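(* Let $0<\theta_0<\pi/2$ and let $\Omega=\{(r\cos\theta,r\sin\theta):r>0,\ |\theta|<\theta_0\}$ (a salient sector). Any non-negative solution $\varphi$ (local variational or very weak) of $-\Delta\varphi=\mathrm{e}^{-\varphi}$ in $\Omega$, $\varphi=0$ on $\partial\Omega$, satisfies $$\varphi(r,\theta)\ \ge\ \log\left(1+\tfrac18\,r^2\sin^2(\theta_0-|\theta|)\right)\qquad\text{for all } r>0,\ |\theta|<\theta_0.$$
   Context: A local variational solution is a function $\varphi$ with $\varphi\in H^1(\mathcal{O})$ for every bounded open $\mathcal{O}\subset\Omega$, zero trace on $\partial\Omega$, and $\int_\Omega\nabla\varphi\cdot\nabla v=\int_\Omega\mathrm{e}^{-\varphi}v$ for all $v\in H^1_0(\Omega)$ with bounded support. A very weak solution is a function $\varphi$ with $\varphi\in L^2(\mathcal{O})$ and $\mathrm{e}^{-\varphi}\in H^{-1}(\mathcal{O})$ for every bounded open $\mathcal{O}\subset\Omega$, and $-\int_\Omega\varphi\,\Delta v=\int_\Omega\mathrm{e}^{-\varphi}v$ for all $v\in H^2\cap H^1_0(\Omega)$ with bounded support. *)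

theory Defs
  imports "HOL-Analysis.Analysis"
begin

subsection \<open>Test functions\<close>

definition partial :: "'a::euclidean_space \<Rightarrow> ('a \<Rightarrow> real) \<Rightarrow> 'a \<Rightarrow> real" where
  "partial b f x = frechet_derivative f (at x) b"

primrec C_k :: "nat \<Rightarrow> ('a::euclidean_space \<Rightarrow> real) \<Rightarrow> bool" where
  "C_k 0 f \<longleftrightarrow> continuous_on UNIV f"
| "C_k (Suc k) f \<longleftrightarrow> (\<forall>x. f differentiable (at x)) \<and> (\<forall>b\<in>Basis. C_k k (partial b f))"

definition smooth :: "('a::euclidean_space \<Rightarrow> real) \<Rightarrow> bool" where
  "smooth f \<longleftrightarrow> (\<forall>k. C_k k f)"

definition test_fun :: "'a::euclidean_space set \<Rightarrow> ('a \<Rightarrow> real) \<Rightarrow> bool" where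
  "test_fun U \<eta> \<longleftrightarrow> smooth \<eta> \<and> compact (closure {x. \<eta> x \<noteq> 0}) \<and> closure {x. \<eta> x \<noteq> 0} \<subseteq> U"


subsection \<open>Sobolev spaces\<close>

text \<open>Elements of the function spaces on an open set \<open>U\<close> are represented by total functions on the
  ambient space; every notion below depends only on the values almost everywhere in \<open>U\<close>.\<close>

definition loc_integrable :: "'a::euclidean_space set \<Rightarrow> ('a \<Rightarrow> real) \<Rightarrow> bool" where
  "loc_integrable U f \<longleftrightarrow> (\<forall>K. compact K \<and> K \<subseteq> U \<longrightarrow> f absolutely_integrable_on K)"

definition L2 :: "'a::euclidean_space set \<Rightarrow> ('a \<Rightarrow> real) set" where
  "L2 U = {f. f \<in> borel_measurable (lebesgue_on U) \<and> integrable (lebesgue_on U) (\<lambda>x. (f x)\<^sup>2)}"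

definition has_weak_partial ::
    "'a::euclidean_space set \<Rightarrow> 'a \<Rightarrow> ('a \<Rightarrow> real) \<Rightarrow> ('a \<Rightarrow> real) \<Rightarrow> bool" where
  "has_weak_partial U b f g \<longleftrightarrow> loc_integrable U f \<and> loc_integrable U g \<and>
     (\<forall>\<eta>. test_fun U \<eta> \<longrightarrow>
        (\<integral>x. f x * partial b \<eta> x \<partial>lebesgue_on U) = - (\<integral>x. g x * \<eta> x \<partial>lebesgue_on U))"

text \<open>Weak derivatives are unique up to null sets, so the choice made here is immaterial in the
  integrals below.\<close>

definition weak_partial :: "'a::euclidean_space set \<Rightarrow> 'a \<Rightarrow> ('a \<Rightarrow> real) \<Rightarrow> 'a \<Rightarrow> real" where
  "weak_partial U b f = (SOME g. has_weak_partial U b f g)"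

definition weak_grad :: "'a::euclidean_space set \<Rightarrow> ('a \<Rightarrow> real) \<Rightarrow> 'a \<Rightarrow> 'a" where
  "weak_grad U f x = (\<Sum>b\<in>Basis. weak_partial U b f x *\<^sub>R b)"

definition weak_laplacian :: "'a::euclidean_space set \<Rightarrow> ('a \<Rightarrow> real) \<Rightarrow> 'a \<Rightarrow> real" where
  "weak_laplacian U f x = (\<Sum>b\<in>Basis. weak_partial U b (weak_partial U b f) x)"

text \<open>\<open>H k U\<close> is the space of functions all of whose weak derivatives of order at most \<open>k\<close>
  are square integrable.\<close>

primrec H :: "nat \<Rightarrow> 'a::euclidean_space set \<Rightarrow> ('a \<Rightarrow> real) set" where
  "H 0 U = L2 U"
| "H (Suc k) U = {f \<in> L2 U. \<forall>b\<in>Basis. \<exists>g\<in>H k U. has_weak_partial U b f g}"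

definition H1_norm :: "'a::euclidean_space set \<Rightarrow> ('a \<Rightarrow> real) \<Rightarrow> real" where
  "H1_norm U f =
     sqrt ((\<integral>x. (f x)\<^sup>2 \<partial>lebesgue_on U) + (\<integral>x. (norm (weak_grad U f x))\<^sup>2 \<partial>lebesgue_on U))"

definition H10 :: "'a::euclidean_space set \<Rightarrow> ('a \<Rightarrow> real) set" where
  "H10 U = {f \<in> H 1 U. \<exists>\<eta>. (\<forall>n::nat. test_fun U (\<eta> n)) \<and>
                              (\<lambda>n. H1_norm U (\<lambda>x. f x - \<eta> n x)) \<longlonglongrightarrow> 0}"

text \<open>A locally integrable function belongs to the dual of \<open>H10 U\<close> if the distribution it
  induces is bounded in the \<open>H1_norm\<close> on test functions, which are dense in \<open>H10 U\<close>.\<close>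

definition H_minus1 :: "'a::euclidean_space set \<Rightarrow> ('a \<Rightarrow> real) set" where
  "H_minus1 U = {f. loc_integrable U f \<and>
     (\<exists>C. \<forall>\<eta>. test_fun U \<eta> \<longrightarrow> \<bar>\<integral>x. f x * \<eta> x \<partial>lebesgue_on U\<bar> \<le> C * H1_norm U \<eta>)}"

definition bounded_support :: "'a::euclidean_space set \<Rightarrow> ('a \<Rightarrow> real) \<Rightarrow> bool" where
  "bounded_support U v \<longleftrightarrow> (\<exists>R. AE x in lebesgue_on U. norm x > R \<longrightarrow> v x = 0)"


subsection \<open>Solutions in a sector\<close>

definition sector :: "real \<Rightarrow> (real \<times> real) set" where
  "sector \<theta>\<^sub>0 = {(r * cos \<theta>, r * sin \<theta>) | r \<theta>. r > 0 \<and> \<bar>\<theta>\<bar> < \<theta>\<^sub>0}"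

text \<open>The trace is the local \<open>L\<^sup>2\<close> limit (with respect to arc length) of the boundary values of
  smooth functions on the closed sector that converge in \<open>H\<^sup>1\<close> on bounded parts of the sector. The
  boundary consists of the two rays at angles \<open>\<theta>\<^sub>0\<close> and \<open>- \<theta>\<^sub>0\<close>, on which \<open>t\<close> is arc length.\<close>

definition zero_trace_sector :: "real \<Rightarrow> (real \<times> real \<Rightarrow> real) \<Rightarrow> bool" where
  "zero_trace_sector \<theta>\<^sub>0 \<phi> \<longleftrightarrow>
     (\<exists>u. (\<forall>n::nat. smooth (u n)) \<and>
          (\<forall>D. open D \<and> bounded D \<and> D \<subseteq> sector \<theta>\<^sub>0 \<longrightarrow>
                 (\<lambda>n. H1_norm D (\<lambda>x. \<phi> x - u n x)) \<longlonglongrightarrow> 0) \<and>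
          (\<forall>\<alpha>\<in>{\<theta>\<^sub>0, - \<theta>\<^sub>0}. \<forall>R>0.
                 (\<lambda>n. LBINT t:{0..R}. (u n (t * cos \<alpha>, t * sin \<alpha>))\<^sup>2) \<longlonglongrightarrow> 0))"

text \<open>The integrability conditions on the right-hand sides make explicit that the integrals exist,
  since the Bochner integral of a non-integrable function is 0 by convention. They hold
  automatically for non-negative \<open>\<phi>\<close>.\<close>

definition local_variational_solution :: "real \<Rightarrow> (real \<times> real \<Rightarrow> real) \<Rightarrow> bool" where
  "local_variational_solution \<theta>\<^sub>0 \<phi> \<longleftrightarrow>
     (\<forall>D. open D \<and> bounded D \<and> D \<subseteq> sector \<theta>\<^sub>0 \<longrightarrow> \<phi> \<in> H 1 D) \<and>
     zero_trace_sector \<theta>\<^sub>0 \<phi> \<and>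
     (\<forall>v \<in> H10 (sector \<theta>\<^sub>0). bounded_support (sector \<theta>\<^sub>0) v \<longrightarrow>
        integrable (lebesgue_on (sector \<theta>\<^sub>0)) (\<lambda>x. exp (- \<phi> x) * v x) \<and>
        (\<integral>x. weak_grad (sector \<theta>\<^sub>0) \<phi> x \<bullet> weak_grad (sector \<theta>\<^sub>0) v x \<partial>lebesgue_on (sector \<theta>\<^sub>0))
          = (\<integral>x. exp (- \<phi> x) * v x \<partial>lebesgue_on (sector \<theta>\<^sub>0)))"

definition very_weak_solution :: "real \<Rightarrow> (real \<times> real \<Rightarrow> real) \<Rightarrow> bool" where
  "very_weak_solution \<theta>\<^sub>0 \<phi> \<longleftrightarrow>
     (\<forall>D. open D \<and> bounded D \<and> D \<subseteq> sector \<theta>\<^sub>0 \<longrightarrow>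
        \<phi> \<in> L2 D \<and> (\<lambda>x. exp (- \<phi> x)) \<in> H_minus1 D) \<and>
     (\<forall>v \<in> H 2 (sector \<theta>\<^sub>0) \<inter> H10 (sector \<theta>\<^sub>0). bounded_support (sector \<theta>\<^sub>0) v \<longrightarrow>
        integrable (lebesgue_on (sector \<theta>\<^sub>0)) (\<lambda>x. exp (- \<phi> x) * v x) \<and>
        - (\<integral>x. \<phi> x * weak_laplacian (sector \<theta>\<^sub>0) v x \<partial>lebesgue_on (sector \<theta>\<^sub>0))
          = (\<integral>x. exp (- \<phi> x) * v x \<partial>lebesgue_on (sector \<theta>\<^sub>0)))"

text \<open>Solutions are classes of functions modulo null sets; their values at individual points are
  those of the continuous representative.\<close>

definition continuous_representative ::
    "'a::euclidean_space set \<Rightarrow> ('a \<Rightarrow> real) \<Rightarrow> ('a \<Rightarrow> real) \<Rightarrow> bool" where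
  "continuous_representative U \<phi> \<psi> \<longleftrightarrow>
     continuous_on U \<psi> \<and> (AE x in lebesgue_on U. \<phi> x = \<psi> x)"

end

theory Submission imports Defs begin

text \<open>Only the interior of the sector matters. On a ball of radius \<open>d\<close> inside the domain the
  non-negative solution dominates the solution of the same equation with zero boundary values,
  which is radial and explicit: \<open>w = 2 ln (a - \<bar>x - x0\<bar>\<^sup>2 / (8 a))\<close> satisfies
  \<open>- \<Delta> w = exp (- w)\<close> where its argument is positive and vanishes at distance \<open>d\<close> from \<open>x0\<close> when
  \<open>a - d\<^sup>2 / (8 a) = 1\<close>. Then \<open>a \<ge> 1\<close> and \<open>a\<^sup>2 = a + d\<^sup>2 / 8 \<ge> 1 + d\<^sup>2 / 8\<close>, so that
  \<open>w x0 = ln (a\<^sup>2) \<ge> ln (1 + d\<^sup>2 / 8)\<close>. For an acute half-angle the sector is an intersection of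
  two half-planes, and the ball about the point with polar coordinates \<open>(r, \<theta>)\<close> of radius
  \<open>r sin (\<theta>\<^sub>0 - \<bar>\<theta>\<bar>)\<close> lies in it (\<open>ball_subset_sector\<close>).

  Both notions of solution imply \<open>- \<Delta> \<phi> = exp (- \<phi>)\<close> in the sense of distributions
  (\<open>variational_imp_distributional\<close>, \<open>very_weak_imp_distributional\<close>). This rests on the
  fundamental lemma of the calculus of variations, by which weak derivatives are determined almost
  everywhere. The comparison is carried out on mollifications \<open>\<phi>_k\<close> of \<open>\<phi>\<close>: by Jensen's inequality
  \<open>- \<Delta> \<phi>_k = (exp (- \<phi>))_k \<ge> exp (- \<phi>_k)\<close>, so \<open>\<phi>_k\<close> is a continuous supersolution, and at an
  interior minimum of \<open>\<phi>_k - w\<close> second differences contradict \<open>\<phi>_k < w\<close>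
  (\<open>mollify_lower_bound\<close>).

  The continuous representative is the locally uniform limit of the \<open>\<phi>_k\<close>. The mollifiers are
  rescaled Laplacians of a smooth radial function that equals \<open>2 ln \<bar>x\<bar>\<close> up to a constant outside
  the unit ball. Hence the difference of two consecutive mollifiers is the Laplacian of a function
  of size \<open>O(1)\<close> supported in a ball of radius \<open>2^(-k)\<close>, and the equation, whose right-hand side is
  bounded by 1 as \<open>\<phi> \<ge> 0\<close>, gives \<open>\<bar>\<phi>_k - \<phi>_(k+1)\<bar> \<le> C 4^(-k)\<close> (\<open>mollify_step\<close>). That the limit agrees
  with \<open>\<phi>\<close> almost everywhere follows from Fubini's theorem and the fundamental lemma
  (\<open>sol_rep_local\<close>).\<close>

section \<open>Calculus of smooth functions\<close>

lemma partial_eq: "(f has_derivative f') (at x) \<Longrightarrow> partial b f x = f' b"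
  unfolding partial_def using frechet_derivative_at by metis

lemma has_derivative_partial:
  "f differentiable (at x) \<Longrightarrow> (f has_derivative frechet_derivative f (at x)) (at x)"
  by (simp add: frechet_derivative_works)

lemma C_k_imp_continuous: "C_k k f \<Longrightarrow> continuous_on UNIV f"
  by (cases k) (auto simp: continuous_on_eq_continuous_at differentiable_imp_continuous_within)

lemma C_k_SucD: "C_k (Suc k) f \<Longrightarrow> C_k k f"
proof (induction k arbitrary: f)
  case 0
  then show ?case using C_k_imp_continuous by fastforce
qed auto

lemma partial_const: "partial b (\<lambda>x::'a::euclidean_space. c) = (\<lambda>x. 0)"
  by (rule ext, subst partial_eq[of _ "\<lambda>_. 0"]) auto

lemma C_k_const: "C_k k (\<lambda>x::'a::euclidean_space. c)"
proof (induction k arbitrary: c)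
  case (Suc k)
  then show ?case by (auto simp: partial_const)
qed auto

lemma partial_add:
  assumes "f differentiable (at x)" "g differentiable (at x)"
  shows "partial b (\<lambda>x. f x + g x) x = partial b f x + partial b g x"
  unfolding partial_def[of b f] partial_def[of b g]
  by (rule partial_eq) (intro derivative_intros has_derivative_partial assms)

lemma partial_mult:
  assumes "f differentiable (at x)" "g differentiable (at x)"
  shows "partial b (\<lambda>x. f x * g x) x = f x * partial b g x + partial b f x * g x"
  unfolding partial_def[of b f] partial_def[of b g]
  by (rule partial_eq) (intro derivative_intros has_derivative_partial assms)

lemma C_k_add: "C_k k f \<Longrightarrow> C_k k g \<Longrightarrow> C_k k (\<lambda>x. f x + g x)"
proof (induction k arbitrary: f g)
  case (Suc k)
  then have "partial b (\<lambda>x. f x + g x) = (\<lambda>x. partial b f x + partial b g x)" for b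
    by (auto simp: partial_add)
  then show ?case using Suc by auto
qed (auto intro: continuous_intros)

lemma C_k_mult: "C_k k f \<Longrightarrow> C_k k g \<Longrightarrow> C_k k (\<lambda>x. f x * g x)"
proof (induction k arbitrary: f g)
  case (Suc k)
  then have "partial b (\<lambda>x. f x * g x) = (\<lambda>x. f x * partial b g x + partial b f x * g x)" for b
    by (auto simp: partial_mult)
  then show ?case using Suc C_k_SucD[OF Suc.prems(1)] C_k_SucD[OF Suc.prems(2)]
    by (auto intro!: C_k_add)
qed (auto intro: continuous_intros)

lemma partial_compose:
  fixes f :: "real \<Rightarrow> real"
  assumes "f differentiable (at (g x))" "g differentiable (at x)"
  shows "partial b (\<lambda>x. f (g x)) x = partial 1 f (g x) * partial b g x"
proof -
  obtain f' where f': "(f has_real_derivative f') (at (g x))"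
    using assms(1) real_differentiable_def by blast
  then have 1: "partial 1 f (g x) = f'"
    using partial_eq[OF f'[unfolded has_field_derivative_def], of 1] by simp
  have "((\<lambda>x. f (g x)) has_derivative (\<lambda>h. f' * frechet_derivative g (at x) h)) (at x)"
    using has_derivative_compose[OF has_derivative_partial[OF assms(2)] f'[unfolded has_field_derivative_def]]
    by simp
  then show ?thesis unfolding 1 partial_def[of b g] by (rule partial_eq)
qed

lemma C_k_compose:
  fixes f :: "real \<Rightarrow> real"
  shows "C_k k f \<Longrightarrow> C_k k g \<Longrightarrow> C_k k (\<lambda>x. f (g x))"
proof (induction k arbitrary: f g)
  case 0
  then show ?case by (auto intro: continuous_on_compose2[where t=UNIV])
next
  case (Suc k)
  have "partial b (\<lambda>x. f (g x)) = (\<lambda>x. partial 1 f (g x) * partial b g x)" for b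
    by (rule ext, rule partial_compose[of f g]) (use Suc.prems in simp_all)
  moreover have "(\<lambda>x. f (g x)) differentiable (at x)" for x
    by (rule differentiable_compose[of f g]) (use Suc.prems in simp_all)
  moreover have "C_k k (\<lambda>x. partial 1 f (g x) * partial b g x)" if "b \<in> Basis" for b
    by (rule C_k_mult[OF Suc.IH]) (use Suc.prems that C_k_SucD[OF Suc.prems(2)] in simp_all)
  ultimately show ?case by simp
qed

lemma partial_inverse:
  assumes "g differentiable (at x)" "g x \<noteq> 0"
  shows "partial b (\<lambda>x. 1 / g x) x = - partial b g x * (1 / g x) * (1 / g x)"
proof -
  have "((\<lambda>x. 1 / g x) has_derivative (\<lambda>h. - frechet_derivative g (at x) h * (1 / g x) * (1 / g x))) (at x)"
    using assms by (auto intro!: derivative_eq_intros has_derivative_partial simp: field_simps power2_eq_square)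
  then show ?thesis unfolding partial_def[of b g] by (rule partial_eq)
qed

lemma C_k_inverse: "C_k k g \<Longrightarrow> (\<And>x. g x \<noteq> 0) \<Longrightarrow> C_k k (\<lambda>x. 1 / g x)"
proof (induction k)
  case 0
  then show ?case by (auto intro: continuous_intros)
next
  case (Suc k)
  have "partial b (\<lambda>x. 1 / g x) = (\<lambda>x. ((-1) * partial b g x) * (1 / g x) * (1 / g x))" for b
    by (rule ext, subst partial_inverse[of g]) (use Suc.prems in simp_all)
  moreover have "C_k k (\<lambda>x. 1 / g x)" using Suc.IH Suc.prems C_k_SucD[OF Suc.prems(1)] by blast
  moreover have "(\<lambda>x. 1 / g x) differentiable (at x)" for x
    using Suc.prems by (intro derivative_intros) auto
  moreover have "C_k k (\<lambda>x. ((-1) * partial b g x) * (1 / g x) * (1 / g x))" if "b \<in> Basis" for b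
    using Suc.prems that calculation(2) by (intro C_k_mult C_k_const) auto
  ultimately show ?case by simp
qed

lemma partial_inner: "partial b (\<lambda>x::'a::euclidean_space. x \<bullet> c) = (\<lambda>x. b \<bullet> c)"
  by (rule ext, rule partial_eq) (auto intro!: derivative_eq_intros)

lemma C_k_inner: "C_k k (\<lambda>x::'a::euclidean_space. x \<bullet> c)"
proof (cases k)
  case 0 then show ?thesis by (auto intro!: continuous_intros)
next
  case (Suc k)
  then show ?thesis by (auto simp: partial_inner C_k_const intro!: derivative_intros)
qed

lemma C_k_sum: "finite I \<Longrightarrow> (\<And>i. i \<in> I \<Longrightarrow> C_k k (f i)) \<Longrightarrow> C_k k (\<lambda>x. \<Sum>i\<in>I. f i x)"
  by (induction I rule: finite_induct) (auto intro: C_k_const C_k_add)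

lemma C_k_prod: "finite I \<Longrightarrow> (\<And>i. i \<in> I \<Longrightarrow> C_k k (f i)) \<Longrightarrow> C_k k (\<lambda>x. \<Prod>i\<in>I. f i x)"
  by (induction I rule: finite_induct) (auto intro: C_k_const C_k_mult)

lemma C_k_norm_sq: "C_k k (\<lambda>x::'a::euclidean_space. x \<bullet> x)"
proof -
  have "(\<lambda>x::'a. x \<bullet> x) = (\<lambda>x. \<Sum>b\<in>Basis. (x \<bullet> b) * (x \<bullet> b))"
    using euclidean_inner by blast
  then show ?thesis by (auto intro!: C_k_sum C_k_mult C_k_inner)
qed

lemma partial_affine:
  fixes f :: "'a::euclidean_space \<Rightarrow> real"
  assumes "f differentiable (at (p + c *\<^sub>R z))"
  shows "partial b (\<lambda>z. f (p + c *\<^sub>R z)) z = c * partial b f (p + c *\<^sub>R z)"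
proof -
  have *: "((\<lambda>z. p + c *\<^sub>R z) has_derivative (\<lambda>h. c *\<^sub>R h)) (at z)"
    by (auto intro!: derivative_eq_intros)
  have "((\<lambda>z. f (p + c *\<^sub>R z)) has_derivative
      (\<lambda>h. frechet_derivative f (at (p + c *\<^sub>R z)) (c *\<^sub>R h))) (at z)"
    using has_derivative_compose[OF * has_derivative_partial[OF assms]] .
  then have "partial b (\<lambda>z. f (p + c *\<^sub>R z)) z = frechet_derivative f (at (p + c *\<^sub>R z)) (c *\<^sub>R b)"
    by (rule partial_eq)
  then show ?thesis
    using linear_scale[OF linear_frechet_derivative[OF assms]] by (simp add: partial_def)
qed

lemma C_k_affine:
  fixes f :: "'a::euclidean_space \<Rightarrow> real"
  shows "C_k k f \<Longrightarrow> C_k k (\<lambda>z. f (p + c *\<^sub>R z))"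
proof (induction k arbitrary: f)
  case 0
  then show ?case by (auto intro!: continuous_on_compose2[where t=UNIV and g=f] continuous_intros)
next
  case (Suc k)
  have "partial b (\<lambda>z. f (p + c *\<^sub>R z)) = (\<lambda>z. c * partial b f (p + c *\<^sub>R z))" for b
    by (rule ext, rule partial_affine[of f]) (use Suc.prems in simp_all)
  moreover have "(\<lambda>z. f (p + c *\<^sub>R z)) differentiable (at x)" for x
    by (rule differentiable_compose[of f]) (use Suc.prems in \<open>auto intro!: derivative_intros\<close>)
  moreover have "C_k k (\<lambda>z. c * partial b f (p + c *\<^sub>R z))" if "b \<in> Basis" for b
    by (rule C_k_mult[OF C_k_const Suc.IH]) (use Suc.prems that in simp)
  ultimately show ?case by simp
qed

lemma smooth_add: "smooth f \<Longrightarrow> smooth g \<Longrightarrow> smooth (\<lambda>x. f x + g x)"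
  by (simp add: smooth_def C_k_add)

lemma smooth_mult: "smooth f \<Longrightarrow> smooth g \<Longrightarrow> smooth (\<lambda>x. f x * g x)"
  by (simp add: smooth_def C_k_mult)

lemma smooth_const: "smooth (\<lambda>x. c)"
  by (simp add: smooth_def C_k_const)

lemma smooth_affine: "smooth f \<Longrightarrow> smooth (\<lambda>z. f (p + c *\<^sub>R z))"
  by (simp add: smooth_def C_k_affine)

lemma smooth_differentiable: "smooth f \<Longrightarrow> f differentiable (at x)"
  unfolding smooth_def by (metis C_k.simps(2))

lemma smooth_partial: "smooth f \<Longrightarrow> b \<in> Basis \<Longrightarrow> smooth (partial b f)"
  unfolding smooth_def by (metis C_k.simps(2))

lemma smooth_continuous: "smooth f \<Longrightarrow> continuous_on S f"
  unfolding smooth_def using C_k_imp_continuous continuous_on_subset by blast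

lemma smooth_by_partials:
  assumes "\<And>x. f differentiable (at x)" "\<And>b. b \<in> Basis \<Longrightarrow> smooth (partial b f)"
  shows "smooth f"
proof -
  have "C_k (Suc k) f" for k using assms by (auto simp: smooth_def)
  then show ?thesis using C_k_SucD unfolding smooth_def by blast
qed

text \<open>The smooth function \<open>exp (- 1 / t)\<close>, extended by 0 to \<open>t \<le> 0\<close>, together with its quotients by
  powers of \<open>t\<close>. The family is closed under differentiation up to linear combinations, which gives
  smoothness by induction for all members at once.\<close>

definition flat_exp :: "nat \<Rightarrow> real \<Rightarrow> real" where
  "flat_exp n t = (if t > 0 then exp (- 1 / t) / t ^ n else 0)"

lemma flat_exp_tendsto_0: "(flat_exp n \<longlongrightarrow> 0) (at 0)"
proof -
  have 1: "((\<lambda>t::real. (1 / t) ^ n / exp (1 / t)) \<longlongrightarrow> 0) (at_right 0)"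
    by (rule filterlim_compose[OF tendsto_power_div_exp_0])
       (use filterlim_inverse_at_top_right in \<open>simp add: inverse_eq_divide\<close>)
  have "(flat_exp n \<longlongrightarrow> 0) (at_right 0)"
    by (rule Lim_transform_eventually[OF 1])
       (auto simp: eventually_at_filter flat_exp_def exp_minus field_simps)
  moreover have "(flat_exp n \<longlongrightarrow> 0) (at_left 0)"
    by (rule Lim_transform_eventually[OF tendsto_const])
       (auto simp: eventually_at_filter flat_exp_def)
  ultimately show ?thesis
    by (simp add: filterlim_split_at)
qed

lemma flat_exp_derivative:
  "(flat_exp n has_real_derivative flat_exp (n + 2) t - real n * flat_exp (n + 1) t) (at t)"
proof -
  consider "t < 0" | "t > 0" | "t = 0" by linarith
  then show ?thesis
  proof cases
    case 1
    have "((\<lambda>_. 0) has_real_derivative flat_exp (n + 2) t - real n * flat_exp (n + 1) t) (at t)"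
      using 1 by (auto simp: flat_exp_def)
    then show ?thesis
      by (rule has_field_derivative_transform_within_open[where S="{..<0}"])
         (use 1 in \<open>auto simp: flat_exp_def\<close>)
  next
    case 2
    have "t ^ m = t * t ^ (m - Suc 0)" if "m \<noteq> 0" for m
      using that by (cases m) auto
    then have "((\<lambda>t. exp (- 1 / t) / t ^ n) has_real_derivative
        flat_exp (n + 2) t - real n * flat_exp (n + 1) t) (at t)"
      using 2 by (cases n) (auto intro!: derivative_eq_intros simp: flat_exp_def field_simps power2_eq_square, metis neq0_conv)
    then show ?thesis
      by (rule has_field_derivative_transform_within_open[where S="{0<..}"])
         (use 2 in \<open>auto simp: flat_exp_def\<close>)
  next
    case 3
    \<comment> \<open>The difference quotient at 0 is the next member of the family.\<close>
    have "((\<lambda>h. flat_exp n h / h) \<longlongrightarrow> 0) (at 0)"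
      by (rule Lim_transform_eventually[OF flat_exp_tendsto_0[of "Suc n"]])
         (auto simp: eventually_at_filter flat_exp_def)
    then show ?thesis using 3 by (simp add: has_field_derivative_iff flat_exp_def)
  qed
qed

lemma partial_flat_exp: "partial 1 (flat_exp n) = (\<lambda>t. flat_exp (n + 2) t - real n * flat_exp (n + 1) t)"
  using partial_eq[OF flat_exp_derivative[unfolded has_field_derivative_def], of 1 n] by (intro ext) simp

lemma C_k_flat_exp: "C_k k (flat_exp n)"
proof (induction k arbitrary: n)
  case 0
  show ?case
    using DERIV_isCont[OF flat_exp_derivative] by (simp add: continuous_on_eq_continuous_at)
next
  case (Suc k)
  have "C_k k (\<lambda>t. flat_exp (n + 2) t + (- real n) * flat_exp (n + 1) t)"
    by (intro C_k_add C_k_mult C_k_const Suc)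
  moreover have "flat_exp n differentiable (at t)" for t
    using flat_exp_derivative real_differentiable_def by blast
  ultimately show ?case
    by (simp add: partial_flat_exp)
qed

lemma flat_exp_0_bounds: "0 \<le> flat_exp n t" "flat_exp 0 t \<le> 1"
  by (auto simp: flat_exp_def)

section \<open>Test functions and weak derivatives\<close>

lemma integral_lebesgue_on_zero_outside:
  fixes f :: "'a::euclidean_space \<Rightarrow> real"
  assumes "S \<in> sets lebesgue" "\<And>x. x \<notin> S \<Longrightarrow> f x = 0"
  shows "integral\<^sup>L (lebesgue_on S) f = integral\<^sup>L lebesgue f"
    and "integrable (lebesgue_on S) f \<longleftrightarrow> integrable lebesgue f"
proof -
  have "(\<lambda>x. if x \<in> S then f x else 0) = f" using assms(2) by auto
  then show "integral\<^sup>L (lebesgue_on S) f = integral\<^sup>L lebesgue f"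
    "integrable (lebesgue_on S) f \<longleftrightarrow> integrable lebesgue f"
    using Lebesgue_Measure.integral_restrict_UNIV[OF assms(1), of f]
      Lebesgue_Measure.integrable_restrict_UNIV[OF assms(1), of f] by auto
qed

lemma open_sets_lebesgue: "open (U::'a::euclidean_space set) \<Longrightarrow> U \<in> sets lebesgue"
  using borel_open[of U] by auto

lemma AE_lebesgue_on_iff:
  "open (U::'a::euclidean_space set) \<Longrightarrow> (AE x in lebesgue_on U. P x) \<longleftrightarrow> (AE x in lebesgue. x \<in> U \<longrightarrow> P x)"
  using open_sets_lebesgue by (subst AE_restrict_space_iff) auto

lemma continuous_measurable_lebesgue:
  "continuous_on UNIV f \<Longrightarrow> f \<in> borel_measurable lebesgue"
  for f :: "'a::euclidean_space \<Rightarrow> real"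
  by (intro measurable_completion) (simp add: borel_measurable_continuous_onI)

lemma measurable_indicator_times:
  fixes f :: "'a::euclidean_space \<Rightarrow> real"
  assumes "f \<in> borel_measurable lebesgue" "open A"
  shows "(\<lambda>x. indicator A x * f x) \<in> borel_measurable lebesgue"
  using assms open_sets_lebesgue by (intro borel_measurable_times borel_measurable_indicator) auto

lemma continuous_compact_support_bounded:
  fixes \<eta> :: "'a::euclidean_space \<Rightarrow> real"
  assumes "continuous_on UNIV \<eta>" "compact K" "\<And>x. x \<notin> K \<Longrightarrow> \<eta> x = 0"
  obtains M where "M > 0" "\<And>x. \<bar>\<eta> x\<bar> \<le> M"
proof -
  have "bounded (\<eta> ` K)"
    using assms by (intro compact_imp_bounded compact_continuous_image) (auto intro: continuous_on_subset)
  then obtain M where M: "M > 0" "\<And>x. x \<in> K \<Longrightarrow> \<bar>\<eta> x\<bar> \<le> M"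
    unfolding bounded_pos by auto
  then have "\<bar>\<eta> x\<bar> \<le> M" for x by (cases "x \<in> K") (use assms(3) in force)+
  then show ?thesis using that M(1) by blast
qed

lemma loc_integrable_mult:
  fixes h \<eta> :: "'a::euclidean_space \<Rightarrow> real"
  assumes "loc_integrable U h" "continuous_on UNIV \<eta>" "compact K" "K \<subseteq> U"
    "\<And>x. x \<notin> K \<Longrightarrow> \<eta> x = 0"
  shows "integrable lebesgue (\<lambda>x. h x * \<eta> x)"
proof -
  obtain M where M: "M > 0" "\<And>x. \<bar>\<eta> x\<bar> \<le> M"
    using continuous_compact_support_bounded assms by metis
  have i: "integrable lebesgue (\<lambda>x. indicator K x * h x)"
    using assms(1,3,4) by (auto simp: loc_integrable_def set_integrable_def)
  have eq: "(\<lambda>x. h x * \<eta> x) = (\<lambda>x. (indicator K x * h x) * \<eta> x)"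
    using assms(5) by (force simp: indicator_def)
  show ?thesis unfolding eq
  proof (rule Bochner_Integration.integrable_bound[of _ "\<lambda>x. M * (indicator K x * h x)"])
    show "AE x in lebesgue. norm (indicator K x * h x * \<eta> x) \<le> norm (M * (indicator K x * h x))"
      using M by (auto simp: abs_mult mult.commute intro!: mult_right_mono)
  qed (use i continuous_measurable_lebesgue[OF assms(2)] in auto)
qed

lemma loc_integrable_continuous_on:
  fixes f :: "'a::euclidean_space \<Rightarrow> real"
  assumes "continuous_on U f"
  shows "loc_integrable U f"
  unfolding loc_integrable_def set_integrable_def
proof clarify
  fix K :: "'a set" assume K: "compact K" "K \<subseteq> U"
  then have "integrable lborel (\<lambda>x. indicator K x *\<^sub>R f x)"
    using assms by (intro borel_integrable_compact continuous_on_subset[OF assms]) auto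
  then show "integrable lebesgue (\<lambda>x. indicator K x *\<^sub>R f x)"
    using integrable_completion borel_measurable_integrable by blast
qed

lemma loc_integrable_continuous:
  fixes f :: "'a::euclidean_space \<Rightarrow> real"
  shows "continuous_on UNIV f \<Longrightarrow> loc_integrable U f"
  by (rule loc_integrable_continuous_on) (rule continuous_on_subset, auto)

lemma loc_integrable_subset: "loc_integrable U f \<Longrightarrow> V \<subseteq> U \<Longrightarrow> loc_integrable V f"
  by (auto simp: loc_integrable_def)

lemma loc_integrable_AE_cong:
  fixes f g :: "'a::euclidean_space \<Rightarrow> real"
  assumes "open U" "loc_integrable U f" "AE x in lebesgue_on U. f x = g x"
  shows "loc_integrable U g"
  unfolding loc_integrable_def
proof clarify
  fix K assume K: "compact K" "K \<subseteq> U"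
  have "AE x in lebesgue. x \<in> U \<longrightarrow> f x = g x"
    using assms(3) by (subst (asm) AE_lebesgue_on_iff[OF assms(1)])
  then obtain N where N: "negligible N" "{x. \<not> (x \<in> U \<longrightarrow> f x = g x)} \<subseteq> N"
    unfolding eventually_ae_filter_negligible by blast
  show "g absolutely_integrable_on K"
    by (rule absolutely_integrable_spike[where f=f and S=N])
       (use assms(2) K N in \<open>auto simp: loc_integrable_def\<close>)
qed

lemma loc_integrable_diff:
  "loc_integrable U f \<Longrightarrow> loc_integrable U g \<Longrightarrow> loc_integrable U (\<lambda>x. f x - g x)"
  by (auto simp: loc_integrable_def)

subsection \<open>The fundamental lemma\<close>

text \<open>Open boxes form an intersection-stable generator of the Borel sets, so vanishing of the integral
  over boxes carries over to all Borel sets. The Dynkin argument is applied to a Borel measurable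
  function equal to \<open>h\<close> almost everywhere.\<close>

lemma AE_zero_of_box_integrals:
  fixes h :: "'a::euclidean_space \<Rightarrow> real"
  assumes h: "integrable lebesgue h" and box: "\<And>a b. (\<integral>x. indicator (box a b) x * h x \<partial>lebesgue) = 0"
  shows "AE x in lebesgue. h x = 0"
proof -
  obtain g where g: "g \<in> borel_measurable lborel" "AE x in lborel. h x = g x"
    using completion_ex_borel_measurable_real[OF borel_measurable_integrable[OF h]] by blast
  have hg: "AE x in lebesgue. h x = g x"
    using g(2) by (rule AE_completion)
  have gl: "g \<in> borel_measurable lebesgue" using g(1) by (rule measurable_completion)
  have "integrable lebesgue g"
    using h integrable_cong_AE[OF borel_measurable_integrable[OF h] gl hg] by blast
  then have ig: "integrable lborel g"
    using integrable_completion[OF g(1)] by blast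
  have int: "(\<integral>x. indicator A x * g x \<partial>lborel) = (\<integral>x. indicator A x * h x \<partial>lebesgue)" if [measurable]: "A \<in> sets borel" for A
  proof -
    have "(\<integral>x. indicator A x * g x \<partial>lborel) = (\<integral>x. indicator A x * g x \<partial>lebesgue)"
      by (rule integral_completion[symmetric]) (use g in measurable)
    also have "\<dots> = (\<integral>x. indicator A x * h x \<partial>lebesgue)"
    proof (rule integral_cong_AE)
      have [measurable]: "A \<in> sets lebesgue" using that by auto
      have [measurable]: "h \<in> borel_measurable lebesgue" using h by blast
      note [measurable] = gl
      show "(\<lambda>x. indicator A x * g x) \<in> borel_measurable lebesgue" by measurable
      show "(\<lambda>x. indicator A x * h x) \<in> borel_measurable lebesgue" by measurable
      show "AE x in lebesgue. indicator A x * g x = indicator A x * h x" using hg by auto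
    qed
    finally show ?thesis .
  qed
  have si: "set_integrable lborel A g" if "A \<in> sets borel" for A
    unfolding set_integrable_def using that ig by (intro integrable_mult_indicator) auto
  have box0: "(\<integral>x. indicator (box a b) x * g x \<partial>lborel) = 0" for a b
    using int[of "box a b"] box by simp
  have total: "(\<integral>x. g x \<partial>lborel) = 0"
  proof -
    have "(\<lambda>n. \<integral>x. indicator (box (- (real n *\<^sub>R One)) (real n *\<^sub>R One)) x * g x \<partial>lborel) \<longlonglongrightarrow> (\<integral>x. g x \<partial>lborel)"
    proof (rule integral_dominated_convergence[where w="\<lambda>x. norm (g x)"])
      show "AE x in lborel. (\<lambda>n. indicator (box (- (real n *\<^sub>R One)) (real n *\<^sub>R One)) x * g x) \<longlonglongrightarrow> g x"
      proof (rule AE_I2)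
        fix x :: 'a
        obtain N where N: "x \<in> box (- (real N *\<^sub>R One)) (real N *\<^sub>R One)"
          using UN_box_eq_UNIV by blast
        have "x \<in> box (- (real n *\<^sub>R One)) (real n *\<^sub>R One)" if "n \<ge> N" for n
          using N of_nat_mono[OF that, where 'a=real] by (force simp: mem_box)
        then have "\<forall>\<^sub>F n in sequentially. g x = indicator (box (- (real n *\<^sub>R One)) (real n *\<^sub>R One)) x * g x"
          by (auto simp: eventually_sequentially intro!: exI[of _ N])
        then show "(\<lambda>n. indicator (box (- (real n *\<^sub>R One)) (real n *\<^sub>R One)) x * g x) \<longlonglongrightarrow> g x"
          by (rule Lim_transform_eventually[OF tendsto_const])
      qed
    qed (use g ig in \<open>auto simp: indicator_def\<close>)
    then show ?thesis using box0 LIMSEQ_unique[OF _ tendsto_const] by force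
  qed
  have "(\<integral>x. indicator A x * g x \<partial>lborel) = 0" if A: "A \<in> sets borel" for A
  proof -
    have "Int_stable (range (\<lambda>(a, b). box a b::'a set))"
      by (auto simp: Int_stable_def box_Int_box)
    moreover have "(range (\<lambda>(a, b). box a b::'a set)) \<subseteq> Pow UNIV" by auto
    moreover have "A \<in> sigma_sets UNIV (range (\<lambda>(a, b). box a b))"
      using A unfolding borel_eq_box by simp
    ultimately show ?thesis
    proof (induction rule: sigma_sets_induct_disjoint)
      case (basic A) then show ?case using box0 by auto
    next
      case empty then show ?case by simp
    next
      case (compl A)
      then have A: "A \<in> sets borel" unfolding borel_eq_box by simp
      have "(\<integral>x. indicator (UNIV - A) x * g x \<partial>lborel) = (\<integral>x. g x - indicator A x * g x \<partial>lborel)"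
        by (rule Bochner_Integration.integral_cong) (auto simp: indicator_def)
      also have "\<dots> = (\<integral>x. g x \<partial>lborel) - (\<integral>x. indicator A x * g x \<partial>lborel)"
        using si[OF A] ig by (intro Bochner_Integration.integral_diff) (auto simp: set_integrable_def)
      finally show ?case using total compl by simp
    next
      case (union A)
      then have A: "A i \<in> sets borel" for i unfolding borel_eq_box by (auto simp: subset_eq)
      have "(LINT x:(\<Union>i. A i)|lborel. g x) = (\<Sum>i. LINT x:A i|lborel. g x)"
        using union(1) A by (intro lebesgue_integral_countable_add si) (auto simp: disjoint_family_on_def)
      then show ?case using union by (simp add: set_lebesgue_integral_def)
    qed
  qed
  then have "AE x in lborel. g x = 0"
    by (intro density_unique_real[OF ig]) (auto simp: set_lebesgue_integral_def)
  then have "AE x in lebesgue. g x = 0" by (rule AE_completion)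
  with hg show ?thesis by auto
qed

lemma smooth_flat_exp_inner:
  "smooth (\<lambda>x::'a::euclidean_space. flat_exp 0 (c * (x \<bullet> b + d)))"
  unfolding smooth_def
  by (intro allI C_k_compose[OF C_k_flat_exp] C_k_mult C_k_add C_k_const C_k_inner)

text \<open>Smooth functions that vanish outside the open box and increase with \<open>n\<close> to its indicator.\<close>

definition box_bump :: "'a::euclidean_space \<Rightarrow> 'a \<Rightarrow> nat \<Rightarrow> 'a \<Rightarrow> real" where
  "box_bump a b n x = (\<Prod>i\<in>Basis. flat_exp 0 (real n * (x \<bullet> i + - (a \<bullet> i)))
                               * flat_exp 0 (- real n * (x \<bullet> i + - (b \<bullet> i))))"

lemma smooth_box_bump: "smooth (box_bump a b n)"
proof -
  have "C_k k (\<lambda>x. \<Prod>i\<in>Basis. flat_exp 0 (real n * (x \<bullet> i + - (a \<bullet> i)))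
                               * flat_exp 0 (- real n * (x \<bullet> i + - (b \<bullet> i))))" for k
    by (intro C_k_prod C_k_mult smooth_flat_exp_inner[unfolded smooth_def, rule_format] finite_Basis)
  then show ?thesis unfolding smooth_def box_bump_def[abs_def] by blast
qed

lemma box_bump_bounds: "0 \<le> box_bump a b n x" "box_bump a b n x \<le> 1"
  unfolding box_bump_def
  by (auto intro!: prod_nonneg prod_le_1 mult_nonneg_nonneg mult_le_one flat_exp_0_bounds)

lemma box_bump_outside: "x \<notin> box a b \<Longrightarrow> box_bump a b n x = 0"
  unfolding box_bump_def mem_box
  by (auto simp: flat_exp_def zero_less_mult_iff mult_less_0_iff)

lemma box_bump_tendsto: "(\<lambda>n. box_bump a b n x) \<longlonglongrightarrow> indicator (box a b) x"
proof (cases "x \<in> box a b")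
  case True
  have lim: "(\<lambda>n. flat_exp 0 (real n * t)) \<longlonglongrightarrow> 1" if "t > 0" for t
  proof -
    have "(\<lambda>n. exp (- (1 / t) * inverse (real n))) \<longlonglongrightarrow> exp (- (1 / t) * 0)"
      by (intro tendsto_intros lim_inverse_n)
    then have "(\<lambda>n. exp (- 1 / (real n * t))) \<longlonglongrightarrow> 1"
      by (simp add: field_simps)
    moreover have "\<forall>\<^sub>F n in sequentially. exp (- 1 / (real n * t)) = flat_exp 0 (real n * t)"
      unfolding eventually_sequentially using that by (intro exI[of _ 1]) (auto simp: flat_exp_def)
    ultimately show ?thesis by (rule Lim_transform_eventually)
  qed
  have "(\<lambda>n. box_bump a b n x) \<longlonglongrightarrow> (\<Prod>i\<in>(Basis::'a set). 1 * 1)"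
    unfolding box_bump_def
  proof (intro tendsto_prod tendsto_mult)
    fix i :: 'a assume i: "i \<in> Basis"
    show "(\<lambda>n. flat_exp 0 (real n * (x \<bullet> i + - (a \<bullet> i)))) \<longlonglongrightarrow> 1"
      using True i by (intro lim) (auto simp: mem_box)
    have "(\<lambda>n. flat_exp 0 (real n * (b \<bullet> i - x \<bullet> i))) \<longlonglongrightarrow> 1"
      using True i by (intro lim) (auto simp: mem_box)
    then show "(\<lambda>n. flat_exp 0 (- real n * (x \<bullet> i + - (b \<bullet> i)))) \<longlonglongrightarrow> 1"
      by (simp add: algebra_simps)
  qed
  then show ?thesis using True by simp
qed (simp add: box_bump_outside)

lemma test_funI:
  assumes "smooth \<eta>" "compact K" "K \<subseteq> U" "\<And>x. x \<notin> K \<Longrightarrow> \<eta> x = 0"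
  shows "test_fun U \<eta>"
proof -
  have "{x. \<eta> x \<noteq> 0} \<subseteq> K" using assms(4) by auto
  then have K: "closure {x. \<eta> x \<noteq> 0} \<subseteq> K"
    using assms(2) by (simp add: closure_minimal compact_imp_closed)
  then have "compact (closure {x. \<eta> x \<noteq> 0})"
    using assms(2) by (meson bounded_closure bounded_subset closure_subset compact_closure compact_imp_bounded order_trans)
  then show ?thesis unfolding test_fun_def using assms K by blast
qed

lemma test_funE:
  assumes "test_fun U \<eta>"
  obtains K where "smooth \<eta>" "compact K" "K \<subseteq> U" "\<And>x. x \<notin> K \<Longrightarrow> \<eta> x = 0"
  using assms closure_subset[of "{x. \<eta> x \<noteq> 0}"]
  by (intro that[of "closure {x. \<eta> x \<noteq> 0}"]) (auto simp: test_fun_def)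

lemma loc_integrable_mult_test:
  assumes "loc_integrable U h" "test_fun U \<eta>"
  shows "integrable lebesgue (\<lambda>x. h x * \<eta> x)"
proof -
  obtain K where "smooth \<eta>" "compact K" "K \<subseteq> U" "\<And>x. x \<notin> K \<Longrightarrow> \<eta> x = 0"
    using assms(2) test_funE by blast
  then show ?thesis
    using assms(1) smooth_continuous by (intro loc_integrable_mult[of U h \<eta> K])
qed

lemma integral_test_lebesgue_on:
  fixes \<eta> :: "'a::euclidean_space \<Rightarrow> real"
  assumes "open U" "test_fun U \<eta>"
  shows "(\<integral>x. h x * \<eta> x \<partial>lebesgue_on U) = (\<integral>x. h x * \<eta> x \<partial>lebesgue)"
proof -
  have "\<eta> x = 0" if "x \<notin> U" for x
    using test_funE[OF assms(2)] that by (metis subsetD)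
  then show ?thesis
    by (intro integral_lebesgue_on_zero_outside(1) open_sets_lebesgue[OF assms(1)]) simp
qed

text \<open>The fundamental lemma of the calculus of variations. Bumps exhausting a box \<open>box a b\<close> show that the
  integral of \<open>h\<close> over it vanishes; \<open>U\<close> is a countable union of closed boxes.\<close>

theorem fundamental_lemma:
  fixes h :: "'a::euclidean_space \<Rightarrow> real"
  assumes U: "open U" and h: "loc_integrable U h"
    and zero: "\<And>\<eta>. test_fun U \<eta> \<Longrightarrow> (\<integral>x. h x * \<eta> x \<partial>lebesgue_on U) = 0"
  shows "AE x in lebesgue_on U. h x = 0"
proof -
  have cb: "AE x in lebesgue. x \<in> cbox p q \<longrightarrow> h x = 0" if pq: "cbox p q \<subseteq> U" for p q
  proof -
    have i: "integrable lebesgue (\<lambda>x. indicator (cbox p q) x * h x)"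
      using h pq by (auto simp: loc_integrable_def set_integrable_def)
    have bx: "(\<integral>x. indicator (box a b) x * h x \<partial>lebesgue) = 0" if ab: "box a b \<subseteq> box p q" for a b
    proof -
      have sub: "box a b \<subseteq> cbox p q" using ab box_subset_cbox by blast
      have "(\<lambda>n. \<integral>x. h x * box_bump a b n x \<partial>lebesgue) \<longlonglongrightarrow> (\<integral>x. indicator (box a b) x * h x \<partial>lebesgue)"
      proof (rule integral_dominated_convergence[where w="\<lambda>x. norm (indicator (cbox p q) x * h x)"])
        show meas: "(\<lambda>x. indicator (box a b) x * h x) \<in> borel_measurable lebesgue"
        proof -
          have "(\<lambda>x. indicator (box a b) x * (indicator (cbox p q) x * h x)) \<in> borel_measurable lebesgue"
            by (intro measurable_indicator_times borel_measurable_integrable i open_box)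
          then show ?thesis
            by (rule measurable_cong[THEN iffD1, rotated]) (use sub in \<open>auto simp: indicator_def\<close>)
        qed
        show "(\<lambda>x. h x * box_bump a b n x) \<in> borel_measurable lebesgue" for n
        proof -
          have "(\<lambda>x. (indicator (box a b) x * h x) * box_bump a b n x) \<in> borel_measurable lebesgue"
            by (intro borel_measurable_times meas continuous_measurable_lebesgue smooth_continuous
                smooth_box_bump)
          then show ?thesis
            by (rule measurable_cong[THEN iffD1, rotated]) (use box_bump_outside in \<open>fastforce simp: indicator_def\<close>)
        qed
        show "AE x in lebesgue. (\<lambda>n. h x * box_bump a b n x) \<longlonglongrightarrow> indicator (box a b) x * h x"
        proof (rule AE_I2)
          fix x
          show "(\<lambda>n. h x * box_bump a b n x) \<longlonglongrightarrow> indicator (box a b) x * h x"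
            using tendsto_mult[OF tendsto_const box_bump_tendsto, of "h x" a b x]
            by (simp only: mult.commute)
        qed
        show "AE x in lebesgue. norm (h x * box_bump a b n x) \<le> norm (indicator (cbox p q) x * h x)" for n
        proof (rule AE_I2)
          fix x
          show "norm (h x * box_bump a b n x) \<le> norm (indicator (cbox p q) x * h x)"
          proof (cases "x \<in> box a b")
            case True
            then have "x \<in> cbox p q" using sub by blast
            then show ?thesis
              using box_bump_bounds[of a b n x] by (simp add: abs_mult mult_left_le)
          qed (simp add: box_bump_outside)
        qed
      qed (use i in auto)
      moreover have "(\<integral>x. h x * box_bump a b n x \<partial>lebesgue) = 0" for n
      proof (cases "box a b = {}")
        case True
        then show ?thesis using box_bump_outside[of _ a b n] by simp
      next
        case False
        then have "cbox a b \<subseteq> cbox p q"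
          using ab by (metis closure_box closure_mono box_eq_empty(1) subset_empty)
        then have "test_fun U (box_bump a b n)"
          using pq by (intro test_funI[of _ "cbox a b"] smooth_box_bump)
             (auto intro!: box_bump_outside dest: box_subset_cbox[THEN subsetD])
        then show ?thesis using zero integral_test_lebesgue_on[OF U] by metis
      qed
      ultimately show ?thesis using LIMSEQ_unique[OF _ tendsto_const] by force
    qed
    have "negligible (cbox p q - box p q)" by (rule negligible_frontier_interval)
    then have neg: "AE x in lebesgue. x \<notin> cbox p q - box p q"
      unfolding eventually_ae_filter_negligible by blast
    have "AE x in lebesgue. indicator (cbox p q) x * h x = 0"
    proof (rule AE_zero_of_box_integrals[OF i])
      fix a b
      obtain c d where cd: "box a b \<inter> box p q = box c d" using box_Int_box by blast
      have "(\<integral>x. indicator (box a b) x * (indicator (cbox p q) x * h x) \<partial>lebesgue) =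
        (\<integral>x. indicator (box c d) x * (indicator (cbox p q) x * h x) \<partial>lebesgue)"
      proof (rule integral_cong_AE)
        show "(\<lambda>x. indicator (box a b) x * (indicator (cbox p q) x * h x)) \<in> borel_measurable lebesgue"
          "(\<lambda>x. indicator (box c d) x * (indicator (cbox p q) x * h x)) \<in> borel_measurable lebesgue"
          by (intro measurable_indicator_times borel_measurable_integrable i open_box)+
        show "AE x in lebesgue. indicator (box a b) x * (indicator (cbox p q) x * h x) =
          indicator (box c d) x * (indicator (cbox p q) x * h x)"
          using neg by eventually_elim (use cd in \<open>auto simp: indicator_def\<close>)
      qed
      also have "\<dots> = (\<integral>x. indicator (box c d) x * h x \<partial>lebesgue)"
        by (rule Bochner_Integration.integral_cong)
           (use cd box_subset_cbox[of p q] in \<open>auto simp: indicator_def\<close>)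
      also have "\<dots> = 0" using bx[of c d] cd by blast
      finally show "(\<integral>x. indicator (box a b) x * (indicator (cbox p q) x * h x) \<partial>lebesgue) = 0" .
    qed
    then show ?thesis by eventually_elim (auto simp: indicator_def)
  qed
  obtain D where D: "countable D" "\<And>X. X \<in> D \<Longrightarrow> X \<subseteq> U" "\<And>X. X \<in> D \<Longrightarrow> \<exists>a b. X = cbox a b" "\<Union>D = U"
    using open_countable_Union_open_cbox[OF U] by (metis PowD subsetD)
  have "AE x in lebesgue. \<forall>X\<in>D. x \<in> X \<longrightarrow> h x = 0"
    using cb D by (subst AE_ball_countable) (auto, metis)
  then have "AE x in lebesgue. x \<in> U \<longrightarrow> h x = 0"
    by eventually_elim (use D(4) in blast)
  then show ?thesis by (subst AE_lebesgue_on_iff[OF U])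
qed

subsection \<open>Integration by parts\<close>

lemma test_fun_smooth: "test_fun U \<eta> \<Longrightarrow> smooth \<eta>"
  by (simp add: test_fun_def)

lemma test_fun_mono: "test_fun U \<eta> \<Longrightarrow> U \<subseteq> V \<Longrightarrow> test_fun V \<eta>"
  by (auto simp: test_fun_def)

lemma test_fun_partial:
  assumes "test_fun U \<eta>" "b \<in> Basis"
  shows "test_fun U (partial b \<eta>)"
proof -
  obtain K where K: "smooth \<eta>" "compact K" "K \<subseteq> U" "\<And>x. x \<notin> K \<Longrightarrow> \<eta> x = 0"
    using test_funE[OF assms(1)] by metis
  have "partial b \<eta> x = 0" if "x \<notin> K" for x
  proof -
    have "(\<eta> has_derivative (\<lambda>_. 0)) (at x)"
      by (rule has_derivative_transform_within_open[of "\<lambda>_. 0" _ _ UNIV "- K"])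
         (use K that in \<open>auto simp: compact_imp_closed\<close>)
    then show ?thesis by (rule partial_eq)
  qed
  then show ?thesis using K assms(2) by (intro test_funI[of _ K] smooth_partial) auto
qed

lemma has_derivative_line:
  fixes f :: "'a::euclidean_space \<Rightarrow> real"
  assumes "smooth f"
  shows "((\<lambda>t. f (x + t *\<^sub>R b)) has_real_derivative partial b f (x + t *\<^sub>R b)) (at t)"
proof -
  let ?D = "frechet_derivative f (at (x + t *\<^sub>R b))"
  have d: "f differentiable (at (x + t *\<^sub>R b))" using smooth_differentiable[OF assms] .
  have 1: "((\<lambda>t. x + t *\<^sub>R b) has_derivative (\<lambda>h. h *\<^sub>R b)) (at t)"
    by (auto intro!: derivative_eq_intros)
  have "((\<lambda>t. f (x + t *\<^sub>R b)) has_derivative (\<lambda>h. ?D (h *\<^sub>R b))) (at t)"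
    using has_derivative_compose[OF 1 has_derivative_partial[OF d]] .
  moreover have "?D (h *\<^sub>R b) = partial b f (x + t *\<^sub>R b) * h" for h
    using linear_scale[OF linear_frechet_derivative[OF d]] by (simp add: partial_def)
  ultimately show ?thesis by (simp add: has_field_derivative_def)
qed

lemma integral_lebesgue_translation:
  fixes f :: "'a::euclidean_space \<Rightarrow> real"
  assumes "f \<in> borel_measurable borel"
  shows "(\<integral>x. f (x + c) \<partial>lebesgue) = (\<integral>x. f x \<partial>lebesgue)"
proof -
  have "(\<integral>x. f x \<partial>lebesgue) = (\<integral>x. f x \<partial>distr lborel borel ((+) c))"
    using assms by (simp add: lborel_distr_plus integral_completion)
  also have "\<dots> = (\<integral>x. f (c + x) \<partial>lborel)"
    using assms by (intro integral_distr) auto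
  also have "\<dots> = (\<integral>x. f (x + c) \<partial>lebesgue)"
    using assms by (simp add: integral_completion add.commute)
  finally show ?thesis by simp
qed

text \<open>Each difference quotient of \<open>f\<close> in direction \<open>b\<close> has integral 0 by translation invariance, and the
  quotients converge boundedly with uniformly bounded supports.\<close>

lemma integral_partial_test_fun:
  fixes f :: "'a::euclidean_space \<Rightarrow> real"
  assumes f: "test_fun UNIV f" and b: "b \<in> Basis"
  shows "(\<integral>x. partial b f x \<partial>lebesgue) = 0"
proof -
  obtain K where K: "smooth f" "compact K" "\<And>x. x \<notin> K \<Longrightarrow> f x = 0"
    using test_funE[OF f] by metis
  obtain R where R: "R > 0" "K \<subseteq> cball 0 R"
    using bounded_subset_ballD[OF compact_imp_bounded[OF K(2)], of 0] ball_subset_cball by blast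
  obtain K' where K': "compact K'" "\<And>x. x \<notin> K' \<Longrightarrow> partial b f x = 0"
    using test_funE[OF test_fun_partial[OF f b]] by metis
  obtain M where M: "M > 0" "\<And>x. \<bar>partial b f x\<bar> \<le> M"
    using continuous_compact_support_bounded[of "partial b f" K'] K' smooth_continuous[OF smooth_partial[OF K(1) b]]
    by metis
  have cont: "continuous_on UNIV f" using smooth_continuous[OF K(1)] .
  have fint: "integrable lebesgue f"
    using loc_integrable_mult_test[OF loc_integrable_continuous f, of "\<lambda>_. 1"] by simp
  define s where "s n x = (f (x + (1 / real (Suc n)) *\<^sub>R b) - f x) * real (Suc n)" for n x
  have sint: "integrable lebesgue (\<lambda>x. f (x + c))" for c
  proof -
    have "test_fun UNIV (\<lambda>z. f (c + 1 *\<^sub>R z))"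
    proof (rule test_funI[of _ "(\<lambda>z. z - c) ` K"])
      show "smooth (\<lambda>z. f (c + 1 *\<^sub>R z))" using smooth_affine[OF K(1)] .
      show "compact ((\<lambda>z. z - c) ` K)"
        using K(2) by (intro compact_continuous_image continuous_intros)
      show "f (c + 1 *\<^sub>R x) = 0" if "x \<notin> (\<lambda>z. z - c) ` K" for x
        using that by (intro K(3)) (force simp: image_iff)
    qed simp
    then show ?thesis
      using loc_integrable_mult_test[OF loc_integrable_continuous, of "\<lambda>_. 1"] by (simp add: add.commute)
  qed
  have s0: "(\<integral>x. s n x \<partial>lebesgue) = 0" for n
  proof -
    have "(\<integral>x. f (x + c) - f x \<partial>lebesgue) = 0" for c
      using integral_lebesgue_translation[of f c] sint[of c] fint cont
      by (subst Bochner_Integration.integral_diff) (auto simp: borel_measurable_continuous_onI)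
    then show ?thesis unfolding s_def by simp
  qed
  have "(\<lambda>n. \<integral>x. s n x \<partial>lebesgue) \<longlonglongrightarrow> (\<integral>x. partial b f x \<partial>lebesgue)"
  proof (rule integral_dominated_convergence[where w="\<lambda>x. M * indicator (cball 0 (R + 1)) x"])
    show "partial b f \<in> borel_measurable lebesgue"
      using smooth_continuous[OF smooth_partial[OF K(1) b]] continuous_measurable_lebesgue by blast
    show "s n \<in> borel_measurable lebesgue" for n
      unfolding s_def[abs_def] using sint fint by (intro borel_measurable_times borel_measurable_diff) auto
    show "integrable lebesgue (\<lambda>x::'a. M * indicator (cball 0 (R + 1)) x)"
      using emeasure_bounded_finite[OF bounded_cball, of "0::'a" "R + 1"]
      by (intro integrable_mult_right integrable_real_indicator) auto
    show "AE x in lebesgue. (\<lambda>n. s n x) \<longlonglongrightarrow> partial b f x"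
    proof (rule AE_I2)
      fix x
      have "((\<lambda>h. (f (x + (0 + h) *\<^sub>R b) - f (x + 0 *\<^sub>R b)) / h) \<longlongrightarrow> partial b f (x + 0 *\<^sub>R b)) (at 0)"
        using has_derivative_line[OF K(1)] by (rule DERIV_D)
      then have d: "((\<lambda>h. (f (x + h *\<^sub>R b) - f x) / h) \<longlongrightarrow> partial b f x) (at 0)" by simp
      have "filterlim (\<lambda>n. 1 / real (Suc n)) (at 0) sequentially"
        unfolding filterlim_at using LIMSEQ_inverse_real_of_nat by (simp add: inverse_eq_divide)
      from filterlim_compose[OF d this] show "(\<lambda>n. s n x) \<longlonglongrightarrow> partial b f x"
        by (simp add: s_def mult.commute)
    qed
    show "AE x in lebesgue. norm (s n x) \<le> M * indicator (cball 0 (R + 1)) x" for n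
    proof (rule AE_I2)
      fix x :: 'a
      let ?t = "1 / real (Suc n)"
      show "norm (s n x) \<le> M * indicator (cball 0 (R + 1)) x"
      proof (cases "x \<in> cball 0 (R + 1)")
        case True
        \<comment> \<open>By the mean value theorem the quotient is a value of the derivative.\<close>
        have "\<exists>z>0. z < ?t \<and> f (x + ?t *\<^sub>R b) - f (x + 0 *\<^sub>R b) = (?t - 0) * partial b f (x + z *\<^sub>R b)"
          by (rule MVT2) (auto intro: has_derivative_line K(1))
        then obtain z where "f (x + ?t *\<^sub>R b) - f x = ?t * partial b f (x + z *\<^sub>R b)" by auto
        then have "s n x = partial b f (x + z *\<^sub>R b)" by (simp add: s_def)
        then show ?thesis using M(2) True by simp
      next
        case False
        then have "x \<notin> K" using R by auto
        moreover have "x + ?t *\<^sub>R b \<notin> K"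
        proof
          assume "x + ?t *\<^sub>R b \<in> K"
          then have "x + ?t *\<^sub>R b \<in> cball 0 R" using R(2) by blast
          moreover have "norm x \<le> norm (x + ?t *\<^sub>R b) + norm (?t *\<^sub>R b)"
            using norm_triangle_ineq4[of "x + ?t *\<^sub>R b" "?t *\<^sub>R b"] by simp
          moreover have "norm (?t *\<^sub>R b) \<le> 1" using b by (simp add: divide_simps)
          ultimately show False using False unfolding mem_cball dist_0_norm by linarith
        qed
        ultimately have "f x = 0" "f (x + ?t *\<^sub>R b) = 0" using K(3) by blast+
        then have "s n x = 0" unfolding s_def by (simp only: diff_self mult_zero_left)
        then show ?thesis using M(1) by simp
      qed
    qed
  qed
  then show ?thesis using s0 LIMSEQ_unique[OF _ tendsto_const] by force
qed

lemma test_fun_mult: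
  assumes "smooth f" "test_fun U \<eta>"
  shows "test_fun U (\<lambda>x. f x * \<eta> x)"
proof -
  obtain K where "smooth \<eta>" "compact K" "K \<subseteq> U" "\<And>x. x \<notin> K \<Longrightarrow> \<eta> x = 0"
    using test_funE[OF assms(2)] by metis
  then show ?thesis using assms(1) by (intro test_funI[of _ K] smooth_mult) auto
qed

lemma has_weak_partial_smooth:
  fixes f :: "'a::euclidean_space \<Rightarrow> real"
  assumes U: "open U" and f: "smooth f" and b: "b \<in> Basis"
  shows "has_weak_partial U b f (partial b f)"
  unfolding has_weak_partial_def
proof (intro conjI allI impI)
  show l: "loc_integrable U f" "loc_integrable U (partial b f)"
    using smooth_continuous[OF f] smooth_continuous[OF smooth_partial[OF f b]]
    by (auto intro: loc_integrable_continuous)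
  fix \<eta> assume \<eta>: "test_fun U \<eta>"
  have "0 = (\<integral>x. partial b (\<lambda>x. f x * \<eta> x) x \<partial>lebesgue)"
    using integral_partial_test_fun[OF test_fun_mult[OF f test_fun_mono[OF \<eta>]] b] by simp
  also have "\<dots> = (\<integral>x. f x * partial b \<eta> x + partial b f x * \<eta> x \<partial>lebesgue)"
    using smooth_differentiable[OF f] smooth_differentiable[OF test_fun_smooth[OF \<eta>]]
    by (simp add: partial_mult)
  also have "\<dots> = (\<integral>x. f x * partial b \<eta> x \<partial>lebesgue) + (\<integral>x. partial b f x * \<eta> x \<partial>lebesgue)"
    using l \<eta> b by (intro Bochner_Integration.integral_add loc_integrable_mult_test[of U] test_fun_partial)
  finally show "(\<integral>x. f x * partial b \<eta> x \<partial>lebesgue_on U) = - (\<integral>x. partial b f x * \<eta> x \<partial>lebesgue_on U)"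
    unfolding integral_test_lebesgue_on[OF U \<eta>] integral_test_lebesgue_on[OF U test_fun_partial[OF \<eta> b]]
    by linarith
qed

subsection \<open>Weak derivatives are determined almost everywhere\<close>

lemma integral_test_AE_cong:
  fixes f g :: "'a::euclidean_space \<Rightarrow> real"
  assumes U: "open U" and l: "loc_integrable U f" "loc_integrable U g" and eq: "AE x in lebesgue_on U. f x = g x"
    and \<eta>: "test_fun U \<eta>"
  shows "(\<integral>x. f x * \<eta> x \<partial>lebesgue_on U) = (\<integral>x. g x * \<eta> x \<partial>lebesgue_on U)"
  unfolding integral_test_lebesgue_on[OF U \<eta>]
proof (rule integral_cong_AE)
  obtain K where K: "K \<subseteq> U" "\<And>x. x \<notin> K \<Longrightarrow> \<eta> x = 0"
    using test_funE[OF \<eta>] by metis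
  have "AE x in lebesgue. x \<in> U \<longrightarrow> f x = g x"
    using eq by (subst (asm) AE_lebesgue_on_iff[OF U])
  then show "AE x in lebesgue. f x * \<eta> x = g x * \<eta> x"
    by eventually_elim (use K in force)
qed (use loc_integrable_mult_test[OF _ \<eta>] l in auto)

lemma has_weak_partial_unique:
  fixes f :: "'a::euclidean_space \<Rightarrow> real"
  assumes U: "open U" and b: "b \<in> Basis" and w: "has_weak_partial U b f g" "has_weak_partial U b f' g'"
    and eq: "AE x in lebesgue_on U. f x = f' x"
  shows "AE x in lebesgue_on U. g x = g' x"
proof -
  have l: "loc_integrable U f" "loc_integrable U f'" "loc_integrable U g" "loc_integrable U g'"
    using w by (auto simp: has_weak_partial_def)
  have "AE x in lebesgue_on U. g x - g' x = 0"
  proof (rule fundamental_lemma[OF U])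
    show "loc_integrable U (\<lambda>x. g x - g' x)" using l by (intro loc_integrable_diff)
    fix \<eta> :: "'a \<Rightarrow> real" assume \<eta>: "test_fun U \<eta>"
    have "(\<integral>x. f x * partial b \<eta> x \<partial>lebesgue_on U) = (\<integral>x. f' x * partial b \<eta> x \<partial>lebesgue_on U)"
      by (rule integral_test_AE_cong[OF U l(1,2) eq test_fun_partial[OF \<eta> b]])
    then have "(\<integral>x. g x * \<eta> x \<partial>lebesgue) = (\<integral>x. g' x * \<eta> x \<partial>lebesgue)"
      using w \<eta> unfolding has_weak_partial_def integral_test_lebesgue_on[OF U \<eta>, symmetric] by force
    then show "(\<integral>x. (g x - g' x) * \<eta> x \<partial>lebesgue_on U) = 0"
      unfolding integral_test_lebesgue_on[OF U \<eta>]
      using loc_integrable_mult_test[OF l(3) \<eta>] loc_integrable_mult_test[OF l(4) \<eta>]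
      by (simp add: left_diff_distrib)
  qed
  then show ?thesis by simp
qed

lemma has_weak_partial_cong:
  fixes f :: "'a::euclidean_space \<Rightarrow> real"
  assumes U: "open U" and b: "b \<in> Basis" and w: "has_weak_partial U b f g"
    and eq: "AE x in lebesgue_on U. f x = f' x"
  shows "has_weak_partial U b f' g"
  unfolding has_weak_partial_def
proof (intro conjI allI impI)
  have l: "loc_integrable U f" "loc_integrable U g" using w by (auto simp: has_weak_partial_def)
  show "loc_integrable U g" by fact
  show l': "loc_integrable U f'" using loc_integrable_AE_cong[OF U l(1) eq] .
  fix \<eta> assume \<eta>: "test_fun U \<eta>"
  show "(\<integral>x. f' x * partial b \<eta> x \<partial>lebesgue_on U) = - (\<integral>x. g x * \<eta> x \<partial>lebesgue_on U)"
    using integral_test_AE_cong[OF U l(1) l' eq test_fun_partial[OF \<eta> b]] w \<eta>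
    by (simp add: has_weak_partial_def)
qed

lemma weak_partial_AE:
  fixes f :: "'a::euclidean_space \<Rightarrow> real"
  assumes U: "open U" and b: "b \<in> Basis" and w: "has_weak_partial U b f g"
  shows "has_weak_partial U b f (weak_partial U b f)"
    and "AE x in lebesgue_on U. weak_partial U b f x = g x"
proof -
  show 1: "has_weak_partial U b f (weak_partial U b f)"
    unfolding weak_partial_def using someI[of "has_weak_partial U b f", OF w] .
  show "AE x in lebesgue_on U. weak_partial U b f x = g x"
    by (rule has_weak_partial_unique[OF U b 1 w]) simp
qed

text \<open>The classical Laplacian, meaningful for twice differentiable functions.\<close>

definition laplacian :: "('a::euclidean_space \<Rightarrow> real) \<Rightarrow> 'a \<Rightarrow> real" where
  "laplacian f x = (\<Sum>b\<in>Basis. partial b (partial b f) x)"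

lemma weak_partial_smooth:
  fixes f :: "'a::euclidean_space \<Rightarrow> real"
  assumes "open U" "smooth f" "b \<in> Basis"
  shows "AE x in lebesgue_on U. weak_partial U b f x = partial b f x"
  using weak_partial_AE(2)[OF assms(1,3) has_weak_partial_smooth[OF assms]] .

lemma weak_grad_smooth:
  fixes f :: "'a::euclidean_space \<Rightarrow> real"
  assumes "open U" "smooth f"
  shows "AE x in lebesgue_on U. weak_grad U f x = (\<Sum>b\<in>Basis. partial b f x *\<^sub>R b)"
proof -
  have "AE x in lebesgue_on U. \<forall>b\<in>Basis. weak_partial U b f x = partial b f x"
    using weak_partial_smooth[OF assms] by (intro AE_finite_allI) auto
  then show ?thesis by eventually_elim (simp add: weak_grad_def)
qed

lemma weak_laplacian_smooth:
  fixes f :: "'a::euclidean_space \<Rightarrow> real"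
  assumes U: "open U" and f: "smooth f"
  shows "AE x in lebesgue_on U. weak_laplacian U f x = laplacian f x"
proof -
  have "AE x in lebesgue_on U. weak_partial U b (weak_partial U b f) x = partial b (partial b f) x"
    if b: "b \<in> Basis" for b
  proof -
    have eq: "AE x in lebesgue_on U. partial b f x = weak_partial U b f x"
      using weak_partial_smooth[OF U f b] by eventually_elim simp
    show ?thesis
      using weak_partial_AE(2)[OF U b has_weak_partial_cong[OF U b has_weak_partial_smooth[OF U smooth_partial[OF f b] b] eq]] .
  qed
  then have "AE x in lebesgue_on U. \<forall>b\<in>Basis. weak_partial U b (weak_partial U b f) x = partial b (partial b f) x"
    by (intro AE_finite_allI) auto
  then show ?thesis by eventually_elim (simp add: weak_laplacian_def laplacian_def)
qed

lemma test_fun_L2: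
  fixes \<eta> :: "'a::euclidean_space \<Rightarrow> real"
  assumes U: "open U" and \<eta>: "test_fun U \<eta>"
  shows "\<eta> \<in> L2 U"
proof -
  have c: "continuous_on UNIV \<eta>" using smooth_continuous[OF test_fun_smooth[OF \<eta>]] .
  have "integrable lebesgue (\<lambda>x. \<eta> x * \<eta> x)"
    using loc_integrable_mult_test[OF loc_integrable_continuous[OF c] \<eta>] .
  moreover have "\<eta> x * \<eta> x = 0" if "x \<notin> U" for x
    using test_funE[OF \<eta>] that by (metis mult_zero_left subsetD)
  ultimately have "integrable (lebesgue_on U) (\<lambda>x. \<eta> x * \<eta> x)"
    using integral_lebesgue_on_zero_outside(2)[OF open_sets_lebesgue[OF U], of "\<lambda>x. \<eta> x * \<eta> x"] by simp
  then show ?thesis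
    using continuous_measurable_lebesgue[OF c]
    by (auto simp: L2_def power2_eq_square intro: measurable_restrict_space1)
qed

lemma test_fun_H:
  assumes U: "open U"
  shows "test_fun U \<eta> \<Longrightarrow> \<eta> \<in> H k U"
proof (induction k arbitrary: \<eta>)
  case (Suc k)
  have "partial b \<eta> \<in> H k U \<and> has_weak_partial U b \<eta> (partial b \<eta>)" if "b \<in> Basis" for b
    using Suc.IH has_weak_partial_smooth[OF U test_fun_smooth[OF Suc.prems] that]
      test_fun_partial[OF Suc.prems that] by blast
  then show ?case using test_fun_L2[OF U Suc.prems] by auto
qed (simp add: test_fun_L2[OF U])

lemma H1_norm_zero:
  fixes U :: "'a::euclidean_space set"
  assumes U: "open U"
  shows "H1_norm U (\<lambda>x. 0) = 0"
proof -
  have "AE x in lebesgue_on U. weak_grad U (\<lambda>x. 0) x = 0"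
    using weak_grad_smooth[OF U smooth_const[of 0]] by eventually_elim (simp add: partial_const)
  then have "AE x in lebesgue_on U. (norm (weak_grad U (\<lambda>x. 0) x))\<^sup>2 = 0"
    by eventually_elim simp
  then have "(\<integral>x. (norm (weak_grad U (\<lambda>x. 0) x))\<^sup>2 \<partial>lebesgue_on U) = 0"
    by (rule integral_eq_zero_AE)
  then show ?thesis by (simp add: H1_norm_def)
qed

lemma test_fun_H10:
  assumes "open U" "test_fun U \<eta>"
  shows "\<eta> \<in> H10 U"
  using test_fun_H[OF assms, of 1] assms(2) H1_norm_zero[OF assms(1)]
  by (auto simp: H10_def intro!: exI[of _ "\<lambda>_. \<eta>"])

lemma test_fun_bounded_support:
  fixes \<eta> :: "'a::euclidean_space \<Rightarrow> real"
  assumes "test_fun U \<eta>"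
  shows "bounded_support U \<eta>"
proof -
  obtain K where K: "compact K" "\<And>x. x \<notin> K \<Longrightarrow> \<eta> x = 0" using test_funE[OF assms] by metis
  then obtain R where "K \<subseteq> cball 0 R" using bounded_subset_ballD[OF compact_imp_bounded, of K 0] ball_subset_cball by blast
  then have "\<forall>x. norm x > R \<longrightarrow> \<eta> x = 0" using K by (force simp: subset_eq)
  then show ?thesis unfolding bounded_support_def by (intro exI[of _ R] AE_I2) auto
qed

section \<open>Distributional solutions\<close>

lemma integral_lebesgue_on_AE_cong:
  fixes f g :: "'a::euclidean_space \<Rightarrow> real"
  assumes U: "open U" and eq: "AE x in lebesgue_on U. f x = g x" and g: "integrable (lebesgue_on U) g"
  shows "integral\<^sup>L (lebesgue_on U) f = integral\<^sup>L (lebesgue_on U) g"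
proof -
  have S: "U \<in> sets lebesgue" using open_sets_lebesgue[OF U] .
  have g': "integrable lebesgue (\<lambda>x. if x \<in> U then g x else 0)"
    using Lebesgue_Measure.integrable_restrict_UNIV[OF S] g by blast
  have "AE x in lebesgue. x \<in> U \<longrightarrow> f x = g x"
    using eq by (subst (asm) AE_lebesgue_on_iff[OF U])
  then have ae: "AE x in lebesgue. (if x \<in> U then g x else 0) = (if x \<in> U then f x else 0)"
    by eventually_elim auto
  have "(\<lambda>x. if x \<in> U then f x else 0) \<in> borel_measurable lebesgue"
    by (rule borel_measurable_AE[OF borel_measurable_integrable[OF g'] ae])
  then have "integral\<^sup>L lebesgue (\<lambda>x. if x \<in> U then g x else 0) = integral\<^sup>L lebesgue (\<lambda>x. if x \<in> U then f x else 0)"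
    using g' ae by (intro integral_cong_AE) auto
  then show ?thesis by (simp only: Lebesgue_Measure.integral_restrict_UNIV[OF S])
qed

text \<open>Square integrability on bounded open subsets of \<open>U\<close>, including those reaching up to the boundary,
  gives local integrability because \<open>\<bar>t\<bar> \<le> 1 + t\<^sup>2\<close>.\<close>

lemma loc_integrable_of_L2:
  fixes \<phi> :: "'a::euclidean_space \<Rightarrow> real"
  assumes U: "open U" and L2: "\<And>D. open D \<Longrightarrow> bounded D \<Longrightarrow> D \<subseteq> U \<Longrightarrow> \<phi> \<in> L2 D"
  shows "loc_integrable U \<phi>"
  unfolding loc_integrable_def set_integrable_def
proof clarify
  fix K assume K: "compact K" "K \<subseteq> U"
  obtain R where R: "K \<subseteq> ball 0 R" using bounded_subset_ballD[OF compact_imp_bounded[OF K(1)]] by metis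
  define D where "D = U \<inter> ball 0 R"
  have D: "open D" "bounded D" "D \<subseteq> U" "K \<subseteq> D" using U K R by (auto simp: D_def)
  have S: "D \<in> sets lebesgue" using open_sets_lebesgue[OF D(1)] .
  have "\<phi> \<in> L2 D" using L2 D by blast
  then have mD: "\<phi> \<in> borel_measurable (lebesgue_on D)" and iD: "integrable (lebesgue_on D) (\<lambda>x. (\<phi> x)\<^sup>2)"
    by (auto simp: L2_def)
  note m = borel_measurable_if_I[OF mD S] and i = Lebesgue_Measure.integrable_restrict_UNIV[OF S, THEN iffD2, OF iD]
  have eq: "(\<lambda>x. indicator K x *\<^sub>R \<phi> x) = (\<lambda>x. indicator K x * (if x \<in> D then \<phi> x else 0))"
    using D(4) by (intro ext) (auto simp: indicator_def)
  show "integrable lebesgue (\<lambda>x. indicator K x *\<^sub>R \<phi> x)"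
    unfolding eq
  proof (rule Bochner_Integration.integrable_bound[of _ "\<lambda>x. indicator K x + (if x \<in> D then (\<phi> x)\<^sup>2 else 0)"])
    show "integrable lebesgue (\<lambda>x. indicator K x + (if x \<in> D then (\<phi> x)\<^sup>2 else 0))"
      using i K(1) emeasure_compact_finite[OF K(1)]
      by (intro Bochner_Integration.integrable_add integrable_real_indicator) (auto simp: compact_imp_closed)
    show "AE x in lebesgue. norm (indicator K x * (if x \<in> D then \<phi> x else 0))
        \<le> norm (indicator K x + (if x \<in> D then (\<phi> x)\<^sup>2 else 0))"
    proof (rule AE_I2)
      fix x
      have "\<bar>\<phi> x\<bar> \<le> 1 + (\<phi> x)\<^sup>2"
      proof -
        have "0 \<le> (\<bar>\<phi> x\<bar> - 1)\<^sup>2" by simp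
        then show ?thesis by (simp add: power2_eq_square algebra_simps)
      qed
      then show "norm (indicator K x * (if x \<in> D then \<phi> x else 0))
        \<le> norm (indicator K x + (if x \<in> D then (\<phi> x)\<^sup>2 else 0))"
        by (auto simp: indicator_def)
    qed
    show "(\<lambda>x. indicator K x * (if x \<in> D then \<phi> x else 0)) \<in> borel_measurable lebesgue"
      using K(1) m by (intro borel_measurable_times borel_measurable_indicator) (auto simp: compact_imp_closed)
  qed
qed

text \<open>Solutions of \<open>- \<Delta> \<phi> = exp (- \<phi>)\<close> in \<open>U\<close> in the sense of distributions, with no boundary
  condition.\<close>

definition distributional_solution :: "'a::euclidean_space set \<Rightarrow> ('a \<Rightarrow> real) \<Rightarrow> bool" where
  "distributional_solution U \<phi> \<longleftrightarrow> loc_integrable U \<phi> \<and>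
     (\<forall>\<eta>. test_fun U \<eta> \<longrightarrow>
        (\<integral>x. \<phi> x * laplacian \<eta> x \<partial>lebesgue_on U) = - (\<integral>x. exp (- \<phi> x) * \<eta> x \<partial>lebesgue_on U))"

lemma test_fun_integrable_on:
  fixes \<eta> :: "'a::euclidean_space \<Rightarrow> real"
  assumes "open U" "test_fun U \<eta>" "loc_integrable U h"
  shows "integrable (lebesgue_on U) (\<lambda>x. h x * \<eta> x)"
proof -
  have "\<eta> x = 0" if "x \<notin> U" for x
    using test_funE[OF assms(2)] that by (metis subsetD)
  then show ?thesis
    using loc_integrable_mult_test[OF assms(3,2)] integral_lebesgue_on_zero_outside(2)[OF open_sets_lebesgue[OF assms(1)], of "\<lambda>x. h x * \<eta> x"]
    by simp
qed

lemma test_fun_sum: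
  assumes "finite I" "\<And>i. i \<in> I \<Longrightarrow> test_fun U (f i)"
  shows "test_fun U (\<lambda>x. \<Sum>i\<in>I. f i x)"
proof (rule test_funI[of _ "\<Union>i\<in>I. closure {x. f i x \<noteq> 0}"])
  show "smooth (\<lambda>x. \<Sum>i\<in>I. f i x)"
    using assms by (auto simp: test_fun_def smooth_def intro!: C_k_sum)
  show "compact (\<Union>i\<in>I. closure {x. f i x \<noteq> 0})"
    using assms by (intro compact_UN) (auto simp: test_fun_def)
  show "(\<Union>i\<in>I. closure {x. f i x \<noteq> 0}) \<subseteq> U" using assms by (auto simp: test_fun_def)
  show "(\<Sum>i\<in>I. f i x) = 0" if "x \<notin> (\<Union>i\<in>I. closure {x. f i x \<noteq> 0})" for x
  proof (rule sum.neutral, rule ballI)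
    fix i assume "i \<in> I"
    then show "f i x = 0" using that closure_subset[of "{x. f i x \<noteq> 0}"] by blast
  qed
qed

lemma test_fun_laplacian: "test_fun U \<eta> \<Longrightarrow> test_fun U (laplacian \<eta>)"
  unfolding laplacian_def[abs_def] by (intro test_fun_sum test_fun_partial) auto

lemma very_weak_imp_distributional:
  assumes U: "open (sector \<theta>)" and s: "very_weak_solution \<theta> \<phi>"
  shows "distributional_solution (sector \<theta>) \<phi>"
  unfolding distributional_solution_def
proof (intro conjI allI impI)
  show l: "loc_integrable (sector \<theta>) \<phi>"
    using s by (intro loc_integrable_of_L2[OF U]) (auto simp: very_weak_solution_def)
  fix \<eta> assume \<eta>: "test_fun (sector \<theta>) \<eta>"
  have "- (\<integral>x. \<phi> x * weak_laplacian (sector \<theta>) \<eta> x \<partial>lebesgue_on (sector \<theta>))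
          = (\<integral>x. exp (- \<phi> x) * \<eta> x \<partial>lebesgue_on (sector \<theta>))"
    using s test_fun_H[OF U \<eta>] test_fun_H10[OF U \<eta>] test_fun_bounded_support[OF \<eta>]
    by (auto simp: very_weak_solution_def)
  moreover have "(\<integral>x. \<phi> x * weak_laplacian (sector \<theta>) \<eta> x \<partial>lebesgue_on (sector \<theta>)) =
      (\<integral>x. \<phi> x * laplacian \<eta> x \<partial>lebesgue_on (sector \<theta>))"
  proof (rule integral_lebesgue_on_AE_cong[OF U])
    show "AE x in lebesgue_on (sector \<theta>). \<phi> x * weak_laplacian (sector \<theta>) \<eta> x = \<phi> x * laplacian \<eta> x"
      using weak_laplacian_smooth[OF U test_fun_smooth[OF \<eta>]] by eventually_elim simp
    show "integrable (lebesgue_on (sector \<theta>)) (\<lambda>x. \<phi> x * laplacian \<eta> x)"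
      using test_fun_integrable_on[OF U test_fun_laplacian[OF \<eta>] l] .
  qed
  ultimately show "(\<integral>x. \<phi> x * laplacian \<eta> x \<partial>lebesgue_on (sector \<theta>)) = - (\<integral>x. exp (- \<phi> x) * \<eta> x \<partial>lebesgue_on (sector \<theta>))"
    by linarith
qed

lemma has_weak_partial_subset:
  fixes f :: "'a::euclidean_space \<Rightarrow> real"
  assumes U: "open U" "open V" "V \<subseteq> U" and w: "has_weak_partial U b f g" and b: "b \<in> Basis"
  shows "has_weak_partial V b f g"
  unfolding has_weak_partial_def
proof (intro conjI allI impI)
  show "loc_integrable V f" "loc_integrable V g"
    using w U(3) loc_integrable_subset by (auto simp: has_weak_partial_def)
  fix \<eta> assume \<eta>: "test_fun V \<eta>"
  note \<eta>U = test_fun_mono[OF \<eta> U(3)]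
  show "(\<integral>x. f x * partial b \<eta> x \<partial>lebesgue_on V) = - (\<integral>x. g x * \<eta> x \<partial>lebesgue_on V)"
    using w \<eta>U unfolding has_weak_partial_def integral_test_lebesgue_on[OF U(2) \<eta>]
      integral_test_lebesgue_on[OF U(2) test_fun_partial[OF \<eta> b]]
      integral_test_lebesgue_on[OF U(1) \<eta>U, symmetric]
      integral_test_lebesgue_on[OF U(1) test_fun_partial[OF \<eta>U b], symmetric]
    by blast
qed

text \<open>Weak derivatives on the bounded parts \<open>D n\<close> of \<open>U\<close> agree almost everywhere where they are both
  defined; at \<open>x\<close> the glued function takes the value given by the first part that contains \<open>x\<close>.\<close>

lemma has_weak_partial_glue:
  fixes f :: "'a::euclidean_space \<Rightarrow> real"
  assumes U: "open U" and b: "b \<in> Basis"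
    and ex: "\<And>D. open D \<Longrightarrow> bounded D \<Longrightarrow> D \<subseteq> U \<Longrightarrow> \<exists>g. has_weak_partial D b f g"
  shows "\<exists>g. has_weak_partial U b f g"
proof -
  define D where "D n = U \<inter> ball 0 (real n)" for n :: nat
  have D: "open (D n)" "bounded (D n)" "D n \<subseteq> U" for n using U by (auto simp: D_def)
  have mono: "D m \<subseteq> D n" if "m \<le> n" for m n using that by (auto simp: D_def)
  have "\<forall>n. \<exists>g. has_weak_partial (D n) b f g" using ex[OF D] by (rule allI)
  then obtain g where g: "\<And>n. has_weak_partial (D n) b f (g n)" by metis
  define N where "N x = (LEAST n. x \<in> D n)" for x
  define G where "G x = g (N x) x" for x
  have G: "AE x in lebesgue_on (D n). g n x = G x" for n
  proof -
    have "AE x in lebesgue. x \<in> D m \<longrightarrow> g m x = g n x" if "m \<le> n" for m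
    proof -
      have "AE x in lebesgue_on (D m). g m x = g n x"
        by (rule has_weak_partial_unique[OF D(1) b g has_weak_partial_subset[OF D(1) D(1) mono[OF that] g b]]) simp
      then show ?thesis by (subst (asm) AE_lebesgue_on_iff[OF D(1)])
    qed
    then have "AE x in lebesgue. \<forall>m\<in>{..n}. x \<in> D m \<longrightarrow> g m x = g n x"
      by (intro AE_finite_allI) auto
    then have "AE x in lebesgue. x \<in> D n \<longrightarrow> g n x = G x"
    proof eventually_elim
      case (elim x)
      show ?case
      proof
        assume "x \<in> D n"
        then have "x \<in> D (N x)" "N x \<le> n" unfolding N_def by (auto intro: LeastI Least_le)
        then show "g n x = G x" using elim by (auto simp: G_def)
      qed
    qed
    then show ?thesis by (subst AE_lebesgue_on_iff[OF D(1)])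
  qed
  have lG: "loc_integrable (D n) G" for n
    using loc_integrable_AE_cong[OF D(1) _ G] g by (auto simp: has_weak_partial_def)
  have sub: "\<exists>n. K \<subseteq> D n" if K: "compact K" "K \<subseteq> U" for K
  proof -
    obtain R where R: "K \<subseteq> ball 0 R" using bounded_subset_ballD[OF compact_imp_bounded[OF K(1)]] by metis
    obtain n where "R \<le> real n" using real_arch_simple by blast
    then have "K \<subseteq> D n" using R K(2) by (force simp: D_def)
    then show ?thesis by blast
  qed
  have "has_weak_partial U b f G"
    unfolding has_weak_partial_def
  proof (intro conjI allI impI)
    have loc: "loc_integrable U h" if h: "\<And>n. loc_integrable (D n) h" for h :: "'a \<Rightarrow> real"
      unfolding loc_integrable_def
    proof clarify
      fix K assume K: "compact K" "K \<subseteq> U"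
      obtain n where "K \<subseteq> D n" using sub[OF K] by blast
      then show "h absolutely_integrable_on K" using h[of n] K(1) by (auto simp: loc_integrable_def)
    qed
    show "loc_integrable U f" "loc_integrable U G"
      using g lG by (auto intro!: loc simp: has_weak_partial_def)
    fix \<eta> assume \<eta>: "test_fun U \<eta>"
    then obtain n where "closure {x. \<eta> x \<noteq> 0} \<subseteq> D n" using sub unfolding test_fun_def by meson
    then have \<eta>n: "test_fun (D n) \<eta>" using \<eta> by (auto simp: test_fun_def)
    have lg: "loc_integrable (D n) (g n)" using g[of n] by (auto simp: has_weak_partial_def)
    have "(\<integral>x. f x * partial b \<eta> x \<partial>lebesgue) = - (\<integral>x. g n x * \<eta> x \<partial>lebesgue_on (D n))"
      using g[of n] \<eta>n integral_test_lebesgue_on[OF D(1) test_fun_partial[OF \<eta>n b]]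
      unfolding has_weak_partial_def by metis
    also have "(\<integral>x. g n x * \<eta> x \<partial>lebesgue_on (D n)) = (\<integral>x. G x * \<eta> x \<partial>lebesgue_on (D n))"
      by (rule integral_test_AE_cong[OF D(1) lg lG G \<eta>n])
    also have "\<dots> = (\<integral>x. G x * \<eta> x \<partial>lebesgue)"
      by (rule integral_test_lebesgue_on[OF D(1) \<eta>n])
    finally show "(\<integral>x. f x * partial b \<eta> x \<partial>lebesgue_on U) = - (\<integral>x. G x * \<eta> x \<partial>lebesgue_on U)"
      unfolding integral_test_lebesgue_on[OF U \<eta>] integral_test_lebesgue_on[OF U test_fun_partial[OF \<eta> b]] .
  qed
  then show ?thesis by blast
qed

text \<open>A local variational solution is only known to have weak derivatives on bounded parts of the sector.
  The gradient on the whole sector in its weak formulation is meaningful by the gluing lemma.\<close>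

lemma variational_imp_distributional:
  assumes U: "open (sector \<theta>)" and s: "local_variational_solution \<theta> \<phi>"
  shows "distributional_solution (sector \<theta>) \<phi>"
  unfolding distributional_solution_def
proof (intro conjI allI impI)
  let ?U = "sector \<theta>"
  have H1: "\<phi> \<in> H 1 D" if "open D" "bounded D" "D \<subseteq> ?U" for D
    using s that by (auto simp: local_variational_solution_def)
  show l: "loc_integrable ?U \<phi>"
    using H1 by (intro loc_integrable_of_L2[OF U]) auto
  have w: "has_weak_partial ?U b \<phi> (weak_partial ?U b \<phi>)" if b: "b \<in> Basis" for b
  proof -
    have "\<exists>g. has_weak_partial ?U b \<phi> g"
    proof (rule has_weak_partial_glue[OF U b])
      fix D :: "(real \<times> real) set" assume "open D" "bounded D" "D \<subseteq> ?U"
      then have "\<phi> \<in> H 1 D" using H1 by blast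
      then show "\<exists>g. has_weak_partial D b \<phi> g" using b by auto
    qed
    then show ?thesis using weak_partial_AE(1)[OF U b] by blast
  qed
  then have lw: "loc_integrable ?U (weak_partial ?U b \<phi>)" if "b \<in> Basis" for b
    using that by (auto simp: has_weak_partial_def)
  fix \<eta> assume \<eta>: "test_fun ?U \<eta>"
  have int: "integrable (lebesgue_on ?U) (\<lambda>x. weak_partial ?U b \<phi> x * partial b \<eta> x)" if "b \<in> Basis" for b
    using test_fun_integrable_on[OF U test_fun_partial[OF \<eta> that] lw[OF that]] .
  have "(\<integral>x. weak_grad ?U \<phi> x \<bullet> weak_grad ?U \<eta> x \<partial>lebesgue_on ?U) =
    (\<integral>x. (\<Sum>b\<in>Basis. weak_partial ?U b \<phi> x * partial b \<eta> x) \<partial>lebesgue_on ?U)"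
  proof (rule integral_lebesgue_on_AE_cong[OF U])
    show "AE x in lebesgue_on ?U. weak_grad ?U \<phi> x \<bullet> weak_grad ?U \<eta> x =
        (\<Sum>b\<in>Basis. weak_partial ?U b \<phi> x * partial b \<eta> x)"
      using weak_grad_smooth[OF U test_fun_smooth[OF \<eta>]]
    proof eventually_elim
      case (elim x)
      show ?case
        unfolding elim inner_sum_right
        by (rule sum.cong) (simp_all add: weak_grad_def mult.commute)
    qed
    show "integrable (lebesgue_on ?U) (\<lambda>x. \<Sum>b\<in>Basis. weak_partial ?U b \<phi> x * partial b \<eta> x)"
      using int by (intro Bochner_Integration.integrable_sum)
  qed
  also have "\<dots> = (\<Sum>b\<in>Basis. \<integral>x. weak_partial ?U b \<phi> x * partial b \<eta> x \<partial>lebesgue_on ?U)"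
    using int by (intro Bochner_Integration.integral_sum)
  also have "\<dots> = (\<Sum>b\<in>Basis. - (\<integral>x. \<phi> x * partial b (partial b \<eta>) x \<partial>lebesgue_on ?U))"
    using w test_fun_partial[OF \<eta>] by (intro sum.cong) (auto simp: has_weak_partial_def)
  also have "\<dots> = - (\<Sum>b\<in>Basis. (\<integral>x. \<phi> x * partial b (partial b \<eta>) x \<partial>lebesgue_on ?U))"
    by (rule sum_negf)
  also have "(\<Sum>b\<in>Basis. (\<integral>x. \<phi> x * partial b (partial b \<eta>) x \<partial>lebesgue_on ?U)) =
      (\<integral>x. (\<Sum>b\<in>Basis. \<phi> x * partial b (partial b \<eta>) x) \<partial>lebesgue_on ?U)"
    by (rule Bochner_Integration.integral_sum[symmetric])
       (intro test_fun_integrable_on[OF U _ l] test_fun_partial \<eta>)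
  also have "\<dots> = (\<integral>x. \<phi> x * laplacian \<eta> x \<partial>lebesgue_on ?U)"
    by (simp add: laplacian_def sum_distrib_left)
  finally have "(\<integral>x. weak_grad ?U \<phi> x \<bullet> weak_grad ?U \<eta> x \<partial>lebesgue_on ?U) =
     - (\<integral>x. \<phi> x * laplacian \<eta> x \<partial>lebesgue_on ?U)" .
  moreover have "(\<integral>x. weak_grad ?U \<phi> x \<bullet> weak_grad ?U \<eta> x \<partial>lebesgue_on ?U) =
     (\<integral>x. exp (- \<phi> x) * \<eta> x \<partial>lebesgue_on ?U)"
    using s test_fun_H10[OF U \<eta>] test_fun_bounded_support[OF \<eta>]
    by (auto simp: local_variational_solution_def)
  ultimately show "(\<integral>x. \<phi> x * laplacian \<eta> x \<partial>lebesgue_on ?U) = - (\<integral>x. exp (- \<phi> x) * \<eta> x \<partial>lebesgue_on ?U)"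
    by linarith
qed

section \<open>The sector\<close>

text \<open>For an acute half-angle the sector is the intersection of two half-planes.\<close>

lemma sector_eq:
  assumes "0 < \<theta>\<^sub>0" "\<theta>\<^sub>0 < pi / 2"
  shows "sector \<theta>\<^sub>0 = {p. \<bar>snd p\<bar> * cos \<theta>\<^sub>0 < fst p * sin \<theta>\<^sub>0}"
proof (intro equalityI subsetI)
  fix p assume "p \<in> sector \<theta>\<^sub>0"
  then obtain r \<theta> where p: "p = (r * cos \<theta>, r * sin \<theta>)" "r > 0" "\<bar>\<theta>\<bar> < \<theta>\<^sub>0"
    by (auto simp: sector_def)
  have "0 < sin (\<theta>\<^sub>0 - \<bar>\<theta>\<bar>)" using p assms by (intro sin_gt_zero) auto
  moreover have "\<bar>sin \<theta>\<bar> = sin \<bar>\<theta>\<bar>"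
    using p assms sin_ge_zero[of "-\<theta>"] sin_ge_zero[of \<theta>] by (cases "\<theta> \<ge> 0") auto
  ultimately have "\<bar>sin \<theta>\<bar> * cos \<theta>\<^sub>0 < cos \<theta> * sin \<theta>\<^sub>0"
    by (simp add: sin_diff mult.commute)
  then show "p \<in> {p. \<bar>snd p\<bar> * cos \<theta>\<^sub>0 < fst p * sin \<theta>\<^sub>0}"
    using p(1,2) by (simp add: abs_mult mult.assoc)
next
  fix p assume p: "p \<in> {p. \<bar>snd p\<bar> * cos \<theta>\<^sub>0 < fst p * sin \<theta>\<^sub>0}"
  obtain x y where xy: "p = (x, y)" by fastforce
  have c: "cos \<theta>\<^sub>0 > 0" "sin \<theta>\<^sub>0 > 0" using assms by (auto intro!: cos_gt_zero sin_gt_zero)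
  have i: "\<bar>y\<bar> * cos \<theta>\<^sub>0 < x * sin \<theta>\<^sub>0" using p xy by simp
  have "0 \<le> \<bar>y\<bar> * cos \<theta>\<^sub>0" using c by simp
  then have "0 < x * sin \<theta>\<^sub>0" using i by linarith
  then have x: "x > 0" using c by (simp add: zero_less_mult_iff)
  define r where "r = sqrt (x\<^sup>2 + y\<^sup>2)"
  define \<theta> where "\<theta> = arctan (y / x)"
  have r: "r > 0" using x by (simp add: r_def add_pos_nonneg)
  have s: "sqrt (1 + (y / x)\<^sup>2) = r / x"
  proof -
    have "1 + (y / x)\<^sup>2 = (x\<^sup>2 + y\<^sup>2) / x\<^sup>2" using x by (simp add: field_simps power2_eq_square)
    then show ?thesis using x by (simp add: real_sqrt_divide r_def)
  qed
  have "r * cos \<theta> = x" "r * sin \<theta> = y"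
    using r x by (auto simp: \<theta>_def cos_arctan sin_arctan s)
  moreover have "\<bar>\<theta>\<bar> < \<theta>\<^sub>0"
  proof -
    have "\<bar>y\<bar> / x < tan \<theta>\<^sub>0" using i x c by (simp add: tan_def field_simps)
    then have "arctan (\<bar>y\<bar> / x) < arctan (tan \<theta>\<^sub>0)" by (simp add: arctan_less_iff)
    also have "\<dots> = \<theta>\<^sub>0" using assms by (intro arctan_tan) auto
    finally have "arctan (\<bar>y\<bar> / x) < \<theta>\<^sub>0" .
    moreover have "\<bar>arctan (y / x)\<bar> = arctan (\<bar>y\<bar> / x)"
      using x by (cases "y \<ge> 0") (auto simp: arctan_minus divide_neg_pos arctan_less_zero_iff abs_of_neg)
    ultimately show ?thesis unfolding \<theta>_def by simp
  qed
  ultimately show "p \<in> sector \<theta>\<^sub>0" using r unfolding xy sector_def by force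
qed

lemma open_sector:
  assumes "0 < \<theta>\<^sub>0" "\<theta>\<^sub>0 < pi / 2"
  shows "open (sector \<theta>\<^sub>0)"
  unfolding sector_eq[OF assms] by (intro open_Collect_less continuous_intros)

text \<open>The number \<open>r sin (\<theta>\<^sub>0 - \<bar>\<theta>\<bar>)\<close> is the smaller of the distances to the two lines bounding the
  sector.\<close>

lemma ball_subset_sector:
  assumes \<theta>\<^sub>0: "0 < \<theta>\<^sub>0" "\<theta>\<^sub>0 < pi / 2" and r: "r > 0" "\<bar>\<theta>\<bar> < \<theta>\<^sub>0"
  shows "ball (r * cos \<theta>, r * sin \<theta>) (r * sin (\<theta>\<^sub>0 - \<bar>\<theta>\<bar>)) \<subseteq> sector \<theta>\<^sub>0"
proof
  fix p assume "p \<in> ball (r * cos \<theta>, r * sin \<theta>) (r * sin (\<theta>\<^sub>0 - \<bar>\<theta>\<bar>))"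
  then have d: "dist (r * cos \<theta>, r * sin \<theta>) p < r * sin (\<theta>\<^sub>0 - \<bar>\<theta>\<bar>)" by simp
  obtain x y where xy: "p = (x, y)" by fastforce
  have "\<bar>sin \<theta>\<bar> = sin \<bar>\<theta>\<bar>"
    using r \<theta>\<^sub>0 sin_ge_zero[of "-\<theta>"] sin_ge_zero[of \<theta>] by (cases "\<theta> \<ge> 0") auto
  then have e: "r * sin (\<theta>\<^sub>0 - \<bar>\<theta>\<bar>) = r * cos \<theta> * sin \<theta>\<^sub>0 - \<bar>r * sin \<theta>\<bar> * cos \<theta>\<^sub>0"
    using r by (simp add: sin_diff abs_mult algebra_simps)
  have c: "cos \<theta>\<^sub>0 > 0" "sin \<theta>\<^sub>0 > 0" using \<theta>\<^sub>0 by (auto intro!: cos_gt_zero sin_gt_zero)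
  \<comment> \<open>Cauchy--Schwarz against the unit normal of a bounding line\<close>
  have cs: "a * sin \<theta>\<^sub>0 + b * cos \<theta>\<^sub>0 \<le> sqrt (a\<^sup>2 + b\<^sup>2)" for a b
  proof (rule real_le_rsqrt)
    have "(a * sin \<theta>\<^sub>0 + b * cos \<theta>\<^sub>0)\<^sup>2 + (a * cos \<theta>\<^sub>0 - b * sin \<theta>\<^sub>0)\<^sup>2 =
        (a\<^sup>2 + b\<^sup>2) * ((sin \<theta>\<^sub>0)\<^sup>2 + (cos \<theta>\<^sub>0)\<^sup>2)"
      by algebra
    then have "(a * sin \<theta>\<^sub>0 + b * cos \<theta>\<^sub>0)\<^sup>2 + (a * cos \<theta>\<^sub>0 - b * sin \<theta>\<^sub>0)\<^sup>2 = a\<^sup>2 + b\<^sup>2" by simp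
    then show "(a * sin \<theta>\<^sub>0 + b * cos \<theta>\<^sub>0)\<^sup>2 \<le> a\<^sup>2 + b\<^sup>2"
      using zero_le_power2[of "a * cos \<theta>\<^sub>0 - b * sin \<theta>\<^sub>0"] by linarith
  qed
  have "(r * cos \<theta> - x) * sin \<theta>\<^sub>0 + \<bar>r * sin \<theta> - y\<bar> * cos \<theta>\<^sub>0 < r * sin (\<theta>\<^sub>0 - \<bar>\<theta>\<bar>)"
    using cs[of "r * cos \<theta> - x" "\<bar>r * sin \<theta> - y\<bar>"] d by (simp add: xy dist_Pair_Pair dist_real_def)
  moreover have "\<bar>y\<bar> * cos \<theta>\<^sub>0 \<le> (\<bar>r * sin \<theta>\<bar> + \<bar>r * sin \<theta> - y\<bar>) * cos \<theta>\<^sub>0"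
    using c by (intro mult_right_mono) auto
  ultimately have "\<bar>y\<bar> * cos \<theta>\<^sub>0 < x * sin \<theta>\<^sub>0"
    unfolding e by (simp add: algebra_simps)
  then show "p \<in> sector \<theta>\<^sub>0" by (simp add: sector_eq[OF \<theta>\<^sub>0] xy)
qed

section \<open>Mollifiers adapted to the Laplacian of the plane\<close>

lemma laplacian_add:
  assumes "smooth f" "smooth g"
  shows "laplacian (\<lambda>x. f x + g x) x = laplacian f x + laplacian g x"
proof -
  have "partial b (\<lambda>x. f x + g x) = (\<lambda>x. partial b f x + partial b g x)" for b
    by (rule ext, rule partial_add) (use assms smooth_differentiable in blast)+
  then have "partial b (partial b (\<lambda>x. f x + g x)) x = partial b (partial b f) x + partial b (partial b g) x"
    if b: "b \<in> Basis" for b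
    using partial_add[OF smooth_differentiable[OF smooth_partial[OF assms(1) b]]
        smooth_differentiable[OF smooth_partial[OF assms(2) b]]] by simp
  then show ?thesis by (simp add: laplacian_def sum.distrib)
qed

lemma laplacian_const: "laplacian (\<lambda>x::'a::euclidean_space. c) x = 0"
  by (simp add: laplacian_def partial_const)

lemma partial_cmult: "f differentiable (at x) \<Longrightarrow> partial b (\<lambda>x. c * f x) x = c * partial b f x"
  by (subst partial_mult) (simp_all add: partial_const)

lemma laplacian_cmult:
  assumes "smooth f"
  shows "laplacian (\<lambda>x. c * f x) x = c * laplacian f x"
proof -
  have "partial b (\<lambda>x. c * f x) = (\<lambda>x. c * partial b f x)" for b
    by (rule ext, rule partial_cmult) (use assms smooth_differentiable in blast)
  then have "partial b (partial b (\<lambda>x. c * f x)) x = c * partial b (partial b f) x" if b: "b \<in> Basis" for b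
    using partial_cmult[OF smooth_differentiable[OF smooth_partial[OF assms b]]] by simp
  then show ?thesis by (simp add: laplacian_def sum_distrib_left)
qed

lemma laplacian_affine:
  assumes "smooth f"
  shows "laplacian (\<lambda>z. f (p + c *\<^sub>R z)) x = c\<^sup>2 * laplacian f (p + c *\<^sub>R x)"
proof -
  have *: "partial b (\<lambda>z. f (p + c *\<^sub>R z)) = (\<lambda>z. c * partial b f (p + c *\<^sub>R z))" for b
    by (rule ext, rule partial_affine) (use assms smooth_differentiable in blast)
  have "partial b (\<lambda>z. c * partial b f (p + c *\<^sub>R z)) x = c\<^sup>2 * partial b (partial b f) (p + c *\<^sub>R x)"
    if b: "b \<in> Basis" for b
  proof -
    have "partial b (\<lambda>z. c * partial b f (p + c *\<^sub>R z)) x = c * partial b (\<lambda>z. partial b f (p + c *\<^sub>R z)) x"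
      by (rule partial_cmult) (rule smooth_differentiable[OF smooth_affine[OF smooth_partial[OF assms b]]])
    also have "partial b (\<lambda>z. partial b f (p + c *\<^sub>R z)) x = c * partial b (partial b f) (p + c *\<^sub>R x)"
      by (rule partial_affine) (rule smooth_differentiable[OF smooth_partial[OF assms b]])
    finally show ?thesis by (simp add: power2_eq_square)
  qed
  then show ?thesis by (simp add: laplacian_def * sum_distrib_left)
qed

lemma smooth_laplacian:
  assumes "smooth f"
  shows "smooth (laplacian f)"
proof -
  have "C_k k (partial b (partial b f))" if "b \<in> Basis" for b k
    using smooth_partial[OF smooth_partial[OF assms that] that] by (simp add: smooth_def)
  then have "C_k k (\<lambda>x. \<Sum>b\<in>Basis. partial b (partial b f) x)" for k
    by (intro C_k_sum) auto
  then show ?thesis unfolding smooth_def laplacian_def[abs_def] by blast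
qed

lemma integral_laplacian_test_fun:
  fixes f :: "'a::euclidean_space \<Rightarrow> real"
  assumes "test_fun UNIV f"
  shows "(\<integral>x. laplacian f x \<partial>lebesgue) = 0"
proof -
  have "integrable lebesgue (\<lambda>x. 1 * partial b (partial b f) x)" if "b \<in> Basis" for b
    using that assms
    by (intro loc_integrable_mult_test[of UNIV] loc_integrable_continuous continuous_on_const test_fun_partial)
  then have "(\<integral>x. laplacian f x \<partial>lebesgue) = (\<Sum>b\<in>Basis. \<integral>x. partial b (partial b f) x \<partial>lebesgue)"
    unfolding laplacian_def by (intro Bochner_Integration.integral_sum) simp
  then show ?thesis using integral_partial_test_fun[OF test_fun_partial[OF assms]] by simp
qed

subsection \<open>A smooth subharmonic truncation of the logarithm\<close>

text \<open>A function of \<open>s = \<bar>x\<bar>\<^sup>2\<close> that agrees with \<open>1 / s\<close> for \<open>s \<ge> 1\<close>. The correction in the denominator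
  removes the singularity at 0; since \<open>e(s) = flat_exp 0 (1 - s)\<close> is non-negative and decreasing,
  \<open>s / (s + e(s))\<close> is increasing for \<open>s \<ge> 0\<close>, which makes the potential below subharmonic. The absolute value only
  serves to have a continuous function on the whole line.\<close>

definition trunc_log_deriv :: "real \<Rightarrow> real" where
  "trunc_log_deriv s = 1 / (\<bar>s\<bar> + flat_exp 0 (1 - \<bar>s\<bar>))"

lemma trunc_log_denominator_pos: "0 < \<bar>s\<bar> + flat_exp 0 (1 - \<bar>s\<bar>)"
proof (cases "s = 0")
  case False then show ?thesis using flat_exp_0_bounds(1)[of 0 "1 - \<bar>s\<bar>"] by linarith
qed (simp add: flat_exp_def)

lemma isCont_flat_exp: "isCont (flat_exp n) t"
  using DERIV_isCont[OF flat_exp_derivative] .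

text \<open>An antiderivative; it equals \<open>ln\<close> up to a constant on \<open>{1..}\<close>. The choice among the antiderivatives
  is immaterial.\<close>

definition trunc_log :: "real \<Rightarrow> real" where
  "trunc_log = (SOME F. \<forall>s. (F has_real_derivative trunc_log_deriv s) (at s))"

lemma trunc_log_derivative: "(trunc_log has_real_derivative trunc_log_deriv s) (at s)"
proof -
  have "isCont trunc_log_deriv s" for s
    unfolding trunc_log_deriv_def[abs_def] using trunc_log_denominator_pos[of s]
    by (intro continuous_intros isCont_o2[OF _ isCont_flat_exp]) auto
  then have "\<exists>F. \<forall>x. -\<infinity> < ereal x \<longrightarrow> ereal x < \<infinity> \<longrightarrow> (F has_vector_derivative trunc_log_deriv x) (at x)"
    by (intro einterval_antiderivative) auto
  then have "\<exists>F. \<forall>s. (F has_real_derivative trunc_log_deriv s) (at s)"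
    by (auto simp: has_real_derivative_iff_has_vector_derivative)
  then have "\<forall>s. (trunc_log has_real_derivative trunc_log_deriv s) (at s)"
    unfolding trunc_log_def by (rule someI_ex)
  then show ?thesis by blast
qed

lemma trunc_log_outside:
  assumes "s \<ge> 1"
  shows "trunc_log s = trunc_log 1 + ln s"
proof -
  have "\<exists>c. \<forall>x\<in>{1..}. trunc_log x - ln x = c"
  proof (rule has_field_derivative_zero_constant)
    fix x :: real assume "x \<in> {1..}"
    then have "trunc_log_deriv x = 1 / x" "x > 0" by (auto simp: trunc_log_deriv_def flat_exp_def)
    then have "((\<lambda>x. trunc_log x - ln x) has_real_derivative 0) (at x)"
      using trunc_log_derivative[of x] by (auto intro!: derivative_eq_intros)
    then show "((\<lambda>x. trunc_log x - ln x) has_real_derivative 0) (at x within {1..})"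
      by (rule has_field_derivative_at_within)
  qed simp
  then obtain c where c: "\<forall>x\<in>{1..}. trunc_log x - ln x = c" by blast
  have "trunc_log s - ln s = c" "trunc_log 1 - ln 1 = c" using c assms by (blast intro: atLeast_iff[THEN iffD2])+
  then show ?thesis by simp
qed

text \<open>A smooth function on the plane that equals \<open>2 ln \<bar>x\<bar>\<close> up to a constant outside the unit ball.\<close>

definition log_potential :: "real \<times> real \<Rightarrow> real" where
  "log_potential x = trunc_log (x \<bullet> x)"

text \<open>The reciprocal of \<open>trunc_log_deriv (x \<bullet> x)\<close>, a smooth function of \<open>x\<close>.\<close>

definition log_denominator :: "real \<times> real \<Rightarrow> real" where
  "log_denominator x = x \<bullet> x + flat_exp 0 (1 + (-1) * (x \<bullet> x))"

lemma log_denominator_pos: "0 < log_denominator x"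
  using trunc_log_denominator_pos[of "x \<bullet> x"] by (simp add: log_denominator_def)

lemma smooth_log_denominator: "smooth log_denominator"
  unfolding smooth_def log_denominator_def[abs_def]
  by (intro allI C_k_add C_k_norm_sq C_k_compose[OF C_k_flat_exp] C_k_mult C_k_const)

lemma has_derivative_log_potential:
  "(log_potential has_derivative (\<lambda>h. (2 / log_denominator x) * (x \<bullet> h))) (at x)"
proof -
  have 1: "((\<lambda>x. x \<bullet> x) has_derivative (\<lambda>h. 2 * (x \<bullet> h))) (at x)"
    by (auto intro!: derivative_eq_intros simp: inner_commute)
  have "((\<lambda>x. trunc_log (x \<bullet> x)) has_derivative (\<lambda>h. trunc_log_deriv (x \<bullet> x) * (2 * (x \<bullet> h)))) (at x)"
    using has_derivative_compose[OF 1 trunc_log_derivative[unfolded has_field_derivative_def]] .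
  moreover have "trunc_log_deriv (x \<bullet> x) = 1 / log_denominator x"
    by (simp add: trunc_log_deriv_def log_denominator_def)
  ultimately show ?thesis by (simp add: log_potential_def[abs_def] field_simps)
qed

lemma partial_log_potential: "partial b log_potential = (\<lambda>x. (x \<bullet> (2 *\<^sub>R b)) * (1 / log_denominator x))"
  by (rule ext, subst partial_eq[OF has_derivative_log_potential]) simp

lemma smooth_log_potential: "smooth log_potential"
proof (rule smooth_by_partials)
  show "log_potential differentiable at x" for x
    using has_derivative_log_potential differentiable_def by blast
  show "smooth (partial b log_potential)" for b
    unfolding partial_log_potential smooth_def
  proof (intro allI C_k_mult C_k_inner C_k_inverse)
    show "C_k k log_denominator" for k
      using smooth_log_denominator by (simp add: smooth_def)
    show "log_denominator x \<noteq> 0" for x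
      using log_denominator_pos[of x] by simp
  qed
qed

lemma partial_log_denominator:
  "partial b log_denominator x = (x \<bullet> (2 *\<^sub>R b)) * (1 - flat_exp 2 (1 - x \<bullet> x))"
proof -
  have 1: "((\<lambda>x. 1 - x \<bullet> x) has_derivative (\<lambda>h. - 2 * (x \<bullet> h))) (at x)"
    by (auto intro!: derivative_eq_intros simp: inner_commute)
  have 2: "((\<lambda>x. x \<bullet> x) has_derivative (\<lambda>h. 2 * (x \<bullet> h))) (at x)"
    by (auto intro!: derivative_eq_intros simp: inner_commute)
  have "((\<lambda>x. flat_exp 0 (1 - x \<bullet> x)) has_derivative (\<lambda>h. flat_exp 2 (1 - x \<bullet> x) * (- 2 * (x \<bullet> h)))) (at x)"
    using has_derivative_compose[OF 1 flat_exp_derivative[of 0, unfolded has_field_derivative_def]]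
    by (simp add: numeral_2_eq_2)
  from has_derivative_add[OF 2 this]
  have "(log_denominator has_derivative (\<lambda>h. 2 * (x \<bullet> h) + flat_exp 2 (1 - x \<bullet> x) * (- 2 * (x \<bullet> h)))) (at x)"
    by (simp add: log_denominator_def[abs_def])
  from partial_eq[OF this, of b] show ?thesis by (simp add: algebra_simps)
qed

text \<open>The logarithm is harmonic in the plane, so only the correction in the denominator contributes.
  The cancellation uses that the dimension is 2.\<close>

lemma laplacian_log_potential:
  "laplacian log_potential x =
     4 * (flat_exp 0 (1 - x \<bullet> x) + (x \<bullet> x) * flat_exp 2 (1 - x \<bullet> x)) / (log_denominator x)\<^sup>2"
proof -
  let ?D = "log_denominator x" and ?h = "flat_exp 2 (1 - x \<bullet> x)"
  have D: "?D > 0" by (rule log_denominator_pos)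
  have dD: "log_denominator differentiable (at x)" by (rule smooth_differentiable[OF smooth_log_denominator])
  have p: "partial b (partial b log_potential) x = 2 / ?D - 4 * (x \<bullet> b) * (x \<bullet> b) * ((1 - ?h) / ?D\<^sup>2)" if b: "b \<in> Basis" for b
  proof -
    have "partial b (\<lambda>x. (x \<bullet> (2 *\<^sub>R b)) * (1 / log_denominator x)) x =
      (x \<bullet> (2 *\<^sub>R b)) * partial b (\<lambda>x. 1 / log_denominator x) x + partial b (\<lambda>x. x \<bullet> (2 *\<^sub>R b)) x * (1 / ?D)"
      by (rule partial_mult) (use D dD in \<open>auto intro!: derivative_intros\<close>)
    also have "partial b (\<lambda>x. 1 / log_denominator x) x = - ((x \<bullet> (2 *\<^sub>R b)) * (1 - ?h)) * (1 / ?D) * (1 / ?D)"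
      by (subst partial_inverse[OF dD]) (use D in \<open>simp_all add: partial_log_denominator\<close>)
    finally have "partial b (partial b log_potential) x =
        (x \<bullet> (2 *\<^sub>R b)) * (- ((x \<bullet> (2 *\<^sub>R b)) * (1 - ?h)) * (1 / ?D) * (1 / ?D)) + (b \<bullet> (2 *\<^sub>R b)) * (1 / ?D)"
      unfolding partial_log_potential[of b] partial_inner .
    then show ?thesis
      using b by (simp add: power2_eq_square algebra_simps diff_divide_distrib)
  qed
  have "laplacian log_potential x = (\<Sum>b\<in>(Basis::(real \<times> real) set). 2 / ?D - 4 * (x \<bullet> b) * (x \<bullet> b) * ((1 - ?h) / ?D\<^sup>2))"
    unfolding laplacian_def by (rule sum.cong) (use p in auto)
  also have "\<dots> = 4 / ?D - 4 * (\<Sum>b\<in>(Basis::(real \<times> real) set). (x \<bullet> b) * (x \<bullet> b)) * ((1 - ?h) / ?D\<^sup>2)"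
    by (simp add: sum_subtractf sum_distrib_left sum_distrib_right sum_divide_distrib mult.assoc)
  also have "(\<Sum>b\<in>(Basis::(real \<times> real) set). (x \<bullet> b) * (x \<bullet> b)) = x \<bullet> x"
    by (rule euclidean_inner[symmetric])
  also have "4 / ?D - 4 * (x \<bullet> x) * ((1 - ?h) / ?D\<^sup>2) = 4 * (?D - (x \<bullet> x) * (1 - ?h)) / ?D\<^sup>2"
    using D by (simp add: field_simps power2_eq_square)
  also have "?D - (x \<bullet> x) * (1 - ?h) = flat_exp 0 (1 - x \<bullet> x) + (x \<bullet> x) * ?h"
    by (simp add: log_denominator_def algebra_simps)
  finally show ?thesis .
qed

lemma laplacian_log_potential_nonneg: "0 \<le> laplacian log_potential x"
  unfolding laplacian_log_potential by (intro divide_nonneg_nonneg mult_nonneg_nonneg add_nonneg_nonneg flat_exp_0_bounds(1)) auto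

lemma laplacian_log_potential_outside: "norm x \<ge> 1 \<Longrightarrow> laplacian log_potential x = 0"
proof -
  assume "norm x \<ge> 1"
  then have "1 - x \<bullet> x \<le> 0" by (simp add: dot_square_norm one_le_power)
  then show ?thesis unfolding laplacian_log_potential by (simp add: flat_exp_def)
qed

lemma laplacian_log_potential_minus: "laplacian log_potential (- x) = laplacian log_potential x"
  by (simp add: laplacian_log_potential log_denominator_def)

text \<open>The normalizing constant of the mollifiers.\<close>

definition mollifier_mass :: real where
  "mollifier_mass = (\<integral>x. laplacian log_potential x \<partial>lebesgue)"

lemma test_fun_laplacian_log_potential: "test_fun UNIV (laplacian log_potential)"
  by (rule test_funI[of _ "cball 0 1"])
     (auto intro: smooth_laplacian smooth_log_potential laplacian_log_potential_outside)

lemma mollifier_mass_pos: "0 < mollifier_mass"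
proof -
  let ?r = "laplacian log_potential"
  have i: "integrable lebesgue ?r"
    using loc_integrable_mult_test[OF loc_integrable_continuous[OF continuous_on_const] test_fun_laplacian_log_potential, of 1]
    by simp
  have "mollifier_mass \<ge> 0"
    unfolding mollifier_mass_def using laplacian_log_potential_nonneg by simp
  moreover have "mollifier_mass \<noteq> 0"
  proof
    assume "mollifier_mass = 0"
    then have "AE x in lebesgue. ?r x = 0"
      using integral_nonneg_eq_0_iff_AE[OF i] laplacian_log_potential_nonneg by (simp add: mollifier_mass_def)
    then obtain N where N: "negligible N" "{x. ?r x \<noteq> 0} \<subseteq> N"
      unfolding eventually_ae_filter_negligible by blast
    have "open {x. ?r x \<noteq> 0}"
      using smooth_continuous[OF smooth_laplacian[OF smooth_log_potential]]
      by (intro open_Collect_neq) auto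
    moreover have "(0::real \<times> real) \<in> {x. ?r x \<noteq> 0}"
      using log_denominator_pos[of 0] by (simp add: laplacian_log_potential flat_exp_def)
    ultimately show False
      using N negligible_subset open_not_negligible by blast
  qed
  ultimately show ?thesis by linarith
qed

subsection \<open>The mollifiers and their correctors\<close>

text \<open>The normalized Laplacian of the potential, rescaled to the ball of radius \<open>2^(-k)\<close>; the factor \<open>4^k\<close>
  is the Jacobian in the plane. The summand \<open>0\<close> in the argument, here and below, brings the expression into the form
  \<open>p + c *\<^sub>R x\<close> of the lemmas on affine substitutions.\<close>

definition mollifier :: "nat \<Rightarrow> real \<times> real \<Rightarrow> real" where
  "mollifier k x = (4 ^ k / mollifier_mass) * laplacian log_potential (0 + (2 ^ k) *\<^sub>R x)"

text \<open>The difference of the potential and its dilate. Outside the unit ball it is constant, since both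
  terms are logarithms there; \<open>ln 4\<close> makes that constant 0.\<close>

definition base_corrector :: "real \<times> real \<Rightarrow> real" where
  "base_corrector x = log_potential x + ((- 1) * log_potential (0 + 2 *\<^sub>R x) + ln 4)"

text \<open>The compactly supported function whose Laplacian is the difference of two consecutive mollifiers.\<close>

definition corrector :: "nat \<Rightarrow> real \<times> real \<Rightarrow> real" where
  "corrector k x = (1 / mollifier_mass) * base_corrector (0 + (2 ^ k) *\<^sub>R x)"

lemma smooth_mollifier: "smooth (mollifier k)"
  unfolding mollifier_def[abs_def]
  by (intro smooth_mult smooth_const smooth_affine smooth_laplacian smooth_log_potential)

lemma mollifier_nonneg: "0 \<le> mollifier k x"
  unfolding mollifier_def using mollifier_mass_pos laplacian_log_potential_nonneg by simp

lemma mollifier_minus: "mollifier k (- x) = mollifier k x"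
  unfolding mollifier_def using laplacian_log_potential_minus[of "2 ^ k *\<^sub>R x"] by simp

lemma norm_scaled_ge_1: "norm x \<ge> (1 / 2) ^ k \<Longrightarrow> norm ((2::real) ^ k *\<^sub>R x) \<ge> 1"
  by (simp add: power_divide field_simps)

lemma mollifier_outside: "norm x \<ge> (1 / 2) ^ k \<Longrightarrow> mollifier k x = 0"
  unfolding mollifier_def using norm_scaled_ge_1[of k x] by (simp add: laplacian_log_potential_outside)

lemma smooth_base_corrector: "smooth base_corrector"
  unfolding base_corrector_def[abs_def]
  by (intro smooth_add smooth_mult smooth_const smooth_affine smooth_log_potential)

lemma base_corrector_outside:
  assumes "norm x \<ge> 1"
  shows "base_corrector x = 0"
proof -
  have s: "x \<bullet> x \<ge> 1" using assms by (simp add: dot_square_norm)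
  have "log_potential (2 *\<^sub>R x) = trunc_log (4 * (x \<bullet> x))" by (simp add: log_potential_def)
  also have "\<dots> = trunc_log 1 + (ln 4 + ln (x \<bullet> x))"
    using s by (subst trunc_log_outside) (auto simp: ln_mult)
  finally show ?thesis
    using trunc_log_outside[OF s] by (simp add: base_corrector_def log_potential_def)
qed

lemma laplacian_base_corrector:
  "laplacian base_corrector x = laplacian log_potential x - 4 * laplacian log_potential (0 + 2 *\<^sub>R x)"
proof -
  note s = smooth_log_potential
  note s2 = smooth_affine[OF s, of 0 2]
  note s3 = smooth_mult[OF smooth_const[of "- 1"] s2]
  have "laplacian base_corrector x = laplacian log_potential x +
      (laplacian (\<lambda>x. (- 1) * log_potential (0 + 2 *\<^sub>R x)) x + laplacian (\<lambda>x::real \<times> real. ln 4) x)"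
    unfolding base_corrector_def[abs_def]
    by (simp only: laplacian_add[OF s smooth_add[OF s3 smooth_const]] laplacian_add[OF s3 smooth_const])
  also have "laplacian (\<lambda>x. (- 1) * log_potential (0 + 2 *\<^sub>R x)) x = (- 1) * (2\<^sup>2 * laplacian log_potential (0 + 2 *\<^sub>R x))"
    by (simp only: laplacian_cmult[OF s2] laplacian_affine[OF s])
  finally show ?thesis by (simp add: laplacian_const)
qed

lemma smooth_corrector: "smooth (corrector k)"
  unfolding corrector_def[abs_def]
  by (intro smooth_mult smooth_const smooth_affine smooth_base_corrector)

lemma corrector_outside: "norm x \<ge> (1 / 2) ^ k \<Longrightarrow> corrector k x = 0"
  unfolding corrector_def using norm_scaled_ge_1[of k x] by (simp add: base_corrector_outside)

lemma laplacian_corrector: "laplacian (corrector k) x = mollifier k x - mollifier (Suc k) x"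
proof -
  have "laplacian (corrector k) x = (1 / mollifier_mass) * ((2 ^ k)\<^sup>2 * laplacian base_corrector (0 + (2 ^ k) *\<^sub>R x))"
    unfolding corrector_def[abs_def]
    by (subst laplacian_cmult[OF smooth_affine[OF smooth_base_corrector]])
       (simp only: laplacian_affine[OF smooth_base_corrector])
  also have "((2::real) ^ k)\<^sup>2 = 4 ^ k" by (simp add: power2_eq_square flip: power_mult_distrib)
  finally show ?thesis
    by (simp add: laplacian_base_corrector mollifier_def algebra_simps diff_divide_distrib)
qed

lemma corrector_bounded: "\<exists>C>0. \<forall>k x. \<bar>corrector k x\<bar> \<le> C"
proof -
  obtain M where M: "M > 0" "\<And>x. \<bar>base_corrector x\<bar> \<le> M"
    using continuous_compact_support_bounded[of base_corrector "cball 0 1"] base_corrector_outside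
      smooth_continuous[OF smooth_base_corrector] by (metis compact_cball mem_cball_0 nle_le)
  have "\<bar>corrector k x\<bar> \<le> (1 / mollifier_mass) * M" for k x
    unfolding corrector_def abs_mult using M(2) mollifier_mass_pos by (intro mult_mono) auto
  then show ?thesis using M(1) mollifier_mass_pos by (intro exI[of _ "(1 / mollifier_mass) * M"]) auto
qed

lemma test_fun_shifted:
  fixes f :: "'a::euclidean_space \<Rightarrow> real"
  assumes "smooth f" "\<And>x. norm x \<ge> r \<Longrightarrow> f x = 0" "cball x r \<subseteq> U"
  shows "test_fun U (\<lambda>z. f (x - z))"
proof (rule test_funI[of _ "cball x r"])
  show "smooth (\<lambda>z. f (x - z))" using smooth_affine[OF assms(1), of x "-1"] by simp
  show "f (x - z) = 0" if "z \<notin> cball x r" for z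
    using that by (intro assms(2)) (simp add: dist_norm)
qed (use assms in auto)

lemma laplacian_shifted: "smooth f \<Longrightarrow> laplacian (\<lambda>z. f (x - z)) z = laplacian f (x - z)"
  using laplacian_affine[of f x "-1" z] by simp

lemma integrable_mollifier: "integrable lebesgue (\<lambda>x. mollifier k x)"
proof -
  have "test_fun UNIV (\<lambda>z. mollifier k (0 - z))"
    by (rule test_fun_shifted[OF smooth_mollifier mollifier_outside]) auto
  then show ?thesis
    using loc_integrable_mult_test[OF loc_integrable_continuous[OF continuous_on_const], of UNIV _ 1]
    by (simp add: mollifier_minus)
qed

text \<open>Consecutive mollifiers differ by the Laplacian of a test function, so they have the same
  integral.\<close>

lemma integral_mollifier: "(\<integral>x. mollifier k x \<partial>lebesgue) = 1"
proof (induction k)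
  case 0
  show ?case using mollifier_mass_pos by (simp add: mollifier_def mollifier_mass_def)
next
  case (Suc k)
  have "test_fun UNIV (corrector k)"
    by (rule test_funI[of _ "cball 0 ((1/2)^k)"]) (auto intro: smooth_corrector corrector_outside)
  from integral_laplacian_test_fun[OF this] show ?case
    using Suc integrable_mollifier by (simp add: laplacian_corrector)
qed

section \<open>Mollification\<close>

lemma integrable_mult_bounded_continuous:
  fixes g \<rho> :: "'a::euclidean_space \<Rightarrow> real"
  assumes "integrable lebesgue g" "continuous_on UNIV \<rho>" "\<And>x. \<bar>\<rho> x\<bar> \<le> M"
  shows "integrable lebesgue (\<lambda>z. g z * \<rho> z)"
proof (rule Bochner_Integration.integrable_bound[of _ "\<lambda>z. M * g z"])
  have M: "0 \<le> M" using assms(3)[of 0] by linarith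
  show "AE z in lebesgue. norm (g z * \<rho> z) \<le> norm (M * g z)"
  proof (rule AE_I2)
    fix z
    have "\<bar>g z\<bar> * \<bar>\<rho> z\<bar> \<le> \<bar>g z\<bar> * M" using assms(3) by (intro mult_left_mono) auto
    then show "norm (g z * \<rho> z) \<le> norm (M * g z)" using M by (simp add: abs_mult mult.commute)
  qed
qed (use assms continuous_measurable_lebesgue[OF assms(2)] in auto)

lemma continuous_reflect_shift:
  fixes \<rho> :: "'a::euclidean_space \<Rightarrow> real"
  shows "continuous_on UNIV \<rho> \<Longrightarrow> continuous_on UNIV (\<lambda>z. \<rho> (x - z))"
  by (rule continuous_on_compose2[where t=UNIV]) (auto intro!: continuous_intros)

lemma continuous_convolution:
  fixes g \<rho> :: "'a::euclidean_space \<Rightarrow> real"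
  assumes g: "integrable lebesgue g" and \<rho>: "continuous_on UNIV \<rho>" "\<And>x. \<bar>\<rho> x\<bar> \<le> M"
  shows "continuous_on UNIV (\<lambda>x. \<integral>z. g z * \<rho> (x - z) \<partial>lebesgue)"
  unfolding continuous_on_sequentially
proof (intro ballI allI impI, elim conjE)
  fix x and a :: 'a assume lim: "x \<longlonglongrightarrow> a"
  have i: "integrable lebesgue (\<lambda>z. g z * \<rho> (y - z))" for y
    using integrable_mult_bounded_continuous[OF g continuous_reflect_shift[OF \<rho>(1)]] \<rho>(2) by blast
  have "(\<lambda>n. \<integral>z. g z * \<rho> (x n - z) \<partial>lebesgue) \<longlonglongrightarrow> (\<integral>z. g z * \<rho> (a - z) \<partial>lebesgue)"
  proof (rule integral_dominated_convergence[where w="\<lambda>z. M * \<bar>g z\<bar>"])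
    show "AE z in lebesgue. (\<lambda>n. g z * \<rho> (x n - z)) \<longlonglongrightarrow> g z * \<rho> (a - z)"
    proof (rule AE_I2)
      fix z
      have "(\<lambda>n. \<rho> (x n - z)) \<longlonglongrightarrow> \<rho> (a - z)"
        using \<rho>(1) by (intro continuous_on_tendsto_compose[of UNIV \<rho>] tendsto_intros lim) auto
      then show "(\<lambda>n. g z * \<rho> (x n - z)) \<longlonglongrightarrow> g z * \<rho> (a - z)" by (rule tendsto_mult_left)
    qed
    show "AE z in lebesgue. norm (g z * \<rho> (x n - z)) \<le> M * \<bar>g z\<bar>" for n
    proof (rule AE_I2)
      fix z
      have "\<bar>g z\<bar> * \<bar>\<rho> (x n - z)\<bar> \<le> \<bar>g z\<bar> * M" using \<rho>(2) by (intro mult_left_mono) auto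
      then show "norm (g z * \<rho> (x n - z)) \<le> M * \<bar>g z\<bar>" by (simp add: abs_mult mult.commute)
    qed
  qed (use g i in auto)
  then show "((\<lambda>x. \<integral>z. g z * \<rho> (x - z) \<partial>lebesgue) \<circ> x) \<longlonglongrightarrow> (\<integral>z. g z * \<rho> (a - z) \<partial>lebesgue)"
    by (simp add: o_def)
qed

text \<open>Cauchy's mean value theorem for \<open>w s + w (- s)\<close> against \<open>s\<^sup>2\<close>, followed by the ordinary one for
  \<open>w'\<close>, yields a single intermediate point.\<close>

lemma second_difference_mean_value:
  fixes w w' w'' :: "real \<Rightarrow> real"
  assumes t: "t > 0"
    and w: "\<And>s. \<bar>s\<bar> \<le> t \<Longrightarrow> (w has_real_derivative w' s) (at s)"
    and w': "\<And>s. \<bar>s\<bar> \<le> t \<Longrightarrow> (w' has_real_derivative w'' s) (at s)"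
  shows "\<exists>\<xi>. \<bar>\<xi>\<bar> < t \<and> (w t + w (- t) - 2 * w 0) / t\<^sup>2 = w'' \<xi>"
proof -
  define v where "v s = w s + w (- s)" for s
  have v: "(v has_real_derivative w' s - w' (- s)) (at s)" if "\<bar>s\<bar> \<le> t" for s
  proof -
    have "((\<lambda>s. w (- s)) has_real_derivative w' (- s) * - 1) (at s)"
      using that by (intro DERIV_chain2[OF w] derivative_eq_intros) auto
    from DERIV_add[OF w[OF that] this] show ?thesis by (simp add: v_def[abs_def])
  qed
  have "\<exists>c. 0 < c \<and> c < t \<and> (v t - v 0) * (2 * c) = (t\<^sup>2 - 0\<^sup>2) * (w' c - w' (- c))"
  proof (rule GMVT')
    show "isCont v z" if "0 \<le> z" "z \<le> t" for z using that v DERIV_isCont by force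
    show "((\<lambda>s. s\<^sup>2) has_real_derivative 2 * z) (at z)" for z :: real
      by (auto intro!: derivative_eq_intros)
  qed (use t v in auto)
  then obtain c where c: "0 < c" "c < t" "(v t - v 0) * (2 * c) = t\<^sup>2 * (w' c - w' (- c))" by auto
  have "\<exists>z>- c. z < c \<and> w' c - w' (- c) = (c - - c) * w'' z"
    using c by (intro MVT2 w') auto
  then obtain \<xi> where \<xi>: "- c < \<xi>" "\<xi> < c" "w' c - w' (- c) = 2 * c * w'' \<xi>" by auto
  have "(v t - v 0) * (2 * c) = (t\<^sup>2 * w'' \<xi>) * (2 * c)" using c(3) \<xi>(3) by simp
  then have "v t - v 0 = t\<^sup>2 * w'' \<xi>" using c(1) by simp
  then show ?thesis using \<xi> c t by (intro exI[of _ \<xi>]) (auto simp: v_def field_simps)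
qed

lemma second_difference_limit:
  fixes w w' w'' :: "real \<Rightarrow> real"
  assumes d: "d > 0"
    and w: "\<And>s. \<bar>s\<bar> \<le> d \<Longrightarrow> (w has_real_derivative w' s) (at s)"
    and w': "\<And>s. \<bar>s\<bar> \<le> d \<Longrightarrow> (w' has_real_derivative w'' s) (at s)"
    and c: "isCont w'' 0" and t: "\<And>n. t n > 0" "t \<longlonglongrightarrow> 0"
  shows "(\<lambda>n. (w (t n) + w (- t n) - 2 * w 0) / (t n)\<^sup>2) \<longlonglongrightarrow> w'' 0"
proof -
  have "\<exists>\<xi>. t n \<le> d \<longrightarrow> \<bar>\<xi>\<bar> < t n \<and> (w (t n) + w (- t n) - 2 * w 0) / (t n)\<^sup>2 = w'' \<xi>" for n
  proof (cases "t n \<le> d")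
    case True
    show ?thesis using second_difference_mean_value[of "t n" w w' w''] t(1)[of n] w w' True by force
  qed auto
  then obtain \<xi> where \<xi>: "\<And>n. t n \<le> d \<Longrightarrow> \<bar>\<xi> n\<bar> < t n \<and> (w (t n) + w (- t n) - 2 * w 0) / (t n)\<^sup>2 = w'' (\<xi> n)"
    by metis
  have ev: "\<forall>\<^sub>F n in sequentially. t n \<le> d"
    using order_tendstoD(2)[OF t(2) d] by eventually_elim auto
  have "\<xi> \<longlonglongrightarrow> 0"
    by (rule Lim_null_comparison[OF _ t(2)]) (use ev in \<open>eventually_elim, use \<xi> in force\<close>)
  then have "(\<lambda>n. w'' (\<xi> n)) \<longlonglongrightarrow> w'' 0" using c isCont_tendsto_compose by blast
  then show ?thesis
    by (rule Lim_transform_eventually) (use ev in \<open>eventually_elim, use \<xi> in force\<close>)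
qed

text \<open>Second differences of a convolution converge to the convolution with the second derivative. This is
  all the differentiability of mollifications that the comparison argument needs.\<close>

lemma convolution_second_difference:
  fixes g \<rho> :: "'a::euclidean_space \<Rightarrow> real" and x :: 'a
  assumes g: "integrable lebesgue g" and \<rho>: "test_fun UNIV \<rho>" and b: "b \<in> Basis"
  defines "G \<equiv> \<lambda>x. \<integral>z. g z * \<rho> (x - z) \<partial>lebesgue"
  defines "t \<equiv> \<lambda>n. 1 / real (Suc n)"
  shows "(\<lambda>n. (G (x + t n *\<^sub>R b) + G (x - t n *\<^sub>R b) - 2 * G x) / (t n)\<^sup>2)
           \<longlonglongrightarrow> (\<integral>z. g z * partial b (partial b \<rho>) (x - z) \<partial>lebesgue)"
proof -
  have s: "smooth \<rho>" "smooth (partial b \<rho>)" "smooth (partial b (partial b \<rho>))"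
    using \<rho> b smooth_partial by (auto simp: test_fun_def)
  have t: "t n > 0" "t \<longlonglongrightarrow> 0" for n
    using LIMSEQ_inverse_real_of_nat by (auto simp: t_def inverse_eq_divide)
  have bdd: "\<exists>M. \<forall>x. \<bar>f x\<bar> \<le> M" if "test_fun UNIV f" for f :: "'a \<Rightarrow> real"
    using continuous_compact_support_bounded[of f] test_funE[OF that] smooth_continuous by metis
  obtain M0 where M0: "\<And>x. \<bar>\<rho> x\<bar> \<le> M0" using bdd[OF \<rho>] by blast
  obtain M where M: "\<And>x. \<bar>partial b (partial b \<rho>) x\<bar> \<le> M"
    using bdd[OF test_fun_partial[OF test_fun_partial[OF \<rho> b] b]] by blast
  have i: "integrable lebesgue (\<lambda>z. g z * \<rho> (y - z))" for y
    by (rule integrable_mult_bounded_continuous[OF g continuous_reflect_shift[OF smooth_continuous[OF s(1)]] M0])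
  have i2: "integrable lebesgue (\<lambda>z. g z * partial b (partial b \<rho>) (x - z))"
    by (rule integrable_mult_bounded_continuous[OF g continuous_reflect_shift[OF smooth_continuous[OF s(3)]] M])
  define D where "D n z = (\<rho> (x - z + t n *\<^sub>R b) + \<rho> (x - z + (- t n) *\<^sub>R b) - 2 * \<rho> (x - z + 0 *\<^sub>R b)) / (t n)\<^sup>2" for n z
  have gD: "g z * D n z = (g z * \<rho> ((x + t n *\<^sub>R b) - z) + g z * \<rho> ((x - t n *\<^sub>R b) - z) - 2 * (g z * \<rho> (x - z))) / (t n)\<^sup>2" for n z
    by (simp add: D_def algebra_simps diff_divide_distrib add_divide_distrib)
  have "(\<integral>z. g z * D n z \<partial>lebesgue) = (G (x + t n *\<^sub>R b) + G (x - t n *\<^sub>R b) - 2 * G x) / (t n)\<^sup>2" for n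
    unfolding gD G_def using i by simp
  moreover have "(\<lambda>n. \<integral>z. g z * D n z \<partial>lebesgue) \<longlonglongrightarrow> (\<integral>z. g z * partial b (partial b \<rho>) (x - z) \<partial>lebesgue)"
  proof (rule integral_dominated_convergence[where w="\<lambda>z. M * \<bar>g z\<bar>"])
    show "(\<lambda>z. g z * D n z) \<in> borel_measurable lebesgue" for n
      unfolding gD using i by (intro borel_measurable_divide borel_measurable_add borel_measurable_diff) auto
    have d1: "((\<lambda>s. \<rho> (y + s *\<^sub>R b)) has_real_derivative partial b \<rho> (y + s *\<^sub>R b)) (at s)"
      and d2: "((\<lambda>s. partial b \<rho> (y + s *\<^sub>R b)) has_real_derivative partial b (partial b \<rho>) (y + s *\<^sub>R b)) (at s)" for y s
      by (rule has_derivative_line, fact)+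
    show "AE z in lebesgue. (\<lambda>n. g z * D n z) \<longlonglongrightarrow> g z * partial b (partial b \<rho>) (x - z)"
    proof (rule AE_I2)
      fix z
      have "continuous_on UNIV (\<lambda>s. partial b (partial b \<rho>) (x - z + s *\<^sub>R b))"
        by (rule continuous_on_compose2[OF smooth_continuous[OF s(3), of UNIV]])
           (auto intro!: continuous_intros)
      then have "isCont (\<lambda>s. partial b (partial b \<rho>) (x - z + s *\<^sub>R b)) 0"
        using continuous_on_eq_continuous_at[OF open_UNIV] by blast
      then have "(\<lambda>n. D n z) \<longlonglongrightarrow> partial b (partial b \<rho>) (x - z + 0 *\<^sub>R b)"
        unfolding D_def
        by (intro second_difference_limit[where d=1 and w="\<lambda>s. \<rho> (x - z + s *\<^sub>R b)" and w'="\<lambda>s. partial b \<rho> (x - z + s *\<^sub>R b)"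
              and w''="\<lambda>s. partial b (partial b \<rho>) (x - z + s *\<^sub>R b)"] d1 d2 t) auto
      then show "(\<lambda>n. g z * D n z) \<longlonglongrightarrow> g z * partial b (partial b \<rho>) (x - z)"
        by (intro tendsto_mult_left) simp
    qed
    show "AE z in lebesgue. norm (g z * D n z) \<le> M * \<bar>g z\<bar>" for n
    proof (rule AE_I2)
      fix z
      have "\<exists>\<xi>. \<bar>\<xi>\<bar> < t n \<and> D n z = partial b (partial b \<rho>) (x - z + \<xi> *\<^sub>R b)"
        unfolding D_def
        by (rule second_difference_mean_value[where w="\<lambda>s. \<rho> (x - z + s *\<^sub>R b)" and w'="\<lambda>s. partial b \<rho> (x - z + s *\<^sub>R b)"
              and w''="\<lambda>s. partial b (partial b \<rho>) (x - z + s *\<^sub>R b)"]) (use t d1 d2 in auto)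
      then have "\<bar>D n z\<bar> \<le> M" using M by metis
      then have "\<bar>g z\<bar> * \<bar>D n z\<bar> \<le> \<bar>g z\<bar> * M" by (intro mult_left_mono) auto
      then show "norm (g z * D n z) \<le> M * \<bar>g z\<bar>" by (simp add: abs_mult mult.commute)
    qed
  qed (use g i2 in auto)
  ultimately show ?thesis by simp
qed

text \<open>Fubini's theorem needs joint measurability for the product of Borel measures, hence the passage to a
  Borel measurable function \<open>f\<close> that equals \<open>g\<close> almost everywhere.\<close>

lemma convolution_Fubini:
  fixes g \<rho> \<eta> :: "'a::euclidean_space \<Rightarrow> real"
  assumes g: "integrable lebesgue g" and \<rho>: "continuous_on UNIV \<rho>" "\<And>x. \<bar>\<rho> x\<bar> \<le> M"
    and \<eta>: "continuous_on UNIV \<eta>" "compact K" "\<And>x. x \<notin> K \<Longrightarrow> \<eta> x = 0"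
  shows "(\<integral>x. (\<integral>z. g z * \<rho> (x - z) \<partial>lebesgue) * \<eta> x \<partial>lebesgue) =
         (\<integral>z. g z * (\<integral>x. \<eta> x * \<rho> (x - z) \<partial>lebesgue) \<partial>lebesgue)"
proof -
  obtain f where f: "f \<in> borel_measurable lborel" "AE x in lborel. g x = f x"
    using completion_ex_borel_measurable_real[OF borel_measurable_integrable[OF g]] by blast
  have gf: "AE x in lebesgue. g x = f x" using f(2) by (rule AE_completion)
  have fl: "f \<in> borel_measurable lebesgue" using f(1) by (rule measurable_completion)
  have ifl: "integrable lebesgue f"
    using g integrable_cong_AE[OF borel_measurable_integrable[OF g] fl gf] by blast
  have [measurable]: "f \<in> borel_measurable borel" using f(1) by simp
  have [measurable]: "\<rho> \<in> borel_measurable borel" "\<eta> \<in> borel_measurable borel"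
    using \<rho>(1) \<eta>(1) by (auto intro: borel_measurable_continuous_onI)
  have gfint: "(\<integral>z. g z * h z \<partial>lebesgue) = (\<integral>z. f z * h z \<partial>lborel)" if [measurable]: "h \<in> borel_measurable borel" for h
  proof -
    have [measurable]: "h \<in> borel_measurable lebesgue" using that by (intro measurable_completion) simp
    have [measurable]: "g \<in> borel_measurable lebesgue" using g by blast
    note fl[measurable]
    have "(\<integral>z. g z * h z \<partial>lebesgue) = (\<integral>z. f z * h z \<partial>lebesgue)"
      by (rule integral_cong_AE) (use gf in auto)
    also have "\<dots> = (\<integral>z. f z * h z \<partial>lborel)" by (rule integral_completion) measurable
    finally show ?thesis .
  qed
  have absconv: "continuous_on UNIV (\<lambda>x. \<integral>z. \<bar>f z\<bar> * \<bar>\<rho> (x - z)\<bar> \<partial>lebesgue)"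
    by (rule continuous_convolution[where \<rho>="\<lambda>x. \<bar>\<rho> x\<bar>" and M=M]) (use ifl \<rho> in \<open>auto intro!: continuous_intros\<close>)
  define F where "F = (\<lambda>x z. f z * \<rho> (x - z) * \<eta> x)"
  have "integrable (lborel \<Otimes>\<^sub>M lborel) (case_prod F)"
  proof (rule lborel_pair.Fubini_integrable)
    show "case_prod F \<in> borel_measurable (lborel \<Otimes>\<^sub>M lborel)"
      unfolding F_def by measurable
    have "(\<lambda>x. \<integral>z. norm (case_prod F (x, z)) \<partial>lborel) = (\<lambda>x. (\<integral>z. \<bar>f z\<bar> * \<bar>\<rho> (x - z)\<bar> \<partial>lebesgue) * \<bar>\<eta> x\<bar>)"
      by (rule ext) (simp add: F_def abs_mult integral_completion)
    moreover have "integrable lebesgue (\<lambda>x. (\<integral>z. \<bar>f z\<bar> * \<bar>\<rho> (x - z)\<bar> \<partial>lebesgue) * \<bar>\<eta> x\<bar>)"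
      using \<eta> absconv
      by (intro loc_integrable_mult[of UNIV _ _ K] loc_integrable_continuous) (auto intro!: continuous_intros)
    moreover have "(\<lambda>x. (\<integral>z. \<bar>f z\<bar> * \<bar>\<rho> (x - z)\<bar> \<partial>lebesgue) * \<bar>\<eta> x\<bar>) \<in> borel_measurable lborel"
      using absconv \<eta>(1) by (auto intro!: borel_measurable_continuous_onI continuous_intros)
    ultimately show "integrable lborel (\<lambda>x. \<integral>z. norm (case_prod F (x, z)) \<partial>lborel)"
      using integrable_completion by metis
    have "integrable lebesgue (\<lambda>z. f z * \<rho> (x - z))" for x
      by (rule integrable_mult_bounded_continuous[OF ifl continuous_reflect_shift[OF \<rho>(1)] \<rho>(2)])
    then have "integrable lborel (\<lambda>z. f z * \<rho> (x - z))" for x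
      by (subst integrable_completion[symmetric]) measurable
    then show "AE x in lborel. integrable lborel (\<lambda>z. case_prod F (x, z))"
      by (intro AE_I2) (simp add: F_def)
  qed
  then have Fub: "(\<integral>z. (\<integral>x. F x z \<partial>lborel) \<partial>lborel) = (\<integral>x. (\<integral>z. F x z \<partial>lborel) \<partial>lborel)"
    by (rule lborel_pair.Fubini_integral)
  have "(\<integral>x. (\<integral>z. g z * \<rho> (x - z) \<partial>lebesgue) * \<eta> x \<partial>lebesgue) = (\<integral>x. (\<integral>z. g z * \<rho> (x - z) \<partial>lebesgue) * \<eta> x \<partial>lborel)"
    using continuous_convolution[OF g \<rho>] \<eta>(1)
    by (intro integral_completion) (auto intro!: borel_measurable_continuous_onI continuous_intros)
  also have "\<dots> = (\<integral>x. (\<integral>z. F x z \<partial>lborel) \<partial>lborel)"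
    by (rule Bochner_Integration.integral_cong) (simp_all add: F_def gfint)
  also have "\<dots> = (\<integral>z. (\<integral>x. F x z \<partial>lborel) \<partial>lborel)"
    by (rule Fub[symmetric])
  also have "\<dots> = (\<integral>z. f z * (\<integral>x. \<eta> x * \<rho> (x - z) \<partial>lborel) \<partial>lborel)"
    unfolding F_def
    by (rule Bochner_Integration.integral_cong) (simp_all add: mult.assoc mult.commute[of "\<rho> _"])
  also have "\<dots> = (\<integral>z. g z * (\<integral>x. \<eta> x * \<rho> (x - z) \<partial>lborel) \<partial>lebesgue)"
    by (rule gfint[symmetric]) measurable
  also have "\<dots> = (\<integral>z. g z * (\<integral>x. \<eta> x * \<rho> (x - z) \<partial>lebesgue) \<partial>lebesgue)"
    by (simp add: integral_completion)
  finally show ?thesis .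
qed

text \<open>Convolution with the mollifier. At points whose closed ball of radius \<open>2^(-k)\<close> lies in an open set,
  only the values of \<open>g\<close> in that set enter.\<close>

definition mollify :: "nat \<Rightarrow> (real \<times> real \<Rightarrow> real) \<Rightarrow> real \<times> real \<Rightarrow> real" where
  "mollify k g x = (\<integral>z. g z * mollifier k (x - z) \<partial>lebesgue)"

lemma mollifier_bounded: "\<exists>M. \<forall>x. \<bar>mollifier k x\<bar> \<le> M"
  using continuous_compact_support_bounded[of "mollifier k" "cball 0 ((1/2)^k)"] mollifier_outside
      smooth_continuous[OF smooth_mollifier] by (metis compact_cball mem_cball_0 nle_le)

lemma continuous_mollify: "integrable lebesgue g \<Longrightarrow> continuous_on UNIV (mollify k g)"
  unfolding mollify_def[abs_def]
proof -
  assume g: "integrable lebesgue g"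
  obtain M where M: "\<And>x. \<bar>mollifier k x\<bar> \<le> M" using mollifier_bounded by blast
  show "continuous_on UNIV (\<lambda>x. \<integral>z. g z * mollifier k (x - z) \<partial>lebesgue)"
    by (rule continuous_convolution[OF g smooth_continuous[OF smooth_mollifier] M])
qed

lemma mollifier_shift:
  "integrable lebesgue (\<lambda>x. mollifier k (x - z))" "(\<integral>x. mollifier k (x - z) \<partial>lebesgue) = 1"
proof -
  have "test_fun UNIV (\<lambda>x. mollifier k (z - x))"
    by (rule test_fun_shifted[OF smooth_mollifier mollifier_outside]) auto
  then have "integrable lebesgue (\<lambda>x. mollifier k (z - x))"
    using loc_integrable_mult_test[OF loc_integrable_continuous[OF continuous_on_const], of UNIV _ 1] by simp
  then show "integrable lebesgue (\<lambda>x. mollifier k (x - z))"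
    using mollifier_minus[of k "z - _"] by simp
  show "(\<integral>x. mollifier k (x - z) \<partial>lebesgue) = 1"
    using integral_lebesgue_translation[of "mollifier k" "- z"] smooth_continuous[OF smooth_mollifier]
    by (simp add: borel_measurable_continuous_onI integral_mollifier)
qed

lemma mollify_continuous_tendsto:
  fixes \<eta> :: "real \<times> real \<Rightarrow> real"
  assumes \<eta>: "continuous_on UNIV \<eta>" "\<And>x. \<bar>\<eta> x\<bar> \<le> M"
  shows "(\<lambda>k. \<integral>x. \<eta> x * mollifier k (x - z) \<partial>lebesgue) \<longlonglongrightarrow> \<eta> z"
    and "\<bar>\<integral>x. \<eta> x * mollifier k (x - z) \<partial>lebesgue\<bar> \<le> M"
proof -
  have i: "integrable lebesgue (\<lambda>x. \<eta> x * mollifier k (x - z))" for k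
    using integrable_mult_bounded_continuous[OF mollifier_shift(1) \<eta>] by (simp add: mult.commute)
  have bound: "\<bar>\<integral>x. h x * mollifier k (x - z) \<partial>lebesgue\<bar> \<le> e"
    if h: "integrable lebesgue (\<lambda>x. h x * mollifier k (x - z))" "\<And>x. norm (x - z) < (1/2)^k \<Longrightarrow> \<bar>h x\<bar> \<le> e" for h k e
  proof -
    have "\<bar>\<integral>x. h x * mollifier k (x - z) \<partial>lebesgue\<bar> \<le> (\<integral>x. \<bar>h x * mollifier k (x - z)\<bar> \<partial>lebesgue)"
      using integral_norm_bound[of lebesgue "\<lambda>x. h x * mollifier k (x - z)"] by simp
    also have "\<dots> \<le> (\<integral>x. e * mollifier k (x - z) \<partial>lebesgue)"
    proof (rule integral_mono)
      fix x
      show "\<bar>h x * mollifier k (x - z)\<bar> \<le> e * mollifier k (x - z)"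
        using h(2)[of x] mollifier_outside[of k "x - z"] mollifier_nonneg[of k "x - z"]
        by (cases "norm (x - z) < (1/2)^k") (auto simp: abs_mult intro!: mult_right_mono)
    qed (use h(1) mollifier_shift(1) in auto)
    also have "\<dots> = e" using mollifier_shift(2) by simp
    finally show ?thesis .
  qed
  show "\<bar>\<integral>x. \<eta> x * mollifier k (x - z) \<partial>lebesgue\<bar> \<le> M" using bound[OF i \<eta>(2)] .
  show "(\<lambda>k. \<integral>x. \<eta> x * mollifier k (x - z) \<partial>lebesgue) \<longlonglongrightarrow> \<eta> z"
  proof (rule LIMSEQ_I)
    fix e :: real assume e: "e > 0"
    have "isCont \<eta> z" using \<eta>(1) continuous_on_eq_continuous_at[OF open_UNIV] by blast
    then obtain d where d: "d > 0" "\<And>x. dist x z < d \<Longrightarrow> dist (\<eta> x) (\<eta> z) < e / 2"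
      unfolding continuous_at_eps_delta using e by (meson half_gt_zero)
    obtain N where N: "(1/2)^N < d" using real_arch_pow_inv[OF d(1), of "1/2"] by auto
    have "norm ((\<integral>x. \<eta> x * mollifier k (x - z) \<partial>lebesgue) - \<eta> z) < e" if k: "k \<ge> N" for k
    proof -
      have kd: "(1/2::real)^k < d" using N k power_decreasing[of N k "1/2::real"] by linarith
      have "(\<integral>x. \<eta> x * mollifier k (x - z) \<partial>lebesgue) - \<eta> z =
          (\<integral>x. \<eta> x * mollifier k (x - z) \<partial>lebesgue) - (\<integral>x. \<eta> z * mollifier k (x - z) \<partial>lebesgue)"
        by (simp add: mollifier_shift)
      also have "\<dots> = (\<integral>x. (\<eta> x - \<eta> z) * mollifier k (x - z) \<partial>lebesgue)"
        using i mollifier_shift(1) by (simp add: left_diff_distrib)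
      also have "\<bar>\<dots>\<bar> \<le> e / 2"
      proof (rule bound)
        show "integrable lebesgue (\<lambda>x. (\<eta> x - \<eta> z) * mollifier k (x - z))"
          using i mollifier_shift(1) by (simp add: left_diff_distrib)
        show "\<bar>\<eta> x - \<eta> z\<bar> \<le> e / 2" if "norm (x - z) < (1/2)^k" for x
          using d(2)[of x] that kd by (simp add: dist_norm)
      qed
      finally show ?thesis using e by simp
    qed
    then show "\<exists>N. \<forall>k\<ge>N. norm ((\<integral>x. \<eta> x * mollifier k (x - z) \<partial>lebesgue) - \<eta> z) < e" by blast
  qed
qed

text \<open>By Fubini's theorem the mollification can be moved to the test function, where it converges
  boundedly.\<close>

lemma mollify_weak_convergence:
  assumes g: "integrable lebesgue g" and \<eta>: "test_fun UNIV \<eta>"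
  shows "(\<lambda>k. \<integral>x. mollify k g x * \<eta> x \<partial>lebesgue) \<longlonglongrightarrow> (\<integral>x. g x * \<eta> x \<partial>lebesgue)"
proof -
  obtain K where K: "smooth \<eta>" "compact K" "\<And>x. x \<notin> K \<Longrightarrow> \<eta> x = 0"
    using test_funE[OF \<eta>] by metis
  have c: "continuous_on UNIV \<eta>" using smooth_continuous[OF K(1)] .
  obtain M where M: "\<And>x. \<bar>\<eta> x\<bar> \<le> M" using continuous_compact_support_bounded[OF c K(2,3)] by metis
  have \<eta>i: "integrable lebesgue \<eta>"
    using loc_integrable_mult_test[OF loc_integrable_continuous[OF continuous_on_const] \<eta>, of 1] by simp
  define E where "E k z = (\<integral>x. \<eta> x * mollifier k (x - z) \<partial>lebesgue)" for k z
  have "mollifier k (x - z) = mollifier k (z - x)" for k x z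
    using mollifier_minus[of k "x - z"] by simp
  then have "E k = mollify k \<eta>" for k
    unfolding E_def[abs_def] mollify_def[abs_def] by presburger
  then have Ec: "continuous_on UNIV (E k)" for k using continuous_mollify[OF \<eta>i] by simp
  have "(\<integral>x. mollify k g x * \<eta> x \<partial>lebesgue) = (\<integral>z. g z * E k z \<partial>lebesgue)" for k
  proof -
    obtain Mk where Mk: "\<And>x. \<bar>mollifier k x\<bar> \<le> Mk" using mollifier_bounded by blast
    show ?thesis
      unfolding mollify_def E_def
      by (rule convolution_Fubini[OF g smooth_continuous[OF smooth_mollifier] Mk c K(2,3)])
  qed
  moreover have "(\<lambda>k. \<integral>z. g z * E k z \<partial>lebesgue) \<longlonglongrightarrow> (\<integral>x. g x * \<eta> x \<partial>lebesgue)"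
  proof (rule integral_dominated_convergence[where w="\<lambda>z. M * \<bar>g z\<bar>"])
    show "(\<lambda>x. g x * \<eta> x) \<in> borel_measurable lebesgue" "(\<lambda>z. g z * E k z) \<in> borel_measurable lebesgue" for k
      using g continuous_measurable_lebesgue[OF Ec] continuous_measurable_lebesgue[OF c] by auto
    show "AE z in lebesgue. (\<lambda>k. g z * E k z) \<longlonglongrightarrow> g z * \<eta> z"
      unfolding E_def by (intro AE_I2 tendsto_mult_left mollify_continuous_tendsto(1)[OF c M])
    show "AE z in lebesgue. norm (g z * E k z) \<le> M * \<bar>g z\<bar>" for k
    proof (rule AE_I2)
      fix z
      have "\<bar>g z\<bar> * \<bar>E k z\<bar> \<le> \<bar>g z\<bar> * M"
        unfolding E_def by (intro mult_left_mono mollify_continuous_tendsto(2)[OF c M]) auto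
      then show "norm (g z * E k z) \<le> M * \<bar>g z\<bar>" by (simp add: abs_mult mult.commute)
    qed
  qed (use g in auto)
  ultimately show ?thesis by simp
qed

section \<open>Interior regularity and the lower bound\<close>

lemma geometric_steps_convergent:
  fixes a :: "nat \<Rightarrow> real"
  assumes C: "C \<ge> 0" and step: "\<And>k. k \<ge> N \<Longrightarrow> \<bar>a k - a (Suc k)\<bar> \<le> C * (1/4)^k"
  shows "a \<longlonglongrightarrow> lim a" and "\<And>k. k \<ge> N \<Longrightarrow> \<bar>a k - lim a\<bar> \<le> 2 * C * (1/4)^k"
proof -
  have tele: "\<bar>a (k + m) - a k\<bar> \<le> 2 * C * (1/4)^k * (1 - (1/4)^m)" if "k \<ge> N" for k m
  proof (induction m)
    case (Suc m)
    have "\<bar>a (k + Suc m) - a k\<bar> \<le> \<bar>a (k + m) - a (Suc (k + m))\<bar> + \<bar>a (k + m) - a k\<bar>" by simp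
    also have "\<dots> \<le> C * (1/4)^(k + m) + 2 * C * (1/4)^k * (1 - (1/4)^m)"
      using Suc step[of "k + m"] that by (intro add_mono) auto
    also have "\<dots> = 2 * C * (1/4)^k * (1 - (1/2) * (1/4)^m)" by (simp add: power_add algebra_simps)
    also have "\<dots> \<le> 2 * C * (1/4)^k * (1 - (1/4)^Suc m)"
      using C by (intro mult_left_mono) auto
    finally show ?case .
  qed simp
  have bnd: "\<bar>a j - a k\<bar> \<le> 2 * C * (1/4)^k" if "k \<ge> N" "j \<ge> k" for j k
  proof -
    have "2 * C * (1/4)^k * (1 - (1/4)^(j - k)) \<le> 2 * C * (1/4)^k * 1"
      using C by (intro mult_left_mono) auto
    then show ?thesis using tele[OF that(1), of "j - k"] that(2) by simp
  qed
  have "Cauchy a"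
  proof (rule CauchyI)
    fix e :: real assume "e > 0"
    then have "e / (4 * C + 1) > 0" using C by simp
    then obtain M where M: "(1/4::real)^M < e / (4 * C + 1)" using real_arch_pow_inv[of _ "1/4"] by force
    let ?K = "max M N"
    have "(1/4::real)^?K \<le> (1/4)^M" by (rule power_decreasing) auto
    then have "(1/4::real)^?K < e / (4 * C + 1)" using M by linarith
    then have "(1/4::real)^?K * (4 * C + 1) < e" using C by (simp add: pos_less_divide_eq)
    moreover have "(1/4::real)^?K * (4 * C) \<le> (1/4)^?K * (4 * C + 1)" by (rule mult_left_mono) auto
    ultimately have "(1/4)^?K * (4 * C) < e" by linarith
    then have small: "4 * C * (1/4)^?K < e" by (simp only: mult.commute)
    have "norm (a m - a n) < e" if "m \<ge> ?K" "n \<ge> ?K" for m n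
      using bnd[of ?K m] bnd[of ?K n] that small by simp
    then show "\<exists>M. \<forall>m\<ge>M. \<forall>n\<ge>M. norm (a m - a n) < e" by blast
  qed
  then show l: "a \<longlonglongrightarrow> lim a" by (simp add: Cauchy_convergent_iff convergent_LIMSEQ_iff)
  show "\<bar>a k - lim a\<bar> \<le> 2 * C * (1/4)^k" if "k \<ge> N" for k
  proof -
    have "(\<lambda>j. \<bar>a j - a k\<bar>) \<longlonglongrightarrow> \<bar>lim a - a k\<bar>" by (intro tendsto_intros l)
    then have "\<bar>lim a - a k\<bar> \<le> 2 * C * (1/4)^k"
      by (rule LIMSEQ_le_const2) (use bnd that in blast)
    then show ?thesis by (simp add: abs_minus_commute)
  qed
qed

text \<open>Where \<open>\<phi> \<ge> 0\<close> the right-hand side of the equation lies between 0 and 1.\<close>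

lemma loc_integrable_exp_minus:
  fixes \<phi> :: "'a::euclidean_space \<Rightarrow> real"
  assumes U: "open U" and l: "loc_integrable U \<phi>" and nn: "AE x in lebesgue_on U. 0 \<le> \<phi> x"
  shows "loc_integrable U (\<lambda>x. exp (- \<phi> x))"
  unfolding loc_integrable_def set_integrable_def
proof clarify
  fix K assume K: "compact K" "K \<subseteq> U"
  have KS: "K \<in> sets lebesgue" using K(1) by (simp add: compact_imp_closed)
  have i: "integrable lebesgue (\<lambda>x. indicator K x * \<phi> x)"
    using l K by (auto simp: loc_integrable_def set_integrable_def)
  have nn': "AE x in lebesgue. x \<in> U \<longrightarrow> 0 \<le> \<phi> x"
    using nn by (subst (asm) AE_lebesgue_on_iff[OF U])
  have eq: "(\<lambda>x. indicator K x *\<^sub>R exp (- \<phi> x)) = (\<lambda>x. indicator K x * exp (- (indicator K x * \<phi> x)))"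
    by (rule ext) (simp add: indicator_def)
  show "integrable lebesgue (\<lambda>x. indicator K x *\<^sub>R exp (- \<phi> x))"
    unfolding eq
  proof (rule Bochner_Integration.integrable_bound[of _ "indicator K :: 'a \<Rightarrow> real"])
    show "integrable lebesgue (indicator K :: 'a \<Rightarrow> real)"
      using KS emeasure_compact_finite[OF K(1)] K(1)
      by (intro integrable_real_indicator) (auto simp: compact_imp_closed)
    show "(\<lambda>x. indicator K x * exp (- (indicator K x * \<phi> x))) \<in> borel_measurable lebesgue"
    proof (rule borel_measurable_times)
      show "(\<lambda>x. exp (- (indicator K x * \<phi> x))) \<in> borel_measurable lebesgue"
        by (rule measurable_compose[OF borel_measurable_integrable[OF i], of "\<lambda>t. exp (- t)"]) simp
    qed (use KS in simp)
    show "AE x in lebesgue. norm (indicator K x * exp (- (indicator K x * \<phi> x))) \<le> norm (indicator K x :: real)"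
      using nn' by eventually_elim (use K(2) in \<open>auto simp: indicator_def\<close>)
  qed
qed

lemma measure_cball_plane: "r \<ge> 0 \<Longrightarrow> measure lebesgue (cball (x::real \<times> real) r) = pi * r\<^sup>2"
  by (simp add: content_cball unit_ball_vol_2 power2_eq_square)

lemma test_fun_mollifier: "cball x ((1/2)^k) \<subseteq> U \<Longrightarrow> test_fun U (\<lambda>z. mollifier k (x - z))"
  by (rule test_fun_shifted[OF smooth_mollifier mollifier_outside])

lemma test_fun_corrector: "cball x ((1/2)^k) \<subseteq> U \<Longrightarrow> test_fun U (\<lambda>z. corrector k (x - z))"
  by (rule test_fun_shifted[OF smooth_corrector corrector_outside])

lemma mollify_localize:
  assumes "dist x0 x + (1/2)^k \<le> r"
  shows "mollify k (\<lambda>z. indicator (cball x0 r) z * \<phi> z) x = mollify k \<phi> x"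
  unfolding mollify_def
proof (rule Bochner_Integration.integral_cong)
  fix z
  show "indicator (cball x0 r) z * \<phi> z * mollifier k (x - z) = \<phi> z * mollifier k (x - z)"
  proof (cases "z \<in> cball x0 r")
    case False
    then have "norm (x - z) \<ge> (1/2)^k"
      using assms dist_triangle[of x0 z x] by (simp add: dist_norm)
    then show ?thesis by (simp add: mollifier_outside)
  qed simp
qed simp

context
  fixes U :: "(real \<times> real) set" and \<phi> :: "real \<times> real \<Rightarrow> real"
  assumes U: "open U" and sol: "distributional_solution U \<phi>"
    and nonneg: "AE x in lebesgue_on U. 0 \<le> \<phi> x"
begin

lemma sol_loc_integrable: "loc_integrable U \<phi>"
  using sol by (simp add: distributional_solution_def)

lemma sol_exp_loc_integrable: "loc_integrable U (\<lambda>x. exp (- \<phi> x))"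
  by (rule loc_integrable_exp_minus[OF U sol_loc_integrable nonneg])

lemma nonneg_AE: "AE x in lebesgue. x \<in> U \<longrightarrow> 0 \<le> \<phi> x"
  using nonneg by (subst (asm) AE_lebesgue_on_iff[OF U])

lemma sol_test:
  assumes "test_fun U \<eta>"
  shows "(\<integral>z. \<phi> z * laplacian \<eta> z \<partial>lebesgue) = - (\<integral>z. exp (- \<phi> z) * \<eta> z \<partial>lebesgue)"
  using sol assms
  unfolding distributional_solution_def integral_test_lebesgue_on[OF U assms, symmetric]
    integral_test_lebesgue_on[OF U test_fun_laplacian[OF assms], symmetric]
  by blast

text \<open>The difference of consecutive mollifications is the equation tested with a corrector, which is
  bounded uniformly in \<open>k\<close> and supported in a ball of area \<open>pi / 4^k\<close>.\<close>

lemma mollify_step: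
  "\<exists>C\<ge>0. \<forall>k x. cball x ((1/2)^k) \<subseteq> U \<longrightarrow> \<bar>mollify k \<phi> x - mollify (Suc k) \<phi> x\<bar> \<le> C * (1/4)^k"
proof -
  obtain C where C: "C > 0" "\<And>k x. \<bar>corrector k x\<bar> \<le> C" using corrector_bounded by metis
  have "\<bar>mollify k \<phi> x - mollify (Suc k) \<phi> x\<bar> \<le> (C * pi) * (1/4)^k" if x: "cball x ((1/2)^k) \<subseteq> U" for k x
  proof -
    have "cball x ((1/2)^Suc k) \<subseteq> cball x ((1/2)^k)" by (rule subset_cball) simp
    then have x': "cball x ((1/2)^Suc k) \<subseteq> U" using x by blast
    note tc = test_fun_corrector[OF x]
    have lap: "laplacian (\<lambda>z. corrector k (x - z)) z = mollifier k (x - z) - mollifier (Suc k) (x - z)" for z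
      by (simp only: laplacian_shifted[OF smooth_corrector] laplacian_corrector)
    have "mollify k \<phi> x - mollify (Suc k) \<phi> x = (\<integral>z. \<phi> z * laplacian (\<lambda>z. corrector k (x - z)) z \<partial>lebesgue)"
      unfolding lap right_diff_distrib mollify_def
      by (rule Bochner_Integration.integral_diff[symmetric])
         (intro loc_integrable_mult_test[OF sol_loc_integrable] test_fun_mollifier x x')+
    also have "\<dots> = - (\<integral>z. exp (- \<phi> z) * corrector k (x - z) \<partial>lebesgue)"
      by (rule sol_test[OF tc])
    finally have "\<bar>mollify k \<phi> x - mollify (Suc k) \<phi> x\<bar> = \<bar>\<integral>z. exp (- \<phi> z) * corrector k (x - z) \<partial>lebesgue\<bar>"
      by simp
    also have "\<dots> \<le> (\<integral>z. \<bar>exp (- \<phi> z) * corrector k (x - z)\<bar> \<partial>lebesgue)"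
      using integral_norm_bound[of lebesgue "\<lambda>z. exp (- \<phi> z) * corrector k (x - z)"] by simp
    also have "\<dots> \<le> (\<integral>z. C * indicator (cball x ((1/2)^k)) z \<partial>lebesgue)"
    proof (rule integral_mono_AE)
      show "integrable lebesgue (\<lambda>z. \<bar>exp (- \<phi> z) * corrector k (x - z)\<bar>)"
        by (intro integrable_abs loc_integrable_mult_test[OF sol_exp_loc_integrable tc])
      show "integrable lebesgue (\<lambda>z. C * indicator (cball x ((1/2)^k)) z)"
        using emeasure_bounded_finite[OF bounded_cball, of x "(1/2)^k"]
        by (intro integrable_mult_right integrable_real_indicator) auto
      show "AE z in lebesgue. \<bar>exp (- \<phi> z) * corrector k (x - z)\<bar> \<le> C * indicator (cball x ((1/2)^k)) z"
        using nonneg_AE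
      proof eventually_elim
        case (elim z)
        show ?case
        proof (cases "z \<in> cball x ((1/2)^k)")
          case True
          then have "exp (- \<phi> z) * \<bar>corrector k (x - z)\<bar> \<le> 1 * C"
            using elim x C by (intro mult_mono) auto
          then show ?thesis using True by (simp add: abs_mult)
        next
          case False
          then have "corrector k (x - z) = 0" by (intro corrector_outside) (simp add: dist_norm)
          then show ?thesis using C(1) by simp
        qed
      qed
    qed
    also have "\<dots> = C * (pi * ((1/2)^k)\<^sup>2)"
      using measure_cball_plane[of "(1/2)^k" x] by simp
    also have "((1/2::real)^k)\<^sup>2 = (1/4)^k" by (simp add: power2_eq_square flip: power_mult_distrib)
    finally show ?thesis by simp
  qed
  then show ?thesis using C(1) by (intro exI[of _ "C * pi"]) auto
qed

text \<open>The continuous representative: the pointwise limit of the mollifications. Its values outside \<open>U\<close>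
  are irrelevant.\<close>

definition sol_rep :: "real \<times> real \<Rightarrow> real" where
  "sol_rep x = lim (\<lambda>k. mollify k \<phi> x)"

lemma localized_integrable:
  "cball x0 r \<subseteq> U \<Longrightarrow> integrable lebesgue (\<lambda>z. indicator (cball x0 r) z * \<phi> z)"
  using sol_loc_integrable by (auto simp: loc_integrable_def set_integrable_def)

text \<open>Near \<open>x0\<close> the mollifications of \<open>\<phi>\<close> agree for large \<open>k\<close> with those of the integrable function \<open>g\<close>
  obtained by cutting \<open>\<phi>\<close> off outside \<open>cball x0 r\<close>. They converge uniformly to \<open>sol_rep\<close>, and weakly to
  \<open>\<phi>\<close>.\<close>

lemma sol_rep_local:
  assumes r: "r > 0" "cball x0 r \<subseteq> U"
  shows "continuous_on (ball x0 (r/2)) sol_rep"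
    and "AE x in lebesgue_on (ball x0 (r/2)). \<phi> x = sol_rep x"
    and "(\<lambda>k. mollify k \<phi> x0) \<longlonglongrightarrow> sol_rep x0"
proof -
  let ?B = "ball x0 (r/2)"
  define g where "g = (\<lambda>z. indicator (cball x0 r) z * \<phi> z)"
  have g: "integrable lebesgue g" unfolding g_def by (rule localized_integrable[OF r(2)])
  obtain C where C: "C \<ge> 0" "\<And>k x. cball x ((1/2)^k) \<subseteq> U \<Longrightarrow> \<bar>mollify k \<phi> x - mollify (Suc k) \<phi> x\<bar> \<le> C * (1/4)^k"
    using mollify_step by blast
  obtain N where N: "(1/2::real)^N < r/2" using real_arch_pow_inv[of "r/2" "1/2"] r by auto
  have small: "(1/2::real)^k \<le> r/2" if "k \<ge> N" for k
    using N that power_decreasing[of N k "1/2::real"] by linarith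
  have sub: "cball x ((1/2)^k) \<subseteq> U" if "k \<ge> N" "x \<in> ?B" for k x
  proof -
    have "cball x ((1/2)^k) \<subseteq> cball x0 r"
      using small[OF that(1)] that(2) by (intro cball_subset_cball_iff[THEN iffD2]) (auto simp: dist_commute)
    then show ?thesis using r(2) by blast
  qed
  have mg: "mollify k g x = mollify k \<phi> x" if "k \<ge> N" "x \<in> ?B" for k x
    unfolding g_def using small[OF that(1)] that(2) by (intro mollify_localize) auto
  have conv: "(\<lambda>k. mollify k \<phi> x) \<longlonglongrightarrow> sol_rep x"
    and err: "\<And>k. k \<ge> N \<Longrightarrow> \<bar>mollify k \<phi> x - sol_rep x\<bar> \<le> 2 * C * (1/4)^k" if "x \<in> ?B" for x
    unfolding sol_rep_def
    by (rule geometric_steps_convergent[OF C(1), of N], rule C(2), rule sub, assumption, rule that)+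
  show "(\<lambda>k. mollify k \<phi> x0) \<longlonglongrightarrow> sol_rep x0" using conv[of x0] r by simp
  have null: "(\<lambda>k. 2 * C * (1/4)^k) \<longlonglongrightarrow> 0"
    using tendsto_mult[OF tendsto_const LIMSEQ_power_zero[of "1/4::real"], of "2 * C"] by simp
  have "uniform_limit ?B (\<lambda>k. mollify k g) sol_rep sequentially"
  proof (rule uniform_limitI)
    fix e :: real assume "e > 0"
    then have "\<forall>\<^sub>F k in sequentially. 2 * C * (1/4)^k < e" using order_tendstoD(2)[OF null] by blast
    then show "\<forall>\<^sub>F k in sequentially. \<forall>x\<in>?B. dist (mollify k g x) (sol_rep x) < e"
      using eventually_ge_at_top[of N]
    proof eventually_elim
      case (elim k)
      show ?case
      proof
        fix x assume x: "x \<in> ?B"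
        show "dist (mollify k g x) (sol_rep x) < e"
          using mg[OF elim(2) x] err[OF x elim(2)] elim(1) by (simp add: dist_real_def)
      qed
    qed
  qed
  moreover have "continuous_on ?B (mollify k g)" for k
    using continuous_on_subset[OF continuous_mollify[OF g]] by blast
  ultimately show cont: "continuous_on ?B sol_rep"
    by (intro uniform_limit_theorem[of _ "\<lambda>k. mollify k g" sequentially]) auto
  have "AE x in lebesgue_on ?B. \<phi> x - sol_rep x = 0"
  proof (rule fundamental_lemma)
    have BU: "?B \<subseteq> U" using r by (auto dest!: subsetD[OF r(2), rotated])
    have l\<phi>: "loc_integrable ?B \<phi>" using loc_integrable_subset[OF sol_loc_integrable BU] .
    have l\<psi>: "loc_integrable ?B sol_rep" using loc_integrable_continuous_on[OF cont] .
    show "loc_integrable ?B (\<lambda>x. \<phi> x - sol_rep x)" using loc_integrable_diff[OF l\<phi> l\<psi>] .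
    fix \<eta> :: "real \<times> real \<Rightarrow> real" assume \<eta>: "test_fun ?B \<eta>"
    obtain K where K: "K \<subseteq> ?B" "\<And>x. x \<notin> K \<Longrightarrow> \<eta> x = 0" using test_funE[OF \<eta>] by metis
    have \<eta>0: "\<eta> x = 0" if "x \<notin> ?B" for x using K that by blast
    have \<eta>i: "integrable lebesgue (\<lambda>x. \<bar>\<eta> x\<bar>)"
      using integrable_abs[OF loc_integrable_mult_test[OF loc_integrable_continuous[OF continuous_on_const] \<eta>, of 1]] by simp
    have i\<psi>: "integrable lebesgue (\<lambda>x. sol_rep x * \<eta> x)" by (rule loc_integrable_mult_test[OF l\<psi> \<eta>])
    have ig: "integrable lebesgue (\<lambda>x. mollify k g x * \<eta> x)" for k
      by (rule loc_integrable_mult_test[OF loc_integrable_continuous[OF continuous_mollify[OF g]] \<eta>])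
    have lim1: "(\<lambda>k. \<integral>x. mollify k g x * \<eta> x \<partial>lebesgue) \<longlonglongrightarrow> (\<integral>x. g x * \<eta> x \<partial>lebesgue)"
      by (rule mollify_weak_convergence[OF g test_fun_mono[OF \<eta>]]) simp
    have lim2: "(\<lambda>k. \<integral>x. mollify k g x * \<eta> x \<partial>lebesgue) \<longlonglongrightarrow> (\<integral>x. sol_rep x * \<eta> x \<partial>lebesgue)"
    proof (rule LIM_zero_cancel, rule Lim_null_comparison)
      show "(\<lambda>k. 2 * C * (1/4)^k * (\<integral>x. \<bar>\<eta> x\<bar> \<partial>lebesgue)) \<longlonglongrightarrow> 0"
        using tendsto_mult_right[OF null] by simp
      show "\<forall>\<^sub>F k in sequentially. norm ((\<integral>x. mollify k g x * \<eta> x \<partial>lebesgue) - (\<integral>x. sol_rep x * \<eta> x \<partial>lebesgue))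
          \<le> 2 * C * (1/4)^k * (\<integral>x. \<bar>\<eta> x\<bar> \<partial>lebesgue)"
        using eventually_ge_at_top[of N]
      proof eventually_elim
        case (elim k)
        have "norm ((\<integral>x. mollify k g x * \<eta> x \<partial>lebesgue) - (\<integral>x. sol_rep x * \<eta> x \<partial>lebesgue)) =
          norm (\<integral>x. mollify k g x * \<eta> x - sol_rep x * \<eta> x \<partial>lebesgue)"
          using ig i\<psi> by simp
        also have "\<dots> \<le> (\<integral>x. norm (mollify k g x * \<eta> x - sol_rep x * \<eta> x) \<partial>lebesgue)"
          by (rule integral_norm_bound)
        also have "\<dots> \<le> (\<integral>x. 2 * C * (1/4)^k * \<bar>\<eta> x\<bar> \<partial>lebesgue)"
        proof (rule integral_mono)
          fix x
          show "norm (mollify k g x * \<eta> x - sol_rep x * \<eta> x) \<le> 2 * C * (1/4)^k * \<bar>\<eta> x\<bar>"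
          proof (cases "x \<in> ?B")
            case True
            then have "\<bar>mollify k g x - sol_rep x\<bar> * \<bar>\<eta> x\<bar> \<le> 2 * C * (1/4)^k * \<bar>\<eta> x\<bar>"
              using mg[OF elim] err[OF _ elim] by (intro mult_right_mono) auto
            then show ?thesis by (simp add: abs_mult flip: left_diff_distrib)
          qed (simp add: \<eta>0)
        qed (use ig i\<psi> \<eta>i in auto)
        finally show ?case by simp
      qed
    qed
    have "(\<integral>x. g x * \<eta> x \<partial>lebesgue) = (\<integral>x. \<phi> x * \<eta> x \<partial>lebesgue)"
    proof (rule Bochner_Integration.integral_cong)
      fix x show "g x * \<eta> x = \<phi> x * \<eta> x"
        using \<eta>0[of x] r(1) by (cases "x \<in> ?B") (auto simp: g_def indicator_def)
    qed simp
    then have "(\<integral>x. \<phi> x * \<eta> x \<partial>lebesgue) = (\<integral>x. sol_rep x * \<eta> x \<partial>lebesgue)"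
      using LIMSEQ_unique[OF lim1 lim2] by simp
    then show "(\<integral>x. (\<phi> x - sol_rep x) * \<eta> x \<partial>lebesgue_on ?B) = 0"
      unfolding integral_test_lebesgue_on[OF open_ball \<eta>]
      using loc_integrable_mult_test[OF l\<phi> \<eta>] i\<psi> by (simp add: left_diff_distrib)
  qed simp
  then show "AE x in lebesgue_on ?B. \<phi> x = sol_rep x" by simp
qed

lemma sol_rep_representative: "continuous_representative U \<phi> sol_rep"
  unfolding continuous_representative_def
proof
  have ex: "\<exists>r>0. cball x r \<subseteq> U" if "x \<in> U" for x
    using U that open_contains_cball by blast
  show "continuous_on U sol_rep"
  proof (rule continuous_at_imp_continuous_on, rule ballI)
    fix x assume "x \<in> U"
    then obtain r where r: "r > 0" "cball x r \<subseteq> U" using ex by blast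
    then have "continuous_on (ball x (r/2)) sol_rep" by (rule sol_rep_local(1))
    then show "isCont sol_rep x" using r(1) continuous_on_eq_continuous_at[OF open_ball] by (metis centre_in_ball half_gt_zero)
  qed
  define F where "F = {ball x (r/2) | x r. r > 0 \<and> cball x r \<subseteq> U}"
  have "\<And>S. S \<in> F \<Longrightarrow> open S" by (auto simp: F_def)
  then obtain F' where F': "F' \<subseteq> F" "countable F'" "\<Union>F' = \<Union>F" using Lindelof by metis
  have "AE x in lebesgue. \<forall>S\<in>F'. x \<in> S \<longrightarrow> \<phi> x = sol_rep x"
  proof (subst AE_ball_countable[OF F'(2)], rule ballI)
    fix S assume "S \<in> F'"
    then obtain x r where S: "S = ball x (r/2)" "r > 0" "cball x r \<subseteq> U" using F'(1) by (auto simp: F_def)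
    show "AE x in lebesgue. x \<in> S \<longrightarrow> \<phi> x = sol_rep x"
      using sol_rep_local(2)[OF S(2,3)] unfolding S(1) by (subst (asm) AE_lebesgue_on_iff[OF open_ball])
  qed
  then have "AE x in lebesgue. x \<in> U \<longrightarrow> \<phi> x = sol_rep x"
  proof eventually_elim
    case (elim x)
    show ?case
    proof
      assume "x \<in> U"
      then obtain r where r: "r > 0" "cball x r \<subseteq> U" using ex by blast
      then have "x \<in> ball x (r/2)" "ball x (r/2) \<in> F" unfolding F_def by (simp, blast)
      then show "\<phi> x = sol_rep x" using elim F'(3) by blast
    qed
  qed
  then show "AE x in lebesgue_on U. \<phi> x = sol_rep x" by (subst AE_lebesgue_on_iff[OF U])
qed

text \<open>Jensen's inequality, from the tangent line of the exponential at the mollified value.\<close>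

lemma mollify_Jensen:
  assumes x: "cball x ((1/2)^k) \<subseteq> U"
  shows "exp (- mollify k \<phi> x) \<le> (\<integral>z. exp (- \<phi> z) * mollifier k (x - z) \<partial>lebesgue)"
proof -
  note t = test_fun_mollifier[OF x]
  let ?a = "mollify k \<phi> x"
  have mm: "mollifier k (x - z) = mollifier k (z - x)" for z
    using mollifier_minus[of k "x - z"] by simp
  have i1: "integrable lebesgue (\<lambda>z. mollifier k (x - z))" "(\<integral>z. mollifier k (x - z) \<partial>lebesgue) = 1"
    unfolding mm by (rule mollifier_shift)+
  have i2: "integrable lebesgue (\<lambda>z. \<phi> z * mollifier k (x - z))"
    by (rule loc_integrable_mult_test[OF sol_loc_integrable t])
  have "(\<integral>z. exp (- ?a) * ((1 + ?a) * mollifier k (x - z) - \<phi> z * mollifier k (x - z)) \<partial>lebesgue)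
      \<le> (\<integral>z. exp (- \<phi> z) * mollifier k (x - z) \<partial>lebesgue)"
  proof (rule integral_mono)
    fix z
    have "1 + (?a - \<phi> z) \<le> exp (?a - \<phi> z)" by (rule exp_ge_add_one_self)
    then have "exp (- ?a) * (1 + (?a - \<phi> z)) \<le> exp (- ?a) * exp (?a - \<phi> z)" by (intro mult_left_mono) auto
    also have "\<dots> = exp (- \<phi> z)" by (simp flip: exp_add)
    finally have "exp (- ?a) * (1 + (?a - \<phi> z)) * mollifier k (x - z) \<le> exp (- \<phi> z) * mollifier k (x - z)"
      by (intro mult_right_mono mollifier_nonneg)
    then show "exp (- ?a) * ((1 + ?a) * mollifier k (x - z) - \<phi> z * mollifier k (x - z)) \<le> exp (- \<phi> z) * mollifier k (x - z)"
      by (simp add: algebra_simps)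
  qed (use i1 i2 loc_integrable_mult_test[OF sol_exp_loc_integrable t] in auto)
  moreover have "(\<integral>z. exp (- ?a) * ((1 + ?a) * mollifier k (x - z) - \<phi> z * mollifier k (x - z)) \<partial>lebesgue) =
      exp (- ?a) * ((1 + ?a) * 1 - ?a)"
    using i1 i2 by (simp add: mollify_def)
  ultimately show ?thesis by simp
qed

end

subsection \<open>Comparison on balls\<close>

text \<open>The barrier \<open>2 ln (a - \<bar>y + s b\<bar>\<^sup>2 / (8 a))\<close> along a line with unit direction \<open>b\<close>, written with
  \<open>A = \<bar>y\<bar>\<^sup>2\<close> and \<open>B = y \<bullet> b\<close>.\<close>

lemma barrier_derivatives:
  fixes a A B s :: real
  defines "q \<equiv> \<lambda>s. a - (A + 2 * s * B + s\<^sup>2) / (8 * a)"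
  assumes "a > 0" "q s > 0"
  shows "((\<lambda>s. 2 * ln (q s)) has_real_derivative - (B + s) / (2 * a * q s)) (at s)"
    and "((\<lambda>s. - (B + s) / (2 * a * q s)) has_real_derivative
           - 1 / (2 * a * q s) - (B + s)\<^sup>2 / (8 * a\<^sup>2 * (q s)\<^sup>2)) (at s)"
proof -
  have q: "(q has_real_derivative - (B + s) / (4 * a)) (at s)"
    unfolding q_def using assms(2) by (auto intro!: derivative_eq_intros simp: field_simps)
  show "((\<lambda>s. 2 * ln (q s)) has_real_derivative - (B + s) / (2 * a * q s)) (at s)"
    using assms(2,3) by (auto intro!: derivative_eq_intros q simp: field_simps)
  show "((\<lambda>s. - (B + s) / (2 * a * q s)) has_real_derivative
           - 1 / (2 * a * q s) - (B + s)\<^sup>2 / (8 * a\<^sup>2 * (q s)\<^sup>2)) (at s)"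
    using assms(2,3) by (auto intro!: derivative_eq_intros q simp: field_simps power2_eq_square)
qed

text \<open>Comparison of a mollified solution with the explicit barrier \<open>w\<close> on a ball of radius \<open>s\<close>. The extra
  radius \<open>2^(-k)\<close> leaves room for the mollification.\<close>

lemma mollify_lower_bound:
  assumes U: "open U" and sol: "distributional_solution U \<phi>"
    and nonneg: "AE x in lebesgue_on U. 0 \<le> \<phi> x"
    and s: "s > 0" and sub: "cball x0 (s + (1/2)^k) \<subseteq> U"
  shows "ln (1 + s\<^sup>2 / 8) \<le> mollify k \<phi> x0"
proof -
  define r where "r = s + (1/2)^k"
  define g where "g = (\<lambda>z. indicator (cball x0 r) z * \<phi> z)"
  have g: "integrable lebesgue g"
    unfolding g_def r_def by (rule localized_integrable[OF U sol nonneg sub])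
  define u where "u = mollify k g"
  have u: "u x = mollify k \<phi> x" if "x \<in> cball x0 s" for x
    unfolding u_def g_def using that by (intro mollify_localize) (simp add: r_def)
  have ucont: "continuous_on UNIV u" unfolding u_def by (rule continuous_mollify[OF g])
  have subx: "cball x ((1/2)^k) \<subseteq> U" if "x \<in> cball x0 s" for x
  proof -
    have "cball x ((1/2)^k) \<subseteq> cball x0 (s + (1/2)^k)"
      using that by (intro cball_subset_cball_iff[THEN iffD2]) (auto simp: dist_commute)
    then show ?thesis using sub by blast
  qed
  have nn: "AE x in lebesgue. x \<in> U \<longrightarrow> 0 \<le> \<phi> x"
    using nonneg by (subst (asm) AE_lebesgue_on_iff[OF U])
  have u0: "u x \<ge> 0" for x
    unfolding u_def mollify_def
  proof (rule integral_nonneg_AE)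
    show "AE z in lebesgue. 0 \<le> g z * mollifier k (x - z)"
      using nn
    proof eventually_elim
      case (elim z)
      then have "0 \<le> g z" using sub by (auto simp: g_def r_def indicator_def)
      then show ?case using mollifier_nonneg by (rule mult_nonneg_nonneg)
    qed
  qed
  \<comment> \<open>The positive root of \<open>a\<^sup>2 = a + s\<^sup>2 / 8\<close>, for which the barrier vanishes on the boundary.\<close>
  define a where "a = (1 + sqrt (1 + s\<^sup>2 / 2)) / 2"
  have a: "a \<ge> 1" by (simp add: a_def)
  have a2: "a\<^sup>2 = a + s\<^sup>2 / 8"
  proof -
    have "(sqrt (1 + s\<^sup>2 / 2))\<^sup>2 = 1 + s\<^sup>2 / 2" by simp
    then show ?thesis by (simp add: a_def power2_eq_square algebra_simps add_divide_distrib)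
  qed
  define q where "q x = a - ((x - x0) \<bullet> (x - x0)) / (8 * a)" for x :: "real \<times> real"
  have q1: "q x \<ge> 1" if "x \<in> cball x0 s" for x
  proof -
    have "(x - x0) \<bullet> (x - x0) \<le> s\<^sup>2"
      using that by (simp add: dot_square_norm dist_norm norm_minus_commute power_mono)
    then have "((x - x0) \<bullet> (x - x0)) / (8 * a) \<le> s\<^sup>2 / (8 * a)" using a by (intro divide_right_mono) auto
    also have "\<dots> = a - 1" using a a2 by (simp add: field_simps power2_eq_square)
    finally show ?thesis by (simp add: q_def)
  qed
  define w where "w x = 2 * ln (q x)" for x
  have cont: "continuous_on (cball x0 s) (\<lambda>x. u x - w x)"
  proof -
    have "continuous_on (cball x0 s) q" unfolding q_def[abs_def] using a by (intro continuous_intros) auto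
    then show ?thesis
      unfolding w_def[abs_def] using q1 continuous_on_subset[OF ucont]
      by (intro continuous_intros) force+
  qed
  have "u x0 \<ge> w x0"
  proof (rule ccontr)
    assume "\<not> u x0 \<ge> w x0"
    then have neg: "u x0 - w x0 < 0" by simp
    obtain x1 where x1: "x1 \<in> cball x0 s" "\<And>x. x \<in> cball x0 s \<Longrightarrow> u x1 - w x1 \<le> u x - w x"
      using continuous_attains_inf[OF compact_cball _ cont] s by auto
    have neg1: "u x1 - w x1 < 0" using x1(2)[of x0] neg s by simp
    \<comment> \<open>On the boundary the barrier is 0 and \<open>u \<ge> 0\<close>, so the minimum is attained inside.\<close>
    have inner: "dist x0 x1 < s"
    proof (rule ccontr)
      assume "\<not> dist x0 x1 < s"
      then have "norm (x1 - x0) = s" using x1(1) by (simp add: dist_norm norm_minus_commute)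
      then have "q x1 = a - s\<^sup>2 / (8 * a)" by (simp add: q_def dot_square_norm)
      also have "\<dots> = 1" using a a2 by (simp add: field_simps power2_eq_square)
      finally show False using neg1 u0[of x1] by (simp add: w_def)
    qed
    define d where "d = (s - dist x0 x1) / 2"
    have d: "d > 0" using inner by (simp add: d_def)
    let ?y = "x1 - x0"
    let ?Q = "q x1"
    have Q: "?Q \<ge> 1" using q1[OF x1(1)] .
    define t where "t n = 1 / real (Suc n)" for n
    have t: "t n > 0" "t \<longlonglongrightarrow> 0" for n
      using LIMSEQ_inverse_real_of_nat by (auto simp: t_def[abs_def] inverse_eq_divide)
    have line: "x1 + \<sigma> *\<^sub>R b \<in> cball x0 s" if "b \<in> Basis" "\<bar>\<sigma>\<bar> \<le> d" for b \<sigma>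
    proof -
      have "dist x0 (x1 + \<sigma> *\<^sub>R b) \<le> dist x0 x1 + \<bar>\<sigma>\<bar>"
        using dist_triangle[of x0 "x1 + \<sigma> *\<^sub>R b" x1] that(1) by (simp add: dist_norm)
      then show ?thesis using that(2) d unfolding d_def by simp
    qed
    \<comment> \<open>At the minimum of \<open>u - w\<close> the second differences of \<open>u\<close> dominate those of \<open>w\<close>.\<close>
    have second: "- 1 / (2 * a * ?Q) - (?y \<bullet> b)\<^sup>2 / (8 * a\<^sup>2 * ?Q\<^sup>2)
        \<le> (\<integral>z. g z * partial b (partial b (mollifier k)) (x1 - z) \<partial>lebesgue)" if b: "b \<in> Basis" for b
    proof -
      define p where "p \<sigma> = a - (?y \<bullet> ?y + 2 * \<sigma> * (?y \<bullet> b) + \<sigma>\<^sup>2) / (8 * a)" for \<sigma>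
      have p: "q (x1 + \<sigma> *\<^sub>R b) = p \<sigma>" for \<sigma>
      proof -
        have "(x1 + \<sigma> *\<^sub>R b) - x0 = ?y + \<sigma> *\<^sub>R b" by simp
        then have "((x1 + \<sigma> *\<^sub>R b) - x0) \<bullet> ((x1 + \<sigma> *\<^sub>R b) - x0) = ?y \<bullet> ?y + 2 * \<sigma> * (?y \<bullet> b) + \<sigma>\<^sup>2 * (b \<bullet> b)"
          by (simp only: inner_add_left inner_add_right inner_scaleR_left inner_scaleR_right inner_commute[of b ?y])
             (simp add: algebra_simps power2_eq_square)
        then show ?thesis using b by (simp add: q_def p_def)
      qed
      have ppos: "p \<sigma> > 0" if "\<bar>\<sigma>\<bar> \<le> d" for \<sigma>
        using q1[OF line[OF b that]] unfolding p by linarith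
      have p0: "p 0 = ?Q" using p[of 0] by simp
      let ?w'' = "\<lambda>\<sigma>. - 1 / (2 * a * p \<sigma>) - (?y \<bullet> b + \<sigma>)\<^sup>2 / (8 * a\<^sup>2 * (p \<sigma>)\<^sup>2)"
      have limw: "(\<lambda>n. (2 * ln (p (t n)) + 2 * ln (p (- t n)) - 2 * (2 * ln (p 0))) / (t n)\<^sup>2) \<longlonglongrightarrow> ?w'' 0"
      proof (rule second_difference_limit[where d=d and w="\<lambda>\<sigma>. 2 * ln (p \<sigma>)" and w'="\<lambda>\<sigma>. - (?y \<bullet> b + \<sigma>) / (2 * a * p \<sigma>)" and w''="?w''"])
        show "((\<lambda>\<sigma>. 2 * ln (p \<sigma>)) has_real_derivative - (?y \<bullet> b + \<sigma>) / (2 * a * p \<sigma>)) (at \<sigma>)" if "\<bar>\<sigma>\<bar> \<le> d" for \<sigma>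
          using barrier_derivatives(1)[of a "?y \<bullet> ?y" \<sigma> "?y \<bullet> b"] a ppos[OF that] unfolding p_def by simp
        show "((\<lambda>\<sigma>. - (?y \<bullet> b + \<sigma>) / (2 * a * p \<sigma>)) has_real_derivative ?w'' \<sigma>) (at \<sigma>)" if "\<bar>\<sigma>\<bar> \<le> d" for \<sigma>
          using barrier_derivatives(2)[of a "?y \<bullet> ?y" \<sigma> "?y \<bullet> b"] a ppos[OF that] unfolding p_def by simp
        have "isCont p 0" unfolding p_def[abs_def] using a by (intro continuous_intros) auto
        then show "isCont ?w'' 0" using a ppos[of 0] d by (intro continuous_intros) auto
      qed (use d t in auto)
      have limu: "(\<lambda>n. (u (x1 + t n *\<^sub>R b) + u (x1 - t n *\<^sub>R b) - 2 * u x1) / (t n)\<^sup>2)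
           \<longlonglongrightarrow> (\<integral>z. g z * partial b (partial b (mollifier k)) (x1 - z) \<partial>lebesgue)"
        unfolding u_def mollify_def[abs_def] t_def
      proof (rule convolution_second_difference[OF g _ b])
        show "test_fun UNIV (mollifier k)"
          by (rule test_funI[of _ "cball 0 ((1/2)^k)"]) (auto intro: smooth_mollifier mollifier_outside)
      qed
      have ev: "\<forall>\<^sub>F n in sequentially. t n < d" using order_tendstoD(2)[OF t(2) d] .
      then obtain N where N: "\<And>n. n \<ge> N \<Longrightarrow> t n < d" unfolding eventually_sequentially by blast
      have "?w'' 0 \<le> (\<integral>z. g z * partial b (partial b (mollifier k)) (x1 - z) \<partial>lebesgue)"
      proof (rule LIMSEQ_le[OF limw limu], intro exI allI impI)
        fix n assume "n \<ge> N"
        then have tn: "\<bar>t n\<bar> \<le> d" "\<bar>- t n\<bar> \<le> d" using N[of n] t(1)[of n] by auto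
        have m: "x1 + (- t n) *\<^sub>R b = x1 - t n *\<^sub>R b" by simp
        have "u x1 - w x1 \<le> u (x1 + t n *\<^sub>R b) - 2 * ln (p (t n))"
          using x1(2)[OF line[OF b tn(1)]] by (simp add: w_def p)
        moreover have "u x1 - w x1 \<le> u (x1 - t n *\<^sub>R b) - 2 * ln (p (- t n))"
          using x1(2)[OF line[OF b tn(2)]] unfolding w_def p unfolding m .
        moreover have "w x1 = 2 * ln (p 0)" by (simp add: w_def p0)
        ultimately show "(2 * ln (p (t n)) + 2 * ln (p (- t n)) - 2 * (2 * ln (p 0))) / (t n)\<^sup>2 \<le>
            (u (x1 + t n *\<^sub>R b) + u (x1 - t n *\<^sub>R b) - 2 * u x1) / (t n)\<^sup>2"
          by (intro divide_right_mono) auto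
      qed
      then show ?thesis by (simp add: p0)
    qed
    let ?\<eta> = "\<lambda>z. mollifier k (x1 - z)"
    have \<eta>: "test_fun U ?\<eta>" by (rule test_fun_mollifier[OF subx[OF x1(1)]])
    have lap\<eta>: "laplacian ?\<eta> z = laplacian (mollifier k) (x1 - z)" for z
      by (rule laplacian_shifted[OF smooth_mollifier])
    have tb: "test_fun UNIV (partial b (partial b (mollifier k)))" if "b \<in> Basis" for b
    proof -
      have "test_fun UNIV (mollifier k)"
        by (rule test_funI[of _ "cball 0 ((1/2)^k)"]) (auto intro: smooth_mollifier mollifier_outside)
      then show ?thesis using that by (intro test_fun_partial)
    qed
    \<comment> \<open>Summing over the two coordinate directions gives \<open>\<Delta> w = - exp (- w)\<close> on the left.\<close>
    have "- 1 / ?Q\<^sup>2 = (\<Sum>b\<in>(Basis::(real \<times> real) set). - 1 / (2 * a * ?Q) - (?y \<bullet> b)\<^sup>2 / (8 * a\<^sup>2 * ?Q\<^sup>2))"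
    proof -
      have "(\<Sum>b\<in>(Basis::(real \<times> real) set). - 1 / (2 * a * ?Q) - (?y \<bullet> b)\<^sup>2 / (8 * a\<^sup>2 * ?Q\<^sup>2)) =
          - 1 / (a * ?Q) - (\<Sum>b\<in>(Basis::(real \<times> real) set). (?y \<bullet> b)\<^sup>2) / (8 * a\<^sup>2 * ?Q\<^sup>2)"
        by (simp add: sum_subtractf sum_divide_distrib)
      also have "(\<Sum>b\<in>(Basis::(real \<times> real) set). (?y \<bullet> b)\<^sup>2) = ?y \<bullet> ?y"
        by (simp add: euclidean_inner[of ?y ?y] power2_eq_square)
      also have "?y \<bullet> ?y = 8 * a * (a - ?Q)" using a by (simp add: q_def)
      also have "- 1 / (a * ?Q) - 8 * a * (a - ?Q) / (8 * a\<^sup>2 * ?Q\<^sup>2) = - 1 / ?Q\<^sup>2"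
        using a Q by (simp add: field_simps power2_eq_square)
      finally show ?thesis by simp
    qed
    also have "\<dots> \<le> (\<Sum>b\<in>(Basis::(real \<times> real) set). \<integral>z. g z * partial b (partial b (mollifier k)) (x1 - z) \<partial>lebesgue)"
      by (rule sum_mono) (rule second)
    also have "\<dots> = (\<integral>z. (\<Sum>b\<in>(Basis::(real \<times> real) set). g z * partial b (partial b (mollifier k)) (x1 - z)) \<partial>lebesgue)"
    proof (rule Bochner_Integration.integral_sum[symmetric])
      fix b :: "real \<times> real" assume b: "b \<in> Basis"
      obtain K where K: "smooth (partial b (partial b (mollifier k)))" "compact K"
          "\<And>x. x \<notin> K \<Longrightarrow> partial b (partial b (mollifier k)) x = 0"
        using test_funE[OF tb[OF b]] by metis
      obtain M where M: "\<And>x. \<bar>partial b (partial b (mollifier k)) x\<bar> \<le> M"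
        using continuous_compact_support_bounded[OF smooth_continuous[OF K(1)] K(2,3)] by metis
      show "integrable lebesgue (\<lambda>z. g z * partial b (partial b (mollifier k)) (x1 - z))"
        by (rule integrable_mult_bounded_continuous[OF g continuous_reflect_shift[OF smooth_continuous[OF K(1)]] M])
    qed
    also have "\<dots> = (\<integral>z. \<phi> z * laplacian ?\<eta> z \<partial>lebesgue)"
    proof (rule Bochner_Integration.integral_cong)
      fix z
      have "(\<Sum>b\<in>(Basis::(real \<times> real) set). g z * partial b (partial b (mollifier k)) (x1 - z)) = g z * laplacian ?\<eta> z"
        unfolding lap\<eta> by (simp add: laplacian_def sum_distrib_left)
      also have "\<dots> = \<phi> z * laplacian ?\<eta> z"
      proof (cases "z \<in> cball x0 r")
        case False
        have "test_fun (cball x0 r) ?\<eta>"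
          using x1(1) by (intro test_fun_mollifier cball_subset_cball_iff[THEN iffD2]) (auto simp: r_def dist_commute)
        then obtain K where "K \<subseteq> cball x0 r" "\<And>x. x \<notin> K \<Longrightarrow> laplacian ?\<eta> x = 0"
          using test_funE[OF test_fun_laplacian] by metis
        then have "laplacian ?\<eta> z = 0" using False by blast
        then show ?thesis by simp
      qed (simp add: g_def)
      finally show "(\<Sum>b\<in>(Basis::(real \<times> real) set). g z * partial b (partial b (mollifier k)) (x1 - z)) = \<phi> z * laplacian ?\<eta> z" .
    qed simp
    also have "\<dots> = - (\<integral>z. exp (- \<phi> z) * ?\<eta> z \<partial>lebesgue)"
      by (rule sol_test[OF U sol nonneg \<eta>])
    also have "\<dots> \<le> - exp (- mollify k \<phi> x1)"
      using mollify_Jensen[OF U sol nonneg subx[OF x1(1)]] by simp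
    finally have "exp (- u x1) \<le> 1 / ?Q\<^sup>2" using u[OF x1(1)] by simp
    also have "1 / ?Q\<^sup>2 = exp (- w x1)"
      using Q by (simp add: w_def exp_minus exp_double inverse_eq_divide)
    finally show False using neg1 by simp
  qed
  moreover have "ln (1 + s\<^sup>2 / 8) \<le> w x0"
  proof -
    have "w x0 = ln (a\<^sup>2)" using a by (simp add: w_def q_def ln_realpow)
    moreover have "1 + s\<^sup>2 / 8 \<le> a\<^sup>2" using a a2 by simp
    moreover have "0 < 1 + s\<^sup>2 / 8" by (simp add: add_pos_nonneg)
    ultimately show ?thesis by (metis ln_mono)
  qed
  ultimately show ?thesis using u[of x0] s by simp
qed

text \<open>Apply the comparison on balls of radius \<open>s < d\<close>, let \<open>k\<close> tend to infinity and then \<open>s\<close> to \<open>d\<close>.\<close>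

theorem interior_lower_bound:
  fixes U :: "(real \<times> real) set" and \<phi> :: "real \<times> real \<Rightarrow> real"
  assumes U: "open U" and sol: "distributional_solution U \<phi>"
    and nonneg: "AE x in lebesgue_on U. 0 \<le> \<phi> x"
  shows "\<exists>\<psi>. continuous_representative U \<phi> \<psi> \<and>
           (\<forall>x d. d > 0 \<and> ball x d \<subseteq> U \<longrightarrow> ln (1 + d\<^sup>2 / 8) \<le> \<psi> x)"
proof (intro exI conjI allI impI)
  show "continuous_representative U \<phi> (sol_rep \<phi>)"
    by (rule sol_rep_representative[OF U sol nonneg])
  fix x :: "real \<times> real" and d :: real
  assume d: "d > 0 \<and> ball x d \<subseteq> U"
  have lim: "(\<lambda>k. mollify k \<phi> x) \<longlonglongrightarrow> sol_rep \<phi> x"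
  proof (rule sol_rep_local(3)[OF U sol nonneg])
    have "cball x (d / 2) \<subseteq> ball x d" using d by auto
    then show "d / 2 > 0" "cball x (d / 2) \<subseteq> U" using d by auto
  qed
  have inner: "ln (1 + s\<^sup>2 / 8) \<le> sol_rep \<phi> x" if s: "0 < s" "s < d" for s
  proof (rule LIMSEQ_le_const[OF lim])
    obtain N where N: "(1/2::real)^N < d - s" using real_arch_pow_inv[of "d - s" "1/2"] s by auto
    show "\<exists>N. \<forall>k\<ge>N. ln (1 + s\<^sup>2 / 8) \<le> mollify k \<phi> x"
    proof (intro exI allI impI)
      fix k assume "k \<ge> N"
      then have "(1/2::real)^k < d - s" using N power_decreasing[of N k "1/2::real"] by linarith
      then have "cball x (s + (1/2)^k) \<subseteq> ball x d" by auto
      then show "ln (1 + s\<^sup>2 / 8) \<le> mollify k \<phi> x"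
        using d by (intro mollify_lower_bound[OF U sol nonneg s(1)]) blast
    qed
  qed
  have "((\<lambda>s. ln (1 + s\<^sup>2 / 8)) \<longlongrightarrow> ln (1 + d\<^sup>2 / 8)) (at_left d)"
    by (intro tendsto_intros) (auto simp: add_pos_nonneg intro!: less_imp_neq[symmetric])
  moreover have "\<forall>\<^sub>F s in at_left d. ln (1 + s\<^sup>2 / 8) \<le> sol_rep \<phi> x"
    using eventually_at_left_real[of 0 d] d inner by (auto elim!: eventually_mono)
  ultimately show "ln (1 + d\<^sup>2 / 8) \<le> sol_rep \<phi> x"
    by (rule tendsto_upperbound) simp
qed

theorem proposition4p3:
  fixes \<theta>\<^sub>0 :: real and \<phi> :: "real \<times> real \<Rightarrow> real"
  assumes "0 < \<theta>\<^sub>0" and "\<theta>\<^sub>0 < pi / 2"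
    and "AE x in lebesgue_on (sector \<theta>\<^sub>0). \<phi> x \<ge> 0"
    and "local_variational_solution \<theta>\<^sub>0 \<phi> \<or> very_weak_solution \<theta>\<^sub>0 \<phi>"
  shows "\<exists>\<psi>. continuous_representative (sector \<theta>\<^sub>0) \<phi> \<psi> \<and>
           (\<forall>r \<theta>. r > 0 \<and> \<bar>\<theta>\<bar> < \<theta>\<^sub>0 \<longrightarrow>
              \<psi> (r * cos \<theta>, r * sin \<theta>) \<ge> ln (1 + 1 / 8 * r\<^sup>2 * (sin (\<theta>\<^sub>0 - \<bar>\<theta>\<bar>))\<^sup>2))"
proof -
  note op = open_sector[OF assms(1,2)]
  have "distributional_solution (sector \<theta>\<^sub>0) \<phi>"
    using assms(4) variational_imp_distributional[OF op] very_weak_imp_distributional[OF op] by blast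
  from interior_lower_bound[OF op this assms(3)] obtain \<psi> where
    \<psi>: "continuous_representative (sector \<theta>\<^sub>0) \<phi> \<psi>"
      "\<And>x d. d > 0 \<Longrightarrow> ball x d \<subseteq> sector \<theta>\<^sub>0 \<Longrightarrow> ln (1 + d\<^sup>2 / 8) \<le> \<psi> x"
    by blast
  have "ln (1 + 1 / 8 * r\<^sup>2 * (sin (\<theta>\<^sub>0 - \<bar>\<theta>\<bar>))\<^sup>2) \<le> \<psi> (r * cos \<theta>, r * sin \<theta>)"
    if r: "r > 0" "\<bar>\<theta>\<bar> < \<theta>\<^sub>0" for r \<theta>
  proof -
    have "0 < sin (\<theta>\<^sub>0 - \<bar>\<theta>\<bar>)" using r assms(1,2) by (intro sin_gt_zero) auto
    then have "r * sin (\<theta>\<^sub>0 - \<bar>\<theta>\<bar>) > 0" using r by simp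
    from \<psi>(2)[OF this ball_subset_sector[OF assms(1,2) r]] show ?thesis
      by (simp add: power_mult_distrib)
  qed
  then show ?thesis using \<psi>(1) by blast
qed

end
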